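(* Let $\alpha,\beta\in\mathbb{R}$, let $s>\frac12$, and let $(u,v)\in C([0,\infty),H^s(\mathbb{R}))$ be any solution of the Cauchy problem $$i(u_t+u_x)=N_1(u,v),\qquad i(v_t-v_x)=N_2(u,v),\qquad (u,v)|_{t=0}=(u_0,v_0),$$ where $N_1,N_2$ are the cubic nonlinearities given in the context. For $y\in\mathbb{R}$ define $$G_1(y)=-i\int_0^\infty N_1\big(u(y+\tau,\tau),v(y+\tau,\tau)\big)\,d\tau,\qquad G_2(y)=-i\int_0^\infty N_2\big(u(y-\tau,\tau),v(y-\tau,\tau)\big)\,d\tau .$$ Then $$\lim_{t\to\infty}\int_{-\infty}^\infty |u(x,t)-u_0(x-t)-G_1(x-t)|^2\,dx=0,\qquad \lim_{t\to\infty}\int_{-\infty}^\infty |v(x,t)-v_0(x+t)-G_2(x+t)|^2\,dx=0 .$$ Moreover, $$\lim_{t\to\infty}\sup_{x\in\mathbb{R}}|u(x,t)-u_0(x-t)-G_1(x-t)|=0,\qquad \lim_{t\to\infty}\sup_{x\in\mathbb{R}}|v(x,t)-v_0(x+t)-G_2(x+t)|=0 .$$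
   Context: The unknowns $u=u(x,t)$, $v=v(x,t)$ are complex valued, with $x\in\mathbb{R}$, $t\ge 0$. The nonlinear terms are $N_1=\partial_{\overline u}W$, $N_2=\partial_{\overline v}W$ with $W(u,v)=\alpha|u|^2|v|^2+\beta(\overline u v+u\overline v)^2$, $\alpha,\beta\in\mathbb{R}$; explicitly $$N_1(u,v)=\alpha u|v|^2+2\beta v(\overline u v+u\overline v),\qquad N_2(u,v)=\alpha |u|^2v+2\beta u(\overline u v+u\overline v).$$ $H^s(\mathbb{R})$ is the usual $L^2$-based Sobolev space. A solution $(u,v)\in C([0,\infty),H^s(\mathbb{R}))$ satisfies the equations in the sense of distributions (equivalently, it also lies in $C^1([0,\infty),H^{s-1}(\mathbb{R}))$ and the equations hold in $H^{s-1}$ for each $t$) and has initial value $(u_0,v_0)\in H^s(\mathbb{R})$; since $s>\frac12$, $u$ and $v$ are taken to be their continuous representatives. *)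

theory Defs
  imports "HOL-Analysis.Analysis"
begin

subsection \<open>Sobolev spaces on the real line\<close>

definition L2 :: "(real \<Rightarrow> complex) \<Rightarrow> bool" where
  "L2 f \<longleftrightarrow> f \<in> borel_measurable lborel \<and> integrable lborel (\<lambda>x. (cmod (f x))\<^sup>2)"

text \<open>
  The Fourier--Plancherel transform with its unitary normalisation: \<open>g\<close> is the limit in mean square
  of the transforms of the truncations of \<open>f\<close>. It is determined only almost everywhere, hence a
  relation.
\<close>

definition has_fourier_L2 :: "(real \<Rightarrow> complex) \<Rightarrow> (real \<Rightarrow> complex) \<Rightarrow> bool" where
  "has_fourier_L2 f g \<longleftrightarrow> L2 f \<and> L2 g \<and>
     ((\<lambda>R::real. \<integral>\<^sup>+ \<xi>. ennreal ((cmod (g \<xi>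
          - complex_of_real (1 / sqrt (2 * pi)) *
              (LINT x:{-R..R}|lborel. cis (- (x * \<xi>)) * f x)))\<^sup>2) \<partial>lborel)
      \<longlongrightarrow> 0) at_top"

definition fourier_L2 :: "(real \<Rightarrow> complex) \<Rightarrow> real \<Rightarrow> complex" where
  "fourier_L2 f = (SOME g. has_fourier_L2 f g)"

text \<open>
  \<open>in_Hs s f\<close> describes $H^s(\mathbb{R})$ as a subspace of $L^2(\mathbb{R})$, so it is meant for
  \<open>s \<ge> 0\<close> only. The choice made in \<open>fourier_L2\<close> does not affect the norm.
\<close>

definition in_Hs :: "real \<Rightarrow> (real \<Rightarrow> complex) \<Rightarrow> bool" where
  "in_Hs s f \<longleftrightarrow> (\<exists>g. has_fourier_L2 f g \<and>
     integrable lborel (\<lambda>\<xi>. (1 + \<xi>\<^sup>2) powr s * (cmod (g \<xi>))\<^sup>2))"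

definition Hs_norm :: "real \<Rightarrow> (real \<Rightarrow> complex) \<Rightarrow> real" where
  "Hs_norm s f = sqrt (LINT \<xi>|lborel. (1 + \<xi>\<^sup>2) powr s * (cmod (fourier_L2 f \<xi>))\<^sup>2)"

text \<open>
  Space-time functions take the arguments in the order \<open>x\<close>, \<open>t\<close>; their values at negative times are
  irrelevant. In the next definition each element of $H^s$ is represented by its continuous
  representative, which exists for \<open>s > 1/2\<close>.
\<close>

definition C_Hs :: "real \<Rightarrow> (real \<Rightarrow> real \<Rightarrow> complex) \<Rightarrow> bool" where
  "C_Hs s u \<longleftrightarrow>
     (\<forall>t\<ge>0. in_Hs s (\<lambda>x. u x t) \<and> continuous_on UNIV (\<lambda>x. u x t)) \<and>
     (\<forall>t0\<ge>0. ((\<lambda>t. Hs_norm s (\<lambda>x. u x t - u x t0)) \<longlongrightarrow> 0) (at t0 within {0..}))"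


subsection \<open>Distributional solutions\<close>

definition dx :: "(real \<times> real \<Rightarrow> complex) \<Rightarrow> real \<times> real \<Rightarrow> complex" where
  "dx \<phi> p = vector_derivative (\<lambda>x. \<phi> (x, snd p)) (at (fst p))"

definition dt :: "(real \<times> real \<Rightarrow> complex) \<Rightarrow> real \<times> real \<Rightarrow> complex" where
  "dt \<phi> p = vector_derivative (\<lambda>t. \<phi> (fst p, t)) (at (snd p))"

primrec Ck :: "nat \<Rightarrow> (real \<times> real \<Rightarrow> complex) \<Rightarrow> bool" where
  "Ck 0 \<phi> \<longleftrightarrow> continuous_on UNIV \<phi>"
| "Ck (Suc k) \<phi> \<longleftrightarrow> (\<forall>p. \<phi> differentiable (at p)) \<and> Ck k (dx \<phi>) \<and> Ck k (dt \<phi>)"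

text \<open>The space $C_c^\infty(\mathbb{R} \times (0,\infty))$, extended by zero to the plane.\<close>

definition test_function :: "(real \<times> real \<Rightarrow> complex) \<Rightarrow> bool" where
  "test_function \<phi> \<longleftrightarrow> (\<forall>k. Ck k \<phi>) \<and> compact (closure {p. \<phi> p \<noteq> 0}) \<and>
     closure {p. \<phi> p \<noteq> 0} \<subseteq> UNIV \<times> {0<..}"

text \<open>
  The equation $i(w_t + c\,w_x) = F$ in $\mathcal{D}'(\mathbb{R} \times (0,\infty))$, with the bilinear
  pairing of distributions and test functions.
\<close>

definition transport_eq ::
  "real \<Rightarrow> (real \<Rightarrow> real \<Rightarrow> complex) \<Rightarrow> (real \<Rightarrow> real \<Rightarrow> complex) \<Rightarrow> bool" where
  "transport_eq c w F \<longleftrightarrow> (\<forall>\<phi>. test_function \<phi> \<longrightarrow>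
     (LINT p|lborel. - \<i> * w (fst p) (snd p) * (dt \<phi> p + complex_of_real c * dx \<phi> p))
       = (LINT p|lborel. F (fst p) (snd p) * \<phi> p))"

definition N1 :: "real \<Rightarrow> real \<Rightarrow> complex \<Rightarrow> complex \<Rightarrow> complex" where
  "N1 \<alpha> \<beta> u v = complex_of_real \<alpha> * u * complex_of_real ((cmod v)\<^sup>2)
     + 2 * complex_of_real \<beta> * v * (cnj u * v + u * cnj v)"

definition N2 :: "real \<Rightarrow> real \<Rightarrow> complex \<Rightarrow> complex \<Rightarrow> complex" where
  "N2 \<alpha> \<beta> u v = complex_of_real \<alpha> * complex_of_real ((cmod u)\<^sup>2) * v
     + 2 * complex_of_real \<beta> * u * (cnj u * v + u * cnj v)"

definition is_solution :: "real \<Rightarrow> real \<Rightarrow> real \<Rightarrow> (real \<Rightarrow> complex) \<Rightarrow> (real \<Rightarrow> complex) \<Rightarrow>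
    (real \<Rightarrow> real \<Rightarrow> complex) \<Rightarrow> (real \<Rightarrow> real \<Rightarrow> complex) \<Rightarrow> bool" where
  "is_solution \<alpha> \<beta> s u0 v0 u v \<longleftrightarrow>
     in_Hs s u0 \<and> in_Hs s v0 \<and> C_Hs s u \<and> C_Hs s v \<and>
     transport_eq 1 u (\<lambda>x t. N1 \<alpha> \<beta> (u x t) (v x t)) \<and>
     transport_eq (-1) v (\<lambda>x t. N2 \<alpha> \<beta> (u x t) (v x t)) \<and>
     (\<forall>x. u x 0 = u0 x) \<and> (\<forall>x. v x 0 = v0 x)"


subsection \<open>Scattering profiles\<close>

definition G1 :: "real \<Rightarrow> real \<Rightarrow> (real \<Rightarrow> real \<Rightarrow> complex) \<Rightarrow> (real \<Rightarrow> real \<Rightarrow> complex) \<Rightarrow>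
    real \<Rightarrow> complex" where
  "G1 \<alpha> \<beta> u v y = - \<i> * (LINT \<tau>:{0..}|lborel. N1 \<alpha> \<beta> (u (y + \<tau>) \<tau>) (v (y + \<tau>) \<tau>))"

definition G2 :: "real \<Rightarrow> real \<Rightarrow> (real \<Rightarrow> real \<Rightarrow> complex) \<Rightarrow> (real \<Rightarrow> real \<Rightarrow> complex) \<Rightarrow>
    real \<Rightarrow> complex" where
  "G2 \<alpha> \<beta> u v y = - \<i> * (LINT \<tau>:{0..}|lborel. N2 \<alpha> \<beta> (u (y - \<tau>) \<tau>) (v (y - \<tau>) \<tau>))"

end

theory Submission
  imports Defs "HOL-Probability.Probability"
begin

text \<open>
  Since $s > 1/2$, Fourier inversion bounds the supremum norm by the $H^s$ norm, so $u$ and $v$ are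
  jointly continuous and $u_0, v_0$ are in $L^2$ and vanish at infinity. Testing the equations with
  products $a(x \mp t)\,b(t)$ shows that they hold in integrated form along every characteristic.
  The charge $|u|^2 + |v|^2$ is conserved, and integrating the conservation law over a characteristic
  triangle gives $2\int_0^\infty |v(y+\tau,\tau)|^2\,d\tau \le Q$, where $Q$ is the total charge.
  As $|N_1| \le K |u| |v|^2$, Gronwall's inequality along the characteristic yields
  $|u(y+t,t)|^2 \le e^{KQ} |u_0(y)|^2$, and likewise $|v(y-t,t)|^2 \le e^{KQ} |v_0(y)|^2$. Hence
  $|N_1|$ at $(y+\tau,\tau)$ is at most a constant times $|u_0(y)|\,|v_0(y+2\tau)|^2$, so the
  remainder $u(y+t,t) - u_0(y) - G_1(y)$ is bounded by a constant times
  $|u_0(y)| \int_{y+2t}^\infty |v_0|^2$. This tends to $0$ in $L^2$ by dominated convergence, and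
  uniformly because $u_0$ vanishes at infinity. The statement for $v$ follows by the reflection
  $x \mapsto -x$, which exchanges the two equations.
\<close>

subsection \<open>The Fourier--Plancherel transform and its inversion\<close>

text \<open>Two features of the setting shape the proof. A solution is known to be differentiable
  only along characteristics, u on x - t = const and v on x + t = const, so the conservation law is
  not integrated by a divergence theorem: in the coordinates x - t and x + t it becomes two
  one-dimensional fundamental theorems of calculus joined by Fubini. And the transform is given only
  as a mean-square limit, so pointwise inversion comes from pairing with Gaussians whose width tends
  to 0.

  The bound on N_1 is linear in u, and its coefficient |v|^2 is just what charge conservation
  controls along a u-characteristic; hence data of any size are covered. In exp(KQ) the factor 2
  from differentiating |u|^2 is absorbed by the 2 in front of the integral of |v|^2, which comes
  from eta = y + 2 tau.

  The factor |u_0(y)| in the final estimate matters: for fixed t the tail of |v_0|^2 beyond y + 2t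
  need not be small as y tends to -infinity, and there the decay and square integrability of u_0
  take over.\<close>

definition fourier_trunc :: "(real \<Rightarrow> complex) \<Rightarrow> real \<Rightarrow> real \<Rightarrow> complex" where
  "fourier_trunc f R \<xi> =
     complex_of_real (1 / sqrt (2 * pi)) * (LINT x:{-R..R}|lborel. cis (- (x * \<xi>)) * f x)"

lemma L2_measurable: "L2 f \<Longrightarrow> f \<in> borel_measurable borel"
  by (simp add: L2_def)

lemma L2_integrable_mult:
  assumes "L2 f" "L2 h"
  shows "integrable lborel (\<lambda>x. f x * h x)"
proof (rule Bochner_Integration.integrable_bound)
  show "integrable lborel (\<lambda>x. (cmod (f x))\<^sup>2 + (cmod (h x))\<^sup>2)"
    using assms by (auto simp: L2_def)
  have [measurable]: "f \<in> borel_measurable borel" "h \<in> borel_measurable borel"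
    using assms by (auto intro: L2_measurable)
  show "(\<lambda>x. f x * h x) \<in> borel_measurable lborel" by measurable
  have "cmod (f x) * cmod (h x) \<le> (cmod (f x))\<^sup>2 + (cmod (h x))\<^sup>2" for x
    using sum_squares_bound[of "cmod (f x)" "cmod (h x)"]
      mult_nonneg_nonneg[OF norm_ge_zero norm_ge_zero, of "f x" "h x"] by linarith
  then show "AE x in lborel. norm (f x * h x) \<le> norm ((cmod (f x))\<^sup>2 + (cmod (h x))\<^sup>2)"
    by (intro AE_I2) (simp add: norm_mult)
qed

text \<open>The indicator of a bounded interval is itself square integrable, so this is a product of
  two L2 functions. It makes \<open>fourier_trunc\<close> a convergent integral.\<close>

lemma L2_set_integrable:
  assumes "L2 f"
  shows "integrable lborel (\<lambda>x. indicator {-R..R} x *\<^sub>R f x)"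
proof -
  have "L2 (\<lambda>x. complex_of_real (indicator {-R..R} x))"
  proof -
    have "(cmod (complex_of_real (indicator {-R..R} x)))\<^sup>2 = indicator {-R..R} x" for x :: real
      by (simp add: indicator_def)
    moreover have "integrable lborel (indicator {-R..R} :: real \<Rightarrow> real)"
      using emeasure_compact_finite[of "{-R..R}"] by (intro integrable_real_indicator) auto
    ultimately show ?thesis by (simp add: L2_def del: integrable_indicator_iff)
  qed
  from L2_integrable_mult[OF this assms] show ?thesis
    by (simp add: scaleR_conv_of_real)
qed

lemma cmod_diff_sq_le: "(cmod (a - b))\<^sup>2 \<le> 2 * (cmod a)\<^sup>2 + 2 * (cmod b)\<^sup>2"
proof -
  have "(cmod (a - b))\<^sup>2 \<le> (cmod a + cmod b)\<^sup>2"
    by (intro power_mono norm_triangle_ineq4 norm_ge_zero)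
  also have "\<dots> \<le> 2 * (cmod a)\<^sup>2 + 2 * (cmod b)\<^sup>2"
    using sum_squares_bound[of "cmod a" "cmod b"] by (simp add: power2_sum)
  finally show ?thesis .
qed

lemma L2_diff:
  assumes "L2 f" "L2 h"
  shows "L2 (\<lambda>x. f x - h x)"
proof -
  have [measurable]: "f \<in> borel_measurable borel" "h \<in> borel_measurable borel"
    using assms by (auto intro: L2_measurable)
  have "integrable lborel (\<lambda>x. (cmod (f x - h x))\<^sup>2)"
  proof (rule Bochner_Integration.integrable_bound)
    show "integrable lborel (\<lambda>x. 2 * (cmod (f x))\<^sup>2 + 2 * (cmod (h x))\<^sup>2)"
      using assms by (auto simp: L2_def)
    show "(\<lambda>x. (cmod (f x - h x))\<^sup>2) \<in> borel_measurable lborel" by measurable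
    show "AE x in lborel. norm ((cmod (f x - h x))\<^sup>2) \<le> norm (2 * (cmod (f x))\<^sup>2 + 2 * (cmod (h x))\<^sup>2)"
      by (intro AE_I2) (simp add: cmod_diff_sq_le)
  qed
  then show ?thesis by (simp add: L2_def)
qed

lemma cis_measurable [measurable]: "cis \<in> borel_measurable borel"
  by (intro borel_measurable_continuous_onI continuous_on_cis continuous_on_id)

text \<open>Since \<open>cis\<close> has modulus one, the absolute value of the integrand factors
  into a function of the frequency and a function of y. This licenses Fubini in the next
  lemmas.\<close>

lemma fourier_trunc_pair_integrable:
  assumes "L2 f" "integrable lborel h"
  shows "integrable (lborel \<Otimes>\<^sub>M lborel)
    (\<lambda>(\<xi>, y). h \<xi> * (cis (- (y * \<xi>)) * (indicator {-R..R} y *\<^sub>R f y)))"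
proof (rule lborel_pair.Fubini_integrable)
  have [measurable]: "f \<in> borel_measurable borel" "h \<in> borel_measurable borel"
    using assms by (auto intro: L2_measurable)
  show "(\<lambda>(\<xi>, y). h \<xi> * (cis (- (y * \<xi>)) * (indicator {-R..R} y *\<^sub>R f y)))
      \<in> borel_measurable (lborel \<Otimes>\<^sub>M lborel)" by measurable
  have "integrable lborel (\<lambda>\<xi>. cmod (h \<xi>) * (LINT y|lborel. cmod (indicator {-R..R} y *\<^sub>R f y)))"
    using assms by (intro integrable_mult_left integrable_norm) auto
  then show "integrable lborel (\<lambda>\<xi>. LINT y|lborel. norm (case (\<xi>, y) of (\<xi>, y) \<Rightarrow>
      h \<xi> * (cis (- (y * \<xi>)) * (indicator {-R..R} y *\<^sub>R f y))))"
    by (simp only: case_prod_conv norm_mult norm_cis mult_1_left integral_mult_right_zero)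
  have "integrable lborel (\<lambda>y. cis (- (y * \<xi>)) * (indicator {-R..R} y *\<^sub>R f y))" for \<xi>
    by (rule Bochner_Integration.integrable_bound[OF L2_set_integrable[OF assms(1)]])
       (auto simp: norm_mult)
  then show "AE \<xi> in lborel. integrable lborel (\<lambda>y. case (\<xi>, y) of (\<xi>, y) \<Rightarrow>
      h \<xi> * (cis (- (y * \<xi>)) * (indicator {-R..R} y *\<^sub>R f y)))"
    by (intro AE_I2, unfold case_prod_conv, intro integrable_mult_right)
qed

lemma fourier_trunc_measurable [measurable]:
  assumes "L2 f"
  shows "fourier_trunc f R \<in> borel_measurable borel"
proof -
  have [measurable]: "f \<in> borel_measurable borel"
    using assms by (auto intro: L2_measurable)
  have "(\<lambda>\<xi>. LINT y|lborel. indicator {-R..R} y *\<^sub>R (cis (- (y * \<xi>)) * f y)) \<in> borel_measurable borel"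
    by measurable
  then show ?thesis
    unfolding fourier_trunc_def set_lebesgue_integral_def by measurable
qed

text \<open>Fubini moves the transform from the truncation of f onto h; \<open>k\<close> is the
  transform of h in the unitary normalisation.\<close>

lemma integral_fourier_trunc_mult:
  assumes "L2 f" "integrable lborel h"
    and "\<And>y. (LINT \<xi>|lborel. cis (- (y * \<xi>)) * h \<xi>) = complex_of_real (sqrt (2 * pi)) * k y"
  shows "integrable lborel (\<lambda>\<xi>. fourier_trunc f R \<xi> * h \<xi>)"
    and "(LINT \<xi>|lborel. fourier_trunc f R \<xi> * h \<xi>) = (LINT y|lborel. indicator {-R..R} y *\<^sub>R (f y * k y))"
proof -
  let ?c = "complex_of_real (1 / sqrt (2 * pi))"
  note I = fourier_trunc_pair_integrable[OF assms(1,2), of R]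
  have eq: "fourier_trunc f R \<xi> * h \<xi> =
      ?c * (LINT y|lborel. h \<xi> * (cis (- (y * \<xi>)) * (indicator {-R..R} y *\<^sub>R f y)))" for \<xi>
    unfolding fourier_trunc_def set_lebesgue_integral_def integral_mult_right_zero
    by (simp add: mult_ac)
  show "integrable lborel (\<lambda>\<xi>. fourier_trunc f R \<xi> * h \<xi>)"
    unfolding eq using lborel_pair.integrable_fst[OF I] by (intro integrable_mult_right) auto
  have "(LINT \<xi>|lborel. fourier_trunc f R \<xi> * h \<xi>) =
      ?c * (LINT \<xi>|lborel. LINT y|lborel. h \<xi> * (cis (- (y * \<xi>)) * (indicator {-R..R} y *\<^sub>R f y)))"
    unfolding eq by simp
  also have "(LINT \<xi>|lborel. LINT y|lborel. h \<xi> * (cis (- (y * \<xi>)) * (indicator {-R..R} y *\<^sub>R f y)))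
     = (LINT y|lborel. LINT \<xi>|lborel. h \<xi> * (cis (- (y * \<xi>)) * (indicator {-R..R} y *\<^sub>R f y)))"
    using lborel_pair.Fubini_integral[OF I] by simp
  also have "\<dots> = (LINT y|lborel. LINT \<xi>|lborel. (indicator {-R..R} y *\<^sub>R f y) * (cis (- (y * \<xi>)) * h \<xi>))"
    by (simp add: mult_ac)
  also have "\<dots> = (LINT y|lborel. (indicator {-R..R} y *\<^sub>R f y) * (complex_of_real (sqrt (2 * pi)) * k y))"
    by (simp add: assms(3))
  also have "?c * \<dots> = (LINT y|lborel. ?c * ((indicator {-R..R} y *\<^sub>R f y) * (complex_of_real (sqrt (2 * pi)) * k y)))"
    by (rule integral_mult_right_zero[symmetric])
  also have "\<dots> = (LINT y|lborel. indicator {-R..R} y *\<^sub>R (f y * k y))"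
    by (intro Bochner_Integration.integral_cong) (auto simp: field_simps scaleR_conv_of_real simp flip: of_real_mult)
  finally show "(LINT \<xi>|lborel. fourier_trunc f R \<xi> * h \<xi>) = (LINT y|lborel. indicator {-R..R} y *\<^sub>R (f y * k y))" .
qed

lemma has_fourier_L2_tendsto:
  "has_fourier_L2 f g \<Longrightarrow> ((\<lambda>R. \<integral>\<^sup>+ \<xi>. ennreal ((cmod (g \<xi> - fourier_trunc f R \<xi>))\<^sup>2) \<partial>lborel) \<longlongrightarrow> 0) at_top"
  by (simp add: has_fourier_L2_def fourier_trunc_def)

text \<open>Cauchy-Schwarz with the first factor kept in \<open>ennreal\<close>, so that it applies
  to g minus a truncated transform, whose mean square is only known to tend to 0.\<close>

lemma nn_integral_L2_mult_le:
  assumes [measurable]: "f \<in> borel_measurable borel" and h: "L2 h"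
    and I: "integrable lborel (\<lambda>x. f x * h x)"
  shows "ennreal ((cmod (LINT x|lborel. f x * h x))\<^sup>2) \<le>
     (\<integral>\<^sup>+ x. ennreal ((cmod (f x))\<^sup>2) \<partial>lborel) * ennreal (LINT x|lborel. (cmod (h x))\<^sup>2)"
proof -
  have [measurable]: "h \<in> borel_measurable borel" using h by (rule L2_measurable)
  have "ennreal ((cmod (LINT x|lborel. f x * h x))\<^sup>2) = (ennreal (cmod (LINT x|lborel. f x * h x)))\<^sup>2"
    by (simp add: ennreal_power)
  also have "\<dots> \<le> (\<integral>\<^sup>+ x. ennreal (cmod (f x)) * ennreal (cmod (h x)) \<partial>lborel)\<^sup>2"
    using integral_norm_bound_ennreal[OF I]
    by (intro power_mono) (simp_all add: norm_mult ennreal_mult)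
  also have "\<dots> \<le> (\<integral>\<^sup>+ x. (ennreal (cmod (f x)))\<^sup>2 \<partial>lborel) * (\<integral>\<^sup>+ x. (ennreal (cmod (h x)))\<^sup>2 \<partial>lborel)"
    by (intro Cauchy_Schwarz_nn_integral) measurable
  also have "(\<integral>\<^sup>+ x. (ennreal (cmod (h x)))\<^sup>2 \<partial>lborel) = ennreal (LINT x|lborel. (cmod (h x))\<^sup>2)"
    using h by (subst nn_integral_eq_integral[symmetric]) (auto simp: L2_def ennreal_power)
  finally show ?thesis by (simp add: ennreal_power)
qed

text \<open>The multiplication formula. In the truncated version the frequency side converges by
  Cauchy-Schwarz, because the truncated transforms tend to g in mean square, and the space side
  converges by dominated convergence.\<close>

lemma fourier_pairing:
  assumes fg: "has_fourier_L2 f g" and h: "integrable lborel h" "L2 h" and k: "L2 k"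
    and eq: "\<And>y. (LINT \<xi>|lborel. cis (- (y * \<xi>)) * h \<xi>) = complex_of_real (sqrt (2 * pi)) * k y"
  shows "(LINT \<xi>|lborel. g \<xi> * h \<xi>) = (LINT y|lborel. f y * k y)"
proof -
  have f: "L2 f" and g: "L2 g" using fg by (auto simp: has_fourier_L2_def)
  have [measurable]: "f \<in> borel_measurable borel" "h \<in> borel_measurable borel" "k \<in> borel_measurable borel"
     "g \<in> borel_measurable borel" using f g h k by (auto intro: L2_measurable)
  note fk = L2_integrable_mult[OF f k] and gh = L2_integrable_mult[OF g h(2)]
  have Th: "integrable lborel (\<lambda>\<xi>. fourier_trunc f R \<xi> * h \<xi>)" for R
    by (rule integral_fourier_trunc_mult(1)[OF f h(1) eq])
  have "((\<lambda>R. LINT y|lborel. indicator {-R..R} y *\<^sub>R (f y * k y)) \<longlongrightarrow> (LINT y|lborel. f y * k y)) at_top"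
  proof (rule integral_dominated_convergence_at_top)
    show "integrable lborel (\<lambda>y. norm (f y * k y))" using fk by auto
    show "AE y in lborel. ((\<lambda>R. indicator {-R..R} y *\<^sub>R (f y * k y)) \<longlongrightarrow> f y * k y) at_top"
    proof (intro AE_I2 tendsto_eventually)
      fix y :: real
      show "\<forall>\<^sub>F R in at_top. indicator {-R..R} y *\<^sub>R (f y * k y) = f y * k y"
        using eventually_ge_at_top[of "\<bar>y\<bar>"] by eventually_elim (auto simp: indicator_def)
    qed
  qed (auto simp: indicator_def)
  then have 1: "((\<lambda>R. LINT \<xi>|lborel. fourier_trunc f R \<xi> * h \<xi>) \<longlongrightarrow> (LINT y|lborel. f y * k y)) at_top"
    by (simp add: integral_fourier_trunc_mult(2)[OF f h(1) eq])
  let ?e = "\<lambda>R. (cmod ((LINT \<xi>|lborel. g \<xi> * h \<xi>) - (LINT \<xi>|lborel. fourier_trunc f R \<xi> * h \<xi>)))\<^sup>2"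
  have bound: "ennreal (?e R) \<le> (\<integral>\<^sup>+ \<xi>. ennreal ((cmod (g \<xi> - fourier_trunc f R \<xi>))\<^sup>2) \<partial>lborel)
       * ennreal (LINT x|lborel. (cmod (h x))\<^sup>2)" for R
  proof -
    have [measurable]: "fourier_trunc f R \<in> borel_measurable borel" using f by measurable
    have "integrable lborel (\<lambda>\<xi>. (g \<xi> - fourier_trunc f R \<xi>) * h \<xi>)"
      using gh Th[of R] by (simp add: left_diff_distrib)
    from nn_integral_L2_mult_le[OF _ h(2) this] show ?thesis
      using gh Th[of R] by (simp add: left_diff_distrib)
  qed
  have "((\<lambda>R. (\<integral>\<^sup>+ \<xi>. ennreal ((cmod (g \<xi> - fourier_trunc f R \<xi>))\<^sup>2) \<partial>lborel)
       * ennreal (LINT x|lborel. (cmod (h x))\<^sup>2)) \<longlongrightarrow> 0 * ennreal (LINT x|lborel. (cmod (h x))\<^sup>2)) at_top"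
    by (intro tendsto_mult_ennreal has_fourier_L2_tendsto[OF fg] tendsto_const) auto
  then have "((\<lambda>R. ennreal (?e R)) \<longlongrightarrow> ennreal 0) at_top"
    using tendsto_sandwich[OF _ always_eventually[OF allI[OF bound]] tendsto_const[of 0]] by simp
  then have "(?e \<longlongrightarrow> 0) at_top"
    by (subst (asm) tendsto_ennreal_iff) auto
  then have "((\<lambda>R. sqrt (?e R)) \<longlongrightarrow> sqrt 0) at_top" by (rule tendsto_real_sqrt)
  then have "((\<lambda>R. (LINT \<xi>|lborel. g \<xi> * h \<xi>) - (LINT \<xi>|lborel. fourier_trunc f R \<xi> * h \<xi>)) \<longlongrightarrow> 0) at_top"
    by (simp add: tendsto_norm_zero_iff)
  from tendsto_diff[OF tendsto_const[of "LINT \<xi>|lborel. g \<xi> * h \<xi>"] this]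
  have "((\<lambda>R. LINT \<xi>|lborel. fourier_trunc f R \<xi> * h \<xi>) \<longlongrightarrow> (LINT \<xi>|lborel. g \<xi> * h \<xi>)) at_top"
    by simp
  from tendsto_unique[OF _ this 1] show ?thesis by simp
qed

section \<open>Gaussian regularisation and pointwise inversion\<close>

lemma fourier_std_normal_density:
  "(LINT z|lborel. cis (t * z) * complex_of_real (std_normal_density z)) = complex_of_real (exp (- (t\<^sup>2) / 2))"
proof -
  have "(LINT z|lborel. std_normal_density z *\<^sub>R cis (t * z)) = char std_normal_distribution t"
    unfolding char_def by (subst integral_density) (auto simp: normal_density_nonneg cis_conv_exp)
  then show ?thesis
    by (simp add: char_std_normal_distribution scaleR_conv_of_real mult.commute)
qed

lemma std_normal_density_scaled:
  assumes "e > 0"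
  shows "std_normal_density (e * \<xi>) = normal_density 0 (1 / e) \<xi> / e"
  using assms by (simp add: normal_density_def real_sqrt_divide real_sqrt_mult field_simps)

lemma L2_normal_density:
  assumes "e > 0"
  shows "L2 (\<lambda>x. complex_of_real (normal_density m e x))"
proof -
  have "(normal_density m e x)\<^sup>2 = (1 / sqrt (2 * pi * e\<^sup>2)) * (exp (-(x - m)\<^sup>2/ (2 * e\<^sup>2)) * normal_density m e x)" for x
    by (simp add: normal_density_def power2_eq_square)
  moreover have "integrable lborel (\<lambda>x. exp (-(x - m)\<^sup>2/ (2 * e\<^sup>2)) * normal_density m e x)"
    by (rule Bochner_Integration.integrable_bound[OF integrable_normal_density[of e m]])
       (use assms in \<open>auto simp: normal_density_nonneg intro!: mult_left_le_one_le\<close>)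
  ultimately have "integrable lborel (\<lambda>x. (normal_density m e x)\<^sup>2)"
    by simp
  then show ?thesis by (simp add: L2_def)
qed

text \<open>A modulated wide Gaussian in frequency has as its transform the density centred at x
  with width e. So the Gaussian-regularised inversion integral on the left is a mollification of f
  at x.\<close>

lemma fourier_gauss_pairing:
  assumes fg: "has_fourier_L2 f g" and e: "e > 0"
  shows "(LINT \<xi>|lborel. g \<xi> * (cis (x * \<xi>) * complex_of_real (std_normal_density (e * \<xi>)))) =
    (LINT y|lborel. f y * complex_of_real (normal_density x e y))"
proof (rule fourier_pairing[OF fg])
  let ?h = "\<lambda>\<xi>. cis (x * \<xi>) * complex_of_real (std_normal_density (e * \<xi>))"
  have I: "integrable lborel (\<lambda>\<xi>. complex_of_real (std_normal_density (e * \<xi>)))"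
    unfolding std_normal_density_scaled[OF e]
    by (intro integrable_of_real integrable_divide integrable_normal_density) (use e in auto)
  show "integrable lborel ?h"
    by (rule Bochner_Integration.integrable_bound[OF I]) (auto simp: norm_mult)
  have "L2 (\<lambda>\<xi>. complex_of_real (normal_density 0 (1 / e) \<xi>))"
    using e by (intro L2_normal_density) auto
  then have "integrable lborel (\<lambda>\<xi>. (normal_density 0 (1 / e) \<xi>)\<^sup>2 * (1 / e\<^sup>2))"
    by (intro integrable_mult_left) (simp add: L2_def)
  then have "integrable lborel (\<lambda>\<xi>. (std_normal_density (e * \<xi>))\<^sup>2)"
    unfolding std_normal_density_scaled[OF e] by (simp add: power_divide)
  then show "L2 ?h"
    by (simp add: L2_def norm_mult)
  show "L2 (\<lambda>y. complex_of_real (normal_density x e y))"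
    using e by (rule L2_normal_density)
  fix y
  \<comment> \<open>The substitution z = e xi reduces the transform to that of the standard normal
    density at (x - y) / e.\<close>
  have "(LINT z|lborel. cis (((x - y) / e) * z) * complex_of_real (std_normal_density z))
     = \<bar>e\<bar> *\<^sub>R (LINT \<xi>|lborel. cis (((x - y) / e) * (0 + e * \<xi>)) * complex_of_real (std_normal_density (0 + e * \<xi>)))"
    using e by (intro lborel_integral_real_affine) auto
  also have "(LINT \<xi>|lborel. cis (((x - y) / e) * (0 + e * \<xi>)) * complex_of_real (std_normal_density (0 + e * \<xi>)))
     = (LINT \<xi>|lborel. cis (- (y * \<xi>)) * ?h \<xi>)"
  proof (rule Bochner_Integration.integral_cong[OF refl])
    fix \<xi>
    have "((x - y) / e) * (0 + e * \<xi>) = - (y * \<xi>) + x * \<xi>"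
      using e by (simp add: field_simps)
    then show "cis (((x - y) / e) * (0 + e * \<xi>)) * complex_of_real (std_normal_density (0 + e * \<xi>)) = cis (- (y * \<xi>)) * ?h \<xi>"
      by (simp only: cis_mult[symmetric] mult.assoc add_0)
  qed
  finally have "e *\<^sub>R (LINT \<xi>|lborel. cis (- (y * \<xi>)) * ?h \<xi>) = complex_of_real (exp (- (((x - y) / e)\<^sup>2) / 2))"
    using e unfolding fourier_std_normal_density by simp
  also have "\<dots> = e *\<^sub>R (complex_of_real (sqrt (2 * pi)) * complex_of_real (normal_density x e y))"
    using e by (simp add: normal_density_def real_sqrt_mult power_divide power2_commute scaleR_conv_of_real)
  finally show "(LINT \<xi>|lborel. cis (- (y * \<xi>)) * ?h \<xi>) = complex_of_real (sqrt (2 * pi)) * complex_of_real (normal_density x e y)"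
    using e by simp
qed

text \<open>Away from its centre a narrow Gaussian is dominated by the one of unit width; this makes
  dominated convergence applicable although \<open>f\<close> need not be bounded.\<close>

lemma normal_density_far_le:
  assumes "1 \<le> \<bar>y - x\<bar>" "0 < e" "e \<le> 1"
  shows "normal_density x e y \<le> normal_density x 1 y"
proof -
  define k where "k = 1 / e"
  have k: "k \<ge> 1" using assms by (simp add: k_def)
  define r where "r = (y - x)\<^sup>2"
  have r: "r \<ge> 1" using assms(1) unfolding r_def by (metis abs_square_le_1 linear one_le_power power2_abs)
  \<comment> \<open>With k = 1/e and r = (y - x)^2 the claim amounts to k <= exp ((k^2 - 1) r / 2).
    It follows from 2k <= 1 + k^2, from r >= 1 and from 1 + z <= exp z.\<close>
  have "k \<le> 1 + (k\<^sup>2 - 1) / 2"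
    using sum_squares_bound[of k 1] by (simp add: power2_eq_square field_simps)
  also have "\<dots> \<le> 1 + (k\<^sup>2 - 1) * r / 2"
    using k r mult_left_mono[of 1 r "k\<^sup>2 - 1"] by simp
  also have "\<dots> \<le> exp ((k\<^sup>2 - 1) * r / 2)" by (rule exp_ge_add_one_self)
  finally have "k * exp (- (k\<^sup>2 * r / 2)) \<le> exp ((k\<^sup>2 - 1) * r / 2) * exp (- (k\<^sup>2 * r / 2))"
    by (intro mult_right_mono) auto
  also have "\<dots> = exp (- r / 2)"
    by (simp add: field_simps flip: exp_add)
  finally have "1 / sqrt (2 * pi) * (k * exp (- (k\<^sup>2 * r / 2))) \<le> 1 / sqrt (2 * pi) * exp (- r / 2)"
    by (intro mult_left_mono) auto
  then show ?thesis
    using assms by (simp add: normal_density_def real_sqrt_mult r_def k_def power_divide mult.commute)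
qed

lemma normal_density_far_tendsto:
  assumes "y \<noteq> x"
  shows "(\<lambda>n. normal_density x (1 / real (Suc n)) y) \<longlonglongrightarrow> 0"
proof -
  have eq: "normal_density x (1 / real (Suc n)) y = (1 / sqrt (2 * pi)) * (real (Suc n) * exp (- ((y - x)\<^sup>2 / 2) * (real (Suc n))\<^sup>2))" for n
    by (simp add: normal_density_def real_sqrt_divide real_sqrt_mult power_divide)
  have "c > 0 \<Longrightarrow> ((\<lambda>z::real. z * exp (- c * z\<^sup>2)) \<longlongrightarrow> 0) at_top" for c :: real
    by real_asymp
  from filterlim_compose[OF this filterlim_compose[OF filterlim_real_sequentially filterlim_Suc], of "(y - x)\<^sup>2 / 2"]
  have "(\<lambda>n. real (Suc n) * exp (- ((y - x)\<^sup>2 / 2) * (real (Suc n))\<^sup>2)) \<longlonglongrightarrow> 0"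
    using assms by simp
  from tendsto_mult_right_zero[OF this] show ?thesis unfolding eq .
qed

text \<open>Splitting at distance 1 from x separates two reasons for convergence: near x continuity
  gives boundedness and the right limit, far from x the integrand is dominated by f times the unit
  Gaussian and tends to 0.\<close>

lemma gauss_approximate_identity:
  assumes f: "L2 f" and cont: "continuous_on UNIV f"
  shows "(\<lambda>n. LINT y|lborel. f y * complex_of_real (normal_density x (1 / real (Suc n)) y)) \<longlonglongrightarrow> f x"
proof -
  define e where "e = (\<lambda>n. 1 / real (Suc n))"
  have e: "e n > 0" "e n \<le> 1" for n by (auto simp: e_def)
  have e0: "e \<longlonglongrightarrow> 0" unfolding e_def by (rule LIMSEQ_Suc) (rule lim_1_over_n)
  have [measurable]: "f \<in> borel_measurable borel" using f by (rule L2_measurable)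
  define near where "near = (\<lambda>y. of_bool (\<bar>y - x\<bar> < 1) * f y)"
  define far where "far = (\<lambda>y. of_bool (1 \<le> \<bar>y - x\<bar>) * f y)"
  have [measurable]: "near \<in> borel_measurable borel" "far \<in> borel_measurable borel"
    unfolding near_def far_def by measurable
  have split: "f y = near y + far y" for y by (auto simp: near_def far_def)
  have fG: "integrable lborel (\<lambda>y. f y * complex_of_real (normal_density x e y))" if "e > 0" for e
    using L2_integrable_mult[OF f L2_normal_density[OF that]] .
  have nearG: "integrable lborel (\<lambda>y. near y * complex_of_real (normal_density x (e n) y))" for n
    by (rule Bochner_Integration.integrable_bound[OF fG[OF e(1)[of n]]]) (auto simp: near_def norm_mult)
  have farG: "integrable lborel (\<lambda>y. far y * complex_of_real (normal_density x (e n) y))" for n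
    by (rule Bochner_Integration.integrable_bound[OF fG[OF e(1)[of n]]]) (auto simp: far_def norm_mult)
  have "compact (f ` {x-1..x+1})"
    by (intro compact_continuous_image continuous_on_subset[OF cont]) auto
  then obtain M where M: "\<And>y. \<bar>y - x\<bar> \<le> 1 \<Longrightarrow> cmod (f y) \<le> M"
    unfolding bounded_iff[THEN iffD1, OF compact_imp_bounded]
    by (force dest!: compact_imp_bounded simp: bounded_iff abs_le_iff)
  have M0: "M \<ge> 0" using M[of x] norm_ge_zero[of "f x"] by (simp del: norm_ge_zero)
  have "(\<lambda>n. LINT y|lborel. far y * complex_of_real (normal_density x (e n) y)) \<longlonglongrightarrow> (LINT y|(lborel::real measure). (0::complex))"
  proof (rule integral_dominated_convergence)
    show "integrable lborel (\<lambda>y. cmod (f y * complex_of_real (normal_density x 1 y)))"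
      by (intro integrable_norm fG) simp
    show "AE y in lborel. (\<lambda>n. far y * complex_of_real (normal_density x (e n) y)) \<longlonglongrightarrow> 0"
    proof (rule AE_I2)
      fix y
      show "(\<lambda>n. far y * complex_of_real (normal_density x (e n) y)) \<longlonglongrightarrow> 0"
      \<comment> \<open>At the centre itself the densities blow up, but \<open>far\<close> vanishes
        there.\<close>
      proof (cases "y = x")
        case False
        from tendsto_of_real[OF normal_density_far_tendsto[OF this]]
        show ?thesis unfolding e_def by (intro tendsto_mult_right_zero) simp
      qed (simp add: far_def)
    qed
    show "AE y in lborel. norm (far y * complex_of_real (normal_density x (e n) y)) \<le> cmod (f y * complex_of_real (normal_density x 1 y))" for n
    proof (rule AE_I2)
      fix y
      show "norm (far y * complex_of_real (normal_density x (e n) y)) \<le> cmod (f y * complex_of_real (normal_density x 1 y))"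
        using normal_density_far_le[of y x "e n"] e[of n]
        by (auto simp: far_def norm_mult intro!: mult_left_mono)
    qed
  qed measurable
  then have far0: "(\<lambda>n. LINT y|lborel. far y * complex_of_real (normal_density x (e n) y)) \<longlonglongrightarrow> 0" by simp
  \<comment> \<open>Substituting y = x + e z freezes the Gaussian and moves the dependence on n into
    \<open>near\<close>, which makes dominated convergence applicable.\<close>
  have near_eq: "(LINT y|lborel. near y * complex_of_real (normal_density x (e n) y)) =
     (LINT z|lborel. near (x + e n * z) * complex_of_real (std_normal_density z))" for n
  proof -
    have "(LINT y|lborel. near y * complex_of_real (normal_density x (e n) y)) =
       \<bar>e n\<bar> *\<^sub>R (LINT z|lborel. near (x + e n * z) * complex_of_real (normal_density x (e n) (x + e n * z)))"
      using e(1)[of n] by (intro lborel_integral_real_affine) auto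
    also have "\<dots> = (LINT z|lborel. e n *\<^sub>R (near (x + e n * z) * complex_of_real (normal_density x (e n) (x + e n * z))))"
      using e(1)[of n] by simp
    also have "\<dots> = (LINT z|lborel. near (x + e n * z) * complex_of_real (std_normal_density z))"
    proof (rule Bochner_Integration.integral_cong[OF refl])
      fix z
      have "e n * normal_density x (e n) (x + e n * z) = std_normal_density z"
        using e(1)[of n] by (simp add: normal_density_def real_sqrt_mult power_mult_distrib)
      from this[symmetric] show "e n *\<^sub>R (near (x + e n * z) * complex_of_real (normal_density x (e n) (x + e n * z)))
       = near (x + e n * z) * complex_of_real (std_normal_density z)"
        by (simp only: of_real_mult scaleR_conv_of_real mult.left_commute)
    qed
    finally show ?thesis .
  qed
  have "(\<lambda>n. LINT z|lborel. near (x + e n * z) * complex_of_real (std_normal_density z)) \<longlonglongrightarrow>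
     (LINT z|lborel. f x * complex_of_real (std_normal_density z))"
  proof (rule integral_dominated_convergence)
    show "integrable lborel (\<lambda>z. M * std_normal_density z)" by simp
    show "AE z in lborel. (\<lambda>n. near (x + e n * z) * complex_of_real (std_normal_density z)) \<longlonglongrightarrow> f x * complex_of_real (std_normal_density z)"
    proof (rule AE_I2)
      fix z
      have "(\<lambda>n. x + e n * z) \<longlonglongrightarrow> x + 0 * z" by (intro tendsto_intros e0)
      then have l: "(\<lambda>n. x + e n * z) \<longlonglongrightarrow> x" by simp
      have "isCont f x" using cont by (simp add: continuous_on_eq_continuous_at)
      then have "(\<lambda>n. f (x + e n * z)) \<longlonglongrightarrow> f x" using l by (rule isCont_tendsto_compose)
      moreover have "\<forall>\<^sub>F n in sequentially. f (x + e n * z) = near (x + e n * z)"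
        using tendstoD[OF l, of 1] by (auto elim!: eventually_mono simp: near_def dist_real_def)
      ultimately have "(\<lambda>n. near (x + e n * z)) \<longlonglongrightarrow> f x" by (rule Lim_transform_eventually)
      then show "(\<lambda>n. near (x + e n * z) * complex_of_real (std_normal_density z)) \<longlonglongrightarrow> f x * complex_of_real (std_normal_density z)"
        by (intro tendsto_intros)
    qed
    show "AE z in lborel. norm (near (x + e n * z) * complex_of_real (std_normal_density z)) \<le> M * std_normal_density z" for n
      using M M0 by (intro AE_I2) (auto simp: near_def norm_mult intro!: mult_right_mono)
  qed measurable
  then have "(\<lambda>n. LINT y|lborel. near y * complex_of_real (normal_density x (e n) y)) \<longlonglongrightarrow> f x"
    unfolding near_eq by (simp add: integral_normal_density del: integral_of_real add: integral_complex_of_real)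
  from tendsto_add[OF this far0] show ?thesis
    using nearG farG unfolding e_def by (simp add: split[abs_def] distrib_right del: of_nat_Suc)
qed

text \<open>Both sides are limits of one sequence of Gaussian pairings: as mollifications it tends
  to f x, and on the frequency side the Gaussian factor tends to its value 1 / sqrt (2 pi) at 0
  under the majorant |g|.\<close>

lemma fourier_inversion:
  assumes fg: "has_fourier_L2 f g" and cont: "continuous_on UNIV f" and g: "integrable lborel g"
  shows "f x = complex_of_real (1 / sqrt (2 * pi)) * (LINT \<xi>|lborel. g \<xi> * cis (x * \<xi>))"
proof (rule LIMSEQ_unique)
  have [measurable]: "g \<in> borel_measurable borel" using g by auto
  show "(\<lambda>n. LINT y|lborel. f y * complex_of_real (normal_density x (1 / real (Suc n)) y)) \<longlonglongrightarrow> f x"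
    using fg by (intro gauss_approximate_identity cont) (simp add: has_fourier_L2_def)
  have "(\<lambda>n. LINT \<xi>|lborel. g \<xi> * (cis (x * \<xi>) * complex_of_real (std_normal_density (1 / real (Suc n) * \<xi>))))
     \<longlonglongrightarrow> (LINT \<xi>|lborel. g \<xi> * (cis (x * \<xi>) * complex_of_real (std_normal_density (0 * \<xi>))))"
  proof (rule integral_dominated_convergence)
    show "integrable lborel (\<lambda>\<xi>. cmod (g \<xi>))" using g by simp
    have cont: "isCont std_normal_density z" for z
      unfolding std_normal_density_def[abs_def] by (intro continuous_intros) auto
    have "(\<lambda>n. 1 / real (Suc n)) \<longlonglongrightarrow> 0" by (rule LIMSEQ_Suc) (rule lim_1_over_n)
    then have "(\<lambda>n. std_normal_density (1 / real (Suc n) * \<xi>)) \<longlonglongrightarrow> std_normal_density (0 * \<xi>)" for \<xi>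
      by (intro isCont_tendsto_compose[OF cont] tendsto_intros)
    then show "AE \<xi> in lborel. (\<lambda>n. g \<xi> * (cis (x * \<xi>) * complex_of_real (std_normal_density (1 / real (Suc n) * \<xi>))))
     \<longlonglongrightarrow> g \<xi> * (cis (x * \<xi>) * complex_of_real (std_normal_density (0 * \<xi>)))"
      by (intro AE_I2 tendsto_intros)
    have "std_normal_density z \<le> 1" for z
    proof -
      have "exp (- z\<^sup>2 / 2) \<le> sqrt (2 * pi)"
        using pi_gt3 by (intro order_trans[OF _ real_le_rsqrt[of 1]]) auto
      then show ?thesis by (simp add: std_normal_density_def)
    qed
    then show "AE \<xi> in lborel. norm (g \<xi> * (cis (x * \<xi>) * complex_of_real (std_normal_density (1 / real (Suc n) * \<xi>)))) \<le> cmod (g \<xi>)" for n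
      by (intro AE_I2) (auto simp: norm_mult intro!: mult_right_le_one_le)
  qed measurable
  moreover have "std_normal_density 0 = 1 / sqrt (2 * pi)" by (simp add: std_normal_density_def)
  ultimately show "(\<lambda>n. LINT y|lborel. f y * complex_of_real (normal_density x (1 / real (Suc n)) y))
     \<longlonglongrightarrow> complex_of_real (1 / sqrt (2 * pi)) * (LINT \<xi>|lborel. g \<xi> * cis (x * \<xi>))"
    by (subst fourier_gauss_pairing[OF fg, symmetric]) (auto simp: mult_ac)
qed

subsection \<open>Sobolev embedding\<close>

text \<open>The hypothesis s > 1/2 acts here: outside the unit interval the weight is at most
  |xi|^(-2s), and 2s > 1.\<close>

lemma Hs_weight_integrable:
  assumes "s > 1 / 2"
  shows "integrable lborel (\<lambda>\<xi>::real. (1 + \<xi>\<^sup>2) powr (- s))"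
proof -
  define p where "p = (\<lambda>\<xi>::real. indicator {1..} \<xi> *\<^sub>R \<xi> powr (- (2 * s)))"
  have "(\<lambda>\<xi>::real. \<xi> powr (- (2 * s))) integrable_on {1..}"
    using has_integral_powr_to_inf[of "- (2 * s)" 1] assms by (auto simp: integrable_on_def)
  \<comment> \<open>Nonnegativity makes the gauge integral absolutely convergent; Borel
    measurability then brings it from the completed measure to \<open>lborel\<close>.\<close>
  then have "(\<lambda>\<xi>::real. \<xi> powr (- (2 * s))) absolutely_integrable_on {1..}"
    by (rule nonnegative_absolutely_integrable_1) simp
  then have p: "integrable lborel p"
    unfolding set_integrable_def p_def by (subst (asm) integrable_completion) measurable
  have p': "integrable lborel (\<lambda>\<xi>. p (- \<xi>))"
    using lborel_integrable_real_affine[OF p, of "-1" 0] by simp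
  have i: "integrable lborel (indicator {-1..1} :: real \<Rightarrow> real)"
    using emeasure_compact_finite[of "{-1..1}"] by (intro integrable_real_indicator) auto
  have le: "(1 + \<xi>\<^sup>2) powr (- s) \<le> indicator {-1..1} \<xi> + p \<xi> + p (- \<xi>)" for \<xi> :: real
  proof (cases "\<bar>\<xi>\<bar> \<le> 1")
    case True
    have "(1 + \<xi>\<^sup>2) powr (- s) \<le> 1 powr (- s)"
      using assms by (intro powr_mono2') auto
    then show ?thesis using True by (auto simp: indicator_def p_def abs_le_iff)
  next
    case False
    have "(1 + \<xi>\<^sup>2) powr (- s) \<le> (\<bar>\<xi>\<bar>\<^sup>2) powr (- s)"
      using assms False by (intro powr_mono2') auto
    also have "\<dots> = \<bar>\<xi>\<bar> powr (- (2 * s))"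
    proof -
      have "\<bar>\<xi>\<bar>\<^sup>2 = \<bar>\<xi>\<bar> powr 2" using False by simp
      then show ?thesis by (simp only: powr_powr) simp
    qed
    also have "\<dots> \<le> indicator {-1..1} \<xi> + p \<xi> + p (- \<xi>)"
      using False by (auto simp: p_def indicator_def abs_if)
    finally show ?thesis .
  qed
  show ?thesis
    by (rule Bochner_Integration.integrable_bound[OF Bochner_Integration.integrable_add[OF Bochner_Integration.integrable_add[OF i p] p']])
       (use le in \<open>auto intro!: AE_I2 order_trans[OF le abs_ge_self]\<close>)
qed

text \<open>The parameter \<open>l\<close> replaces the Cauchy--Schwarz inequality: optimising it would give the
  product of the square roots of the two integrals.\<close>

lemma L1_of_Hs_weight:
  assumes s: "s > 1 / 2" and [measurable]: "g \<in> borel_measurable borel"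
    and w: "integrable lborel (\<lambda>\<xi>. (1 + \<xi>\<^sup>2) powr s * (cmod (g \<xi>))\<^sup>2)"
  shows "integrable lborel g"
    and "l > 0 \<Longrightarrow> (LINT \<xi>|lborel. cmod (g \<xi>)) \<le> l * (LINT \<xi>|lborel. (1 + \<xi>\<^sup>2) powr (- s)) +
            (LINT \<xi>|lborel. (1 + \<xi>\<^sup>2) powr s * (cmod (g \<xi>))\<^sup>2) / l"
proof -
  have le: "cmod (g \<xi>) \<le> l * (1 + \<xi>\<^sup>2) powr (- s) + ((1 + \<xi>\<^sup>2) powr s * (cmod (g \<xi>))\<^sup>2) / l" if "l > 0" for l \<xi> :: real
  proof -
    define W where "W = (1 + \<xi>\<^sup>2) powr s"
    have W: "W > 0" unfolding W_def by (simp add: add_pos_nonneg[THEN less_imp_neq, symmetric])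
    \<comment> \<open>This is 2ab <= a^2 + b^2 with a = l and b = W |g|; division by l W will give
      the two terms of the bound.\<close>
    have "2 * (l * (W * cmod (g \<xi>))) \<le> l\<^sup>2 + (W * cmod (g \<xi>))\<^sup>2"
      using sum_squares_bound[of l "W * cmod (g \<xi>)"] by simp
    moreover have "0 \<le> l * (W * cmod (g \<xi>))" using W that by simp
    ultimately have "l * (W * cmod (g \<xi>)) \<le> l\<^sup>2 + (W * cmod (g \<xi>))\<^sup>2" by linarith
    then have "cmod (g \<xi>) \<le> (l\<^sup>2 + (W * cmod (g \<xi>))\<^sup>2) / (l * W)"
      using W that by (simp add: field_simps)
    also have "\<dots> = l * (1 / W) + (W * (cmod (g \<xi>))\<^sup>2) / l"
      using W that by (simp add: field_simps power2_eq_square)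
    finally show ?thesis by (simp add: W_def powr_minus divide_inverse)
  qed
  have I: "integrable lborel (\<lambda>\<xi>. l * (1 + \<xi>\<^sup>2) powr (- s) + ((1 + \<xi>\<^sup>2) powr s * (cmod (g \<xi>))\<^sup>2) / l)" for l
    using w Hs_weight_integrable[OF s] by simp
  show g: "integrable lborel g"
  proof (rule Bochner_Integration.integrable_bound[OF I[of 1]])
    show "AE \<xi> in lborel. norm (g \<xi>) \<le> norm (1 * (1 + \<xi>\<^sup>2) powr (- s) + ((1 + \<xi>\<^sup>2) powr s * (cmod (g \<xi>))\<^sup>2) / 1)"
      by (intro AE_I2 order_trans[OF le[of 1]]) simp_all
  qed measurable
  assume l: "l > 0"
  have "(LINT \<xi>|lborel. cmod (g \<xi>)) \<le> (LINT \<xi>|lborel. l * (1 + \<xi>\<^sup>2) powr (- s) + ((1 + \<xi>\<^sup>2) powr s * (cmod (g \<xi>))\<^sup>2) / l)"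
    using le[OF l] by (intro integral_mono I integrable_norm g) auto
  also have "\<dots> = l * (LINT \<xi>|lborel. (1 + \<xi>\<^sup>2) powr (- s)) + (LINT \<xi>|lborel. (1 + \<xi>\<^sup>2) powr s * (cmod (g \<xi>))\<^sup>2) / l"
    using w Hs_weight_integrable[OF s] by simp
  finally show "(LINT \<xi>|lborel. cmod (g \<xi>)) \<le> \<dots>" .
qed

section \<open>Uniqueness and linearity of the transform\<close>

lemma nn_integral_sq_diff_le:
  assumes [measurable]: "a \<in> borel_measurable borel" "b \<in> borel_measurable borel"
  shows "(\<integral>\<^sup>+ x. ennreal ((cmod (a x - b x))\<^sup>2) \<partial>lborel) \<le>
    2 * (\<integral>\<^sup>+ x. ennreal ((cmod (a x))\<^sup>2) \<partial>lborel) + 2 * (\<integral>\<^sup>+ x. ennreal ((cmod (b x))\<^sup>2) \<partial>lborel)"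
proof -
  have "(\<integral>\<^sup>+ x. ennreal ((cmod (a x - b x))\<^sup>2) \<partial>lborel) \<le>
     (\<integral>\<^sup>+ x. 2 * ennreal ((cmod (a x))\<^sup>2) + 2 * ennreal ((cmod (b x))\<^sup>2) \<partial>lborel)"
    by (intro nn_integral_mono) (simp add: cmod_diff_sq_le ennreal_leI flip: ennreal_plus ennreal_mult ennreal_numeral)
  also have "\<dots> = 2 * (\<integral>\<^sup>+ x. ennreal ((cmod (a x))\<^sup>2) \<partial>lborel) + 2 * (\<integral>\<^sup>+ x. ennreal ((cmod (b x))\<^sup>2) \<partial>lborel)"
    by (simp add: nn_integral_add nn_integral_cmult)
  finally show ?thesis .
qed

text \<open>One estimate serves two purposes: for f = f' the truncations cancel and it gives
  uniqueness, and in general it shows that the transform of a difference is the difference of the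
  transforms.\<close>

lemma fourier_error_diff_tendsto:
  assumes "has_fourier_L2 f g" "has_fourier_L2 f' g'"
  shows "((\<lambda>R. \<integral>\<^sup>+ \<xi>. ennreal ((cmod ((g \<xi> - fourier_trunc f R \<xi>) - (g' \<xi> - fourier_trunc f' R \<xi>)))\<^sup>2) \<partial>lborel) \<longlongrightarrow> 0) at_top"
proof -
  have L: "L2 f" "L2 f'" "L2 g" "L2 g'" using assms by (auto simp: has_fourier_L2_def)
  have [measurable]: "g \<in> borel_measurable borel" "g' \<in> borel_measurable borel" using L by (auto intro: L2_measurable)
  have [measurable]: "fourier_trunc f R \<in> borel_measurable borel" "fourier_trunc f' R \<in> borel_measurable borel" for R
    using L by (auto intro: fourier_trunc_measurable)
  let ?A = "\<lambda>R. \<integral>\<^sup>+ \<xi>. ennreal ((cmod (g \<xi> - fourier_trunc f R \<xi>))\<^sup>2) \<partial>lborel"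
  let ?B = "\<lambda>R. \<integral>\<^sup>+ \<xi>. ennreal ((cmod (g' \<xi> - fourier_trunc f' R \<xi>))\<^sup>2) \<partial>lborel"
  have "((\<lambda>R. 2 * ?A R + 2 * ?B R) \<longlongrightarrow> 2 * 0 + 2 * 0) at_top"
    by (intro tendsto_add tendsto_mult_ennreal tendsto_const has_fourier_L2_tendsto assms) auto
  then have lim: "((\<lambda>R. 2 * ?A R + 2 * ?B R) \<longlongrightarrow> 0) at_top" by simp
  have le: "(\<integral>\<^sup>+ \<xi>. ennreal ((cmod ((g \<xi> - fourier_trunc f R \<xi>) - (g' \<xi> - fourier_trunc f' R \<xi>)))\<^sup>2) \<partial>lborel) \<le> 2 * ?A R + 2 * ?B R" for R
    by (rule nn_integral_sq_diff_le) measurable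
  show ?thesis
    by (rule tendsto_sandwich[OF always_eventually always_eventually tendsto_const lim]) (simp_all add: le)
qed

lemma has_fourier_L2_unique:
  assumes "has_fourier_L2 f g" "has_fourier_L2 f g'"
  shows "AE \<xi> in lborel. g \<xi> = g' \<xi>"
proof -
  have L: "L2 g" "L2 g'" using assms by (auto simp: has_fourier_L2_def)
  have [measurable]: "g \<in> borel_measurable borel" "g' \<in> borel_measurable borel" using L by (auto intro: L2_measurable)
  have "((\<lambda>R::real. \<integral>\<^sup>+ \<xi>. ennreal ((cmod (g \<xi> - g' \<xi>))\<^sup>2) \<partial>lborel) \<longlongrightarrow> 0) at_top"
    using fourier_error_diff_tendsto[OF assms] by simp
  then have "(\<integral>\<^sup>+ \<xi>. ennreal ((cmod (g \<xi> - g' \<xi>))\<^sup>2) \<partial>lborel) = 0"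
    by (simp add: tendsto_const_iff)
  then have "AE \<xi> in lborel. ennreal ((cmod (g \<xi> - g' \<xi>))\<^sup>2) = 0"
    by (subst (asm) nn_integral_0_iff_AE) auto
  then show ?thesis by eventually_elim auto
qed

lemma fourier_trunc_diff:
  assumes "L2 f" "L2 f'"
  shows "fourier_trunc (\<lambda>x. f x - f' x) R \<xi> = fourier_trunc f R \<xi> - fourier_trunc f' R \<xi>"
proof -
  have I: "integrable lborel (\<lambda>y. indicator {-R..R} y *\<^sub>R (cis (- (y * \<xi>)) * f y))" if "L2 f" for f
  proof (rule Bochner_Integration.integrable_bound[OF L2_set_integrable[OF that]])
    have [measurable]: "f \<in> borel_measurable borel" using that by (rule L2_measurable)
    show "(\<lambda>y. indicator {-R..R} y *\<^sub>R (cis (- (y * \<xi>)) * f y)) \<in> borel_measurable lborel" by measurable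
  qed (auto simp: norm_mult)
  have "(LINT y|lborel. indicator {-R..R} y *\<^sub>R (cis (- (y * \<xi>)) * (f y - f' y))) =
    (LINT y|lborel. indicator {-R..R} y *\<^sub>R (cis (- (y * \<xi>)) * f y)) -
    (LINT y|lborel. indicator {-R..R} y *\<^sub>R (cis (- (y * \<xi>)) * f' y))"
    unfolding right_diff_distrib scaleR_diff_right by (intro Bochner_Integration.integral_diff I assms)
  then show ?thesis unfolding fourier_trunc_def set_lebesgue_integral_def by (simp only: right_diff_distrib)
qed

lemma has_fourier_L2_diff:
  assumes "has_fourier_L2 f g" "has_fourier_L2 f' g'"
  shows "has_fourier_L2 (\<lambda>x. f x - f' x) (\<lambda>\<xi>. g \<xi> - g' \<xi>)"
proof -
  have L: "L2 f" "L2 f'" "L2 g" "L2 g'" using assms by (auto simp: has_fourier_L2_def)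
  have "((\<lambda>R. \<integral>\<^sup>+ \<xi>. ennreal ((cmod ((g \<xi> - g' \<xi>) - fourier_trunc (\<lambda>x. f x - f' x) R \<xi>))\<^sup>2) \<partial>lborel) \<longlongrightarrow> 0) at_top"
    using fourier_error_diff_tendsto[OF assms] by (simp add: fourier_trunc_diff[OF L(1,2)] algebra_simps)
  then show ?thesis
    using L by (simp add: has_fourier_L2_def fourier_trunc_def L2_diff)
qed

lemma in_Hs_diff:
  assumes "in_Hs s f" "in_Hs s f'"
  shows "in_Hs s (\<lambda>x. f x - f' x)"
proof -
  obtain g where g: "has_fourier_L2 f g" "integrable lborel (\<lambda>\<xi>. (1 + \<xi>\<^sup>2) powr s * (cmod (g \<xi>))\<^sup>2)"
    using assms by (auto simp: in_Hs_def)
  obtain g' where g': "has_fourier_L2 f' g'" "integrable lborel (\<lambda>\<xi>. (1 + \<xi>\<^sup>2) powr s * (cmod (g' \<xi>))\<^sup>2)"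
    using assms by (auto simp: in_Hs_def)
  have [measurable]: "g \<in> borel_measurable borel" "g' \<in> borel_measurable borel"
    using g(1) g'(1) by (auto simp: has_fourier_L2_def intro: L2_measurable)
  have "integrable lborel (\<lambda>\<xi>. (1 + \<xi>\<^sup>2) powr s * (cmod (g \<xi> - g' \<xi>))\<^sup>2)"
  proof (rule Bochner_Integration.integrable_bound)
    show "integrable lborel (\<lambda>\<xi>. 2 * ((1 + \<xi>\<^sup>2) powr s * (cmod (g \<xi>))\<^sup>2) + 2 * ((1 + \<xi>\<^sup>2) powr s * (cmod (g' \<xi>))\<^sup>2))"
      using g(2) g'(2) by simp
    have "(1 + \<xi>\<^sup>2) powr s * (cmod (g \<xi> - g' \<xi>))\<^sup>2 \<le>
      2 * ((1 + \<xi>\<^sup>2) powr s * (cmod (g \<xi>))\<^sup>2) + 2 * ((1 + \<xi>\<^sup>2) powr s * (cmod (g' \<xi>))\<^sup>2)" for \<xi>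
      using mult_left_mono[OF cmod_diff_sq_le[of "g \<xi>" "g' \<xi>"] powr_ge_zero[of "1 + \<xi>\<^sup>2" s]] by (simp add: distrib_left mult_ac)
    then show "AE \<xi> in lborel. norm ((1 + \<xi>\<^sup>2) powr s * (cmod (g \<xi> - g' \<xi>))\<^sup>2)
       \<le> norm (2 * ((1 + \<xi>\<^sup>2) powr s * (cmod (g \<xi>))\<^sup>2) + 2 * ((1 + \<xi>\<^sup>2) powr s * (cmod (g' \<xi>))\<^sup>2))"
      by (intro AE_I2) (auto intro: order_trans[OF _ abs_ge_self])
  qed measurable
  with has_fourier_L2_diff[OF g(1) g'(1)] show ?thesis by (auto simp: in_Hs_def)
qed

text \<open>The witness in \<open>in_Hs\<close> and the function chosen by \<open>fourier_L2\<close>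
  agree almost everywhere, so the weighted integrability passes from one to the other.\<close>

lemma in_Hs_fourier:
  assumes "in_Hs s f"
  shows "has_fourier_L2 f (fourier_L2 f)"
    and "integrable lborel (\<lambda>\<xi>. (1 + \<xi>\<^sup>2) powr s * (cmod (fourier_L2 f \<xi>))\<^sup>2)"
proof -
  obtain g where g: "has_fourier_L2 f g" "integrable lborel (\<lambda>\<xi>. (1 + \<xi>\<^sup>2) powr s * (cmod (g \<xi>))\<^sup>2)"
    using assms by (auto simp: in_Hs_def)
  show F: "has_fourier_L2 f (fourier_L2 f)"
    unfolding fourier_L2_def by (rule someI[of "has_fourier_L2 f", OF g(1)])
  have [measurable]: "g \<in> borel_measurable borel" "fourier_L2 f \<in> borel_measurable borel"
    using g(1) F by (auto simp: has_fourier_L2_def intro: L2_measurable)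
  show "integrable lborel (\<lambda>\<xi>. (1 + \<xi>\<^sup>2) powr s * (cmod (fourier_L2 f \<xi>))\<^sup>2)"
    using has_fourier_L2_unique[OF g(1) F]
    by (intro integrable_cong_AE_imp[OF g(2)]) (auto elim!: eventually_mono)
qed

lemma in_Hs_imp_L1_fourier:
  assumes "s > 1 / 2" "in_Hs s f"
  shows "integrable lborel (fourier_L2 f)"
  using in_Hs_fourier[OF assms(2)] assms(1)
  by (intro L1_of_Hs_weight(1)[of s]) (auto simp: has_fourier_L2_def intro: L2_measurable)

lemma in_Hs_inversion:
  assumes "s > 1 / 2" "in_Hs s f" "continuous_on UNIV f"
  shows "f x = complex_of_real (1 / sqrt (2 * pi)) * (LINT \<xi>|lborel. fourier_L2 f \<xi> * cis (x * \<xi>))"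
  by (rule fourier_inversion[OF in_Hs_fourier(1)[OF assms(2)] assms(3) in_Hs_imp_L1_fourier[OF assms(1,2)]])

section \<open>Uniform bounds, uniform continuity and decay of Sobolev functions\<close>

lemma fourier_const_le_1: "1 / sqrt (2 * pi) \<le> 1"
proof -
  have "1 \<le> sqrt (2 * pi)" using pi_gt3 by (intro real_le_rsqrt) auto
  then show ?thesis by simp
qed

text \<open>Inversion bounds f by the L1 norm of its transform. The free parameter is as good as a
  product bound for proving continuity: l is made small first, then the norm is made small relative
  to l.\<close>

lemma sobolev_bound:
  assumes "s > 1 / 2" "in_Hs s f" "continuous_on UNIV f" "l > 0"
  shows "cmod (f x) \<le> l * (LINT \<xi>|lborel. (1 + \<xi>\<^sup>2) powr (- s)) + (Hs_norm s f)\<^sup>2 / l"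
proof -
  have "cmod (f x) = 1 / sqrt (2 * pi) * cmod (LINT \<xi>|lborel. fourier_L2 f \<xi> * cis (x * \<xi>))"
    by (subst in_Hs_inversion[OF assms(1-3)]) (simp add: norm_mult norm_divide)
  also have "\<dots> \<le> 1 * cmod (LINT \<xi>|lborel. fourier_L2 f \<xi> * cis (x * \<xi>))"
    by (intro mult_right_mono fourier_const_le_1) auto
  also have "\<dots> \<le> (LINT \<xi>|lborel. cmod (fourier_L2 f \<xi> * cis (x * \<xi>)))"
    using integral_norm_bound by simp
  also have "\<dots> = (LINT \<xi>|lborel. cmod (fourier_L2 f \<xi>))" by (simp add: norm_mult)
  also have "\<dots> \<le> l * (LINT \<xi>|lborel. (1 + \<xi>\<^sup>2) powr (- s)) +
            (LINT \<xi>|lborel. (1 + \<xi>\<^sup>2) powr s * (cmod (fourier_L2 f \<xi>))\<^sup>2) / l"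
    using in_Hs_fourier[OF assms(2)] assms(1,4)
    by (intro L1_of_Hs_weight(2)) (auto simp: has_fourier_L2_def intro: L2_measurable)
  also have "(LINT \<xi>|lborel. (1 + \<xi>\<^sup>2) powr s * (cmod (fourier_L2 f \<xi>))\<^sup>2) = (Hs_norm s f)\<^sup>2"
    unfolding Hs_norm_def by (subst real_sqrt_pow2) (auto intro!: integral_nonneg_AE)
  finally show ?thesis .
qed

text \<open>By inversion the increment of f is bounded by the integral of |g| |cis (h xi) - 1|. This
  depends on the shift h only and tends to 0 with h by dominated convergence.\<close>

lemma in_Hs_uniformly_continuous:
  assumes "s > 1 / 2" "in_Hs s f" "continuous_on UNIV f"
  shows "uniformly_continuous_on UNIV f"
proof -
  let ?g = "fourier_L2 f"
  note g = in_Hs_imp_L1_fourier[OF assms(1,2)]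
  have [measurable]: "?g \<in> borel_measurable borel" using g by auto
  define m where "m = (\<lambda>h. LINT \<xi>|lborel. cmod (?g \<xi>) * cmod (cis (h * \<xi>) - 1))"
  have "(m \<longlongrightarrow> (LINT \<xi>|(lborel::real measure). 0)) (at 0)"
    unfolding tendsto_at_iff_sequentially
  proof (intro allI impI)
    fix X :: "nat \<Rightarrow> real" assume X: "X \<longlonglongrightarrow> 0"
    show "(m \<circ> X) \<longlonglongrightarrow> (LINT \<xi>|(lborel::real measure). 0)"
      unfolding m_def comp_def
    proof (rule integral_dominated_convergence)
      show "integrable lborel (\<lambda>\<xi>. cmod (?g \<xi>) * 2)" using g by simp
      show "AE \<xi> in lborel. (\<lambda>i. cmod (?g \<xi>) * cmod (cis (X i * \<xi>) - 1)) \<longlonglongrightarrow> 0"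
      proof (rule AE_I2)
        fix \<xi> :: real
        have "isCont cis z" for z
          using continuous_on_cis[OF continuous_on_id, of UNIV] by (simp add: continuous_on_eq_continuous_at)
        note cis_lim = isCont_tendsto_compose[OF this tendsto_mult[OF X tendsto_const]]
        have "(\<lambda>i. cmod (?g \<xi>) * cmod (cis (X i * \<xi>) - 1)) \<longlonglongrightarrow> cmod (?g \<xi>) * cmod (cis (0 * \<xi>) - 1)"
          by (intro tendsto_mult tendsto_const tendsto_norm tendsto_diff cis_lim)
        then show "(\<lambda>i. cmod (?g \<xi>) * cmod (cis (X i * \<xi>) - 1)) \<longlonglongrightarrow> 0" by simp
      qed
      have "cmod (cis z - 1) \<le> 2" for z using norm_triangle_ineq4[of "cis z" 1] by simp
      then show "AE \<xi> in lborel. norm (cmod (?g \<xi>) * cmod (cis (X i * \<xi>) - 1)) \<le> cmod (?g \<xi>) * 2" for i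
        by (intro AE_I2) (auto simp: abs_mult intro!: mult_left_mono)
    qed measurable
  qed
  then have m0: "(m \<longlongrightarrow> 0) (at 0)" by simp
  have I: "integrable lborel (\<lambda>\<xi>. ?g \<xi> * cis (x * \<xi>))" for x
    by (rule Bochner_Integration.integrable_bound[OF g]) (auto simp: norm_mult)
  have le: "cmod (f x - f y) \<le> m (x - y)" for x y
  proof -
    have "f x - f y = complex_of_real (1 / sqrt (2 * pi)) * (LINT \<xi>|lborel. ?g \<xi> * cis (x * \<xi>) - ?g \<xi> * cis (y * \<xi>))"
      by (subst (1 2) in_Hs_inversion[OF assms]) (simp add: I right_diff_distrib diff_divide_distrib)
    then have "cmod (f x - f y) = 1 / sqrt (2 * pi) * cmod (LINT \<xi>|lborel. ?g \<xi> * cis (x * \<xi>) - ?g \<xi> * cis (y * \<xi>))"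
      by (simp add: norm_mult norm_divide)
    also have "\<dots> \<le> 1 * cmod (LINT \<xi>|lborel. ?g \<xi> * cis (x * \<xi>) - ?g \<xi> * cis (y * \<xi>))"
      by (intro mult_right_mono fourier_const_le_1) auto
    also have "\<dots> \<le> (LINT \<xi>|lborel. cmod (?g \<xi> * cis (x * \<xi>) - ?g \<xi> * cis (y * \<xi>)))"
      using integral_norm_bound by simp
    also have "\<dots> = m (x - y)"
      unfolding m_def
    proof (rule Bochner_Integration.integral_cong[OF refl])
      fix \<xi>
      have "?g \<xi> * cis (x * \<xi>) - ?g \<xi> * cis (y * \<xi>) = ?g \<xi> * (cis (y * \<xi>) * (cis ((x - y) * \<xi>) - 1))"
        by (simp add: right_diff_distrib cis_mult) (simp add: algebra_simps)
      then show "cmod (?g \<xi> * cis (x * \<xi>) - ?g \<xi> * cis (y * \<xi>)) = cmod (?g \<xi>) * cmod (cis ((x - y) * \<xi>) - 1)"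
        by (simp only: norm_mult norm_cis mult_1_left)
    qed
    finally show ?thesis .
  qed
  show ?thesis
    unfolding uniformly_continuous_on_def
  proof (intro allI impI)
    fix e :: real assume e: "e > 0"
    from tendstoD[OF m0 e] obtain d where d: "d > 0" "\<And>h. h \<noteq> 0 \<Longrightarrow> \<bar>h\<bar> < d \<Longrightarrow> \<bar>m h\<bar> < e"
      by (auto simp: eventually_at dist_real_def)
    have "dist (f x') (f x) < e" if "dist x' x < d" for x x'
    proof (cases "x = x'")
      case False
      then show ?thesis
        using le[of x' x] d(2)[of "x' - x"] that by (auto simp: dist_norm)
    qed (use e in simp)
    then show "\<exists>d>0. \<forall>x\<in>UNIV. \<forall>x'\<in>UNIV. dist x' x < d \<longrightarrow> dist (f x') (f x) < e"
      using d(1) by auto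
  qed
qed

text \<open>A value of modulus at least e far out would, by uniform continuity, keep |f| above e/2
  on an interval of fixed length 2d. That interval alone contributes (e/2)^2 2d, more than the tail
  of the integral allows.\<close>

lemma L2_uniformly_continuous_tendsto_0:
  assumes f: "L2 f" and uc: "uniformly_continuous_on UNIV f"
  shows "(f \<longlongrightarrow> 0) at_infinity"
proof (rule tendstoI)
  fix e :: real assume e: "e > 0"
  have [measurable]: "f \<in> borel_measurable borel" using f by (rule L2_measurable)
  obtain d' where d': "d' > 0" "\<And>x y. dist y x < d' \<Longrightarrow> dist (f y) (f x) < e / 2"
    using uc e unfolding uniformly_continuous_on_def by (metis UNIV_I half_gt_zero)
  \<comment> \<open>Halving d' makes the closed interval of radius d fit into the range of uniform
    continuity; d <= 1 keeps it inside |y| >= R when |x| >= R + 1.\<close>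
  define d where "d = min (d' / 2) 1"
  have d: "d > 0" "d < d'" "d \<le> 1" using d'(1) by (auto simp: d_def)
  have I: "integrable lborel (\<lambda>y. (cmod (f y))\<^sup>2)" using f by (simp add: L2_def)
  have "((\<lambda>R. LINT y|lborel. indicator {y. R \<le> \<bar>y\<bar>} y *\<^sub>R (cmod (f y))\<^sup>2) \<longlongrightarrow> (LINT y|(lborel::real measure). 0)) at_top"
  proof (rule integral_dominated_convergence_at_top)
    show "integrable lborel (\<lambda>y. (cmod (f y))\<^sup>2)" by (rule I)
    show "AE y in lborel. ((\<lambda>R. indicator {y. R \<le> \<bar>y\<bar>} y *\<^sub>R (cmod (f y))\<^sup>2) \<longlongrightarrow> 0) at_top"
    proof (intro AE_I2 tendsto_eventually)
      fix y :: real
      show "\<forall>\<^sub>F R in at_top. indicator {y. R \<le> \<bar>y\<bar>} y *\<^sub>R (cmod (f y))\<^sup>2 = 0"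
        using eventually_gt_at_top[of "\<bar>y\<bar>"] by eventually_elim auto
    qed
  qed (auto simp: indicator_def)
  then have "((\<lambda>R. LINT y|lborel. indicator {y. R \<le> \<bar>y\<bar>} y *\<^sub>R (cmod (f y))\<^sup>2) \<longlongrightarrow> 0) at_top" by simp
  moreover have "0 < (e / 2)\<^sup>2 * (2 * d)" using e d by simp
  ultimately have "\<forall>\<^sub>F R in at_top. (LINT y|lborel. indicator {y. R \<le> \<bar>y\<bar>} y *\<^sub>R (cmod (f y))\<^sup>2) < (e / 2)\<^sup>2 * (2 * d)"
    by (rule order_tendstoD(2))
  then obtain R where R: "(LINT y|lborel. indicator {y. R \<le> \<bar>y\<bar>} y *\<^sub>R (cmod (f y))\<^sup>2) < (e / 2)\<^sup>2 * (2 * d)"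
    by (auto simp: eventually_at_top_linorder)
  have "cmod (f x) < e" if x: "R + 1 \<le> \<bar>x\<bar>" for x
  proof (rule ccontr)
    assume "\<not> cmod (f x) < e"
    then have ge: "cmod (f x) \<ge> e" by simp
    have J: "integrable lborel (indicator {x-d..x+d} :: real \<Rightarrow> real)"
      using emeasure_compact_finite[of "{x-d..x+d}"] by (intro integrable_real_indicator) auto
    have K: "integrable lborel (\<lambda>y. indicator {y. R \<le> \<bar>y\<bar>} y *\<^sub>R (cmod (f y))\<^sup>2)"
      by (rule Bochner_Integration.integrable_bound[OF I]) (auto simp: indicator_def)
    have "(e / 2)\<^sup>2 * (2 * d) = (LINT y|lborel. (e / 2)\<^sup>2 * indicator {x-d..x+d} y)"
      using d(1) by simp
    also have "\<dots> \<le> (LINT y|lborel. indicator {y. R \<le> \<bar>y\<bar>} y *\<^sub>R (cmod (f y))\<^sup>2)"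
    proof (intro integral_mono integrable_mult_right J K)
      fix y :: real
      show "(e / 2)\<^sup>2 * indicator {x-d..x+d} y \<le> indicator {y. R \<le> \<bar>y\<bar>} y *\<^sub>R (cmod (f y))\<^sup>2"
      proof (cases "y \<in> {x-d..x+d}")
        case True
        then have "dist y x < d'" using d by (auto simp: dist_real_def)
        from d'(2)[OF this] have "cmod (f y - f x) < e / 2" by (simp add: dist_norm)
        then have "e / 2 \<le> cmod (f y)" using ge norm_triangle_ineq2[of "f x" "f y"] by (simp add: norm_minus_commute)
        then have "(e / 2)\<^sup>2 \<le> (cmod (f y))\<^sup>2" using e by (intro power_mono) auto
        moreover have "R \<le> \<bar>y\<bar>" using True x d(3) by auto
        ultimately show ?thesis using True by simp
      qed (auto simp: indicator_def)
    qed
    finally show False using R by simp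
  qed
  then show "\<forall>\<^sub>F x in at_infinity. dist (f x) 0 < e"
    unfolding eventually_at_infinity by (intro exI[of _ "R + 1"]) auto
qed

text \<open>Continuity in time holds uniformly in x by the Sobolev bound for u(., t) - u(., t0), so
  it combines with continuity of the single slice at t0.\<close>

lemma C_Hs_continuous:
  assumes s: "s > 1 / 2" and u: "C_Hs s u"
  shows "continuous_on (UNIV \<times> {0..}) (\<lambda>p. u (fst p) (snd p))"
  unfolding continuous_on_def
proof (intro ballI tendstoI)
  fix p :: "real \<times> real" and e :: real
  assume p: "p \<in> UNIV \<times> {0..}" and e: "e > 0"
  obtain x0 t0 where p': "p = (x0, t0)" "t0 \<ge> 0" using p by (cases p) auto
  have Hs: "in_Hs s (\<lambda>x. u x t)" "continuous_on UNIV (\<lambda>x. u x t)" if "t \<ge> 0" for t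
    using u that by (auto simp: C_Hs_def)
  have lim: "((\<lambda>t. Hs_norm s (\<lambda>x. u x t - u x t0)) \<longlongrightarrow> 0) (at t0 within {0..})"
    using u p' by (simp add: C_Hs_def)
  define A where "A = (LINT \<xi>|lborel. (1 + \<xi>\<^sup>2) powr (- s))"
  have A: "A \<ge> 0" unfolding A_def by (intro integral_nonneg_AE) auto
  \<comment> \<open>This choice makes the first term of the Sobolev bound at most e/4; the norm is
    then required to satisfy norm^2 < l e/4, so that the second term is at most e/4 too. The summand
    1 avoids division by zero.\<close>
  define l where "l = e / (4 * (A + 1))"
  have l: "l > 0" using A e by (simp add: l_def)
  have lA: "l * A \<le> e / 4" using A e by (simp add: l_def field_simps)
  have "((\<lambda>t. (Hs_norm s (\<lambda>x. u x t - u x t0))\<^sup>2) \<longlongrightarrow> 0\<^sup>2) (at t0 within {0..})"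
    by (intro tendsto_power lim)
  from order_tendstoD(2)[OF this, of "l * (e / 4)"]
  have "\<forall>\<^sub>F t in at t0 within {0..}. (Hs_norm s (\<lambda>x. u x t - u x t0))\<^sup>2 < l * (e / 4)"
    using l e by simp
  then obtain d1 where d1: "d1 > 0" "\<And>t. t \<ge> 0 \<Longrightarrow> t \<noteq> t0 \<Longrightarrow> dist t t0 < d1 \<Longrightarrow>
      (Hs_norm s (\<lambda>x. u x t - u x t0))\<^sup>2 < l * (e / 4)"
    by (auto simp: eventually_at)
  have sup: "cmod (u x t - u x t0) \<le> e / 2" if "t \<ge> 0" "dist t t0 < d1" for x t
  proof (cases "t = t0")
    case False
    have "cmod (u x t - u x t0) \<le> l * A + (Hs_norm s (\<lambda>x. u x t - u x t0))\<^sup>2 / l"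
      unfolding A_def using Hs[OF that(1)] Hs[OF p'(2)] l
      by (intro sobolev_bound[OF s in_Hs_diff]) (auto intro: continuous_on_diff)
    also have "(Hs_norm s (\<lambda>x. u x t - u x t0))\<^sup>2 / l \<le> e / 4"
      using d1(2)[OF that(1) False that(2)] l by (simp add: field_simps)
    finally show ?thesis using lA by simp
  qed (use e in simp)
  have "isCont (\<lambda>x. u x t0) x0" using Hs(2)[OF p'(2)] by (simp add: continuous_on_eq_continuous_at)
  then obtain d2 where d2: "d2 > 0" "\<And>x. dist x x0 < d2 \<Longrightarrow> dist (u x t0) (u x0 t0) < e / 2"
    using e unfolding continuous_at_eps_delta by (metis half_gt_zero)
  show "\<forall>\<^sub>F q in at p within UNIV \<times> {0..}. dist (u (fst q) (snd q)) (u (fst p) (snd p)) < e"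
    unfolding eventually_at
  proof (intro exI[of _ "min d1 d2"] conjI ballI impI)
    show "0 < min d1 d2" using d1 d2 by simp
    fix q assume q: "q \<in> UNIV \<times> {0::real..}" "q \<noteq> p \<and> dist q p < min d1 d2"
    have "dist (fst q) x0 < d2" "dist (snd q) t0 < d1"
      using dist_fst_le[of q p] dist_snd_le[of q p] q p' by auto
    with sup[of "snd q" "fst q"] d2(2)[of "fst q"] q
    have "dist (u (fst q) (snd q)) (u (fst q) t0) \<le> e / 2" "dist (u (fst q) t0) (u x0 t0) < e / 2"
      by (auto simp: dist_norm)
    then show "dist (u (fst q) (snd q)) (u (fst p) (snd p)) < e"
      using dist_triangle[of "u (fst q) (snd q)" "u x0 t0" "u (fst q) t0"] p' by simp
  qed
qed

subsection \<open>Bump functions and the du Bois-Reymond lemma\<close>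

text \<open>The analogue of \<open>Ck\<close> on the line. An existentially quantified derivative
  replaces a derivative operator, so each closure property is proved by exhibiting the
  derivative.\<close>

primrec smooth_upto :: "nat \<Rightarrow> (real \<Rightarrow> real) \<Rightarrow> bool" where
  "smooth_upto 0 f \<longleftrightarrow> continuous_on UNIV f"
| "smooth_upto (Suc k) f \<longleftrightarrow> (\<exists>f'. (\<forall>x. (f has_real_derivative f' x) (at x)) \<and> smooth_upto k f')"

lemma smooth_upto_Suc_imp: "smooth_upto (Suc k) f \<Longrightarrow> smooth_upto k f"
proof (induction k arbitrary: f)
  case 0
  then show ?case by (auto intro: continuous_at_imp_continuous_on DERIV_isCont)
next
  case (Suc k)
  then show ?case by (subst (asm) smooth_upto.simps(2)) (auto simp del: smooth_upto.simps(2) simp: smooth_upto.simps(2)[of k])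
qed

lemma smooth_upto_add: "smooth_upto k f \<Longrightarrow> smooth_upto k g \<Longrightarrow> smooth_upto k (\<lambda>x. f x + g x)"
proof (induction k arbitrary: f g)
  case 0
  then show ?case by (auto intro: continuous_intros)
next
  case (Suc k)
  then obtain f' g' where "\<And>x. (f has_real_derivative f' x) (at x)" "smooth_upto k f'"
    "\<And>x. (g has_real_derivative g' x) (at x)" "smooth_upto k g'" by auto
  then show ?case
    using Suc.IH[of f' g'] by (auto intro!: exI[of _ "\<lambda>x. f' x + g' x"] derivative_eq_intros)
qed

lemma smooth_upto_cmult: "smooth_upto k f \<Longrightarrow> smooth_upto k (\<lambda>x. c * f x)"
proof (induction k arbitrary: f)
  case 0
  then show ?case by (auto intro: continuous_intros)
next
  case (Suc k)
  then obtain f' where "\<And>x. (f has_real_derivative f' x) (at x)" "smooth_upto k f'" by auto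
  then show ?case
    using Suc.IH[of f'] by (auto intro!: exI[of _ "\<lambda>x. c * f' x"] DERIV_cmult)
qed

lemma smooth_upto_mult: "smooth_upto k f \<Longrightarrow> smooth_upto k g \<Longrightarrow> smooth_upto k (\<lambda>x. f x * g x)"
proof (induction k arbitrary: f g)
  case 0
  then show ?case by (auto intro: continuous_intros)
next
  case (Suc k)
  then obtain f' g' where *: "\<And>x. (f has_real_derivative f' x) (at x)" "smooth_upto k f'"
    "\<And>x. (g has_real_derivative g' x) (at x)" "smooth_upto k g'" by auto
  have "smooth_upto k (\<lambda>x. f' x * g x + g' x * f x)"
    using * smooth_upto_Suc_imp[OF Suc.prems(1)] smooth_upto_Suc_imp[OF Suc.prems(2)]
    by (intro smooth_upto_add Suc.IH)
  then show ?case
    using * by (auto intro!: exI[of _ "\<lambda>x. f' x * g x + g' x * f x"] DERIV_mult)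
qed

lemma smooth_upto_affine: "smooth_upto k f \<Longrightarrow> smooth_upto k (\<lambda>x. f (c * x + d))"
proof (induction k arbitrary: f)
  case 0
  then show ?case by (auto intro!: continuous_on_compose2[of UNIV f] continuous_intros)
next
  case (Suc k)
  then obtain f' where *: "\<And>x. (f has_real_derivative f' x) (at x)" "smooth_upto k f'" by auto
  have "((\<lambda>x. f (c * x + d)) has_real_derivative c * f' (c * x + d)) (at x)" for x
  proof -
    have "((\<lambda>x. c * x + d) has_real_derivative c) (at x)" by (auto intro!: derivative_eq_intros)
    from DERIV_chain2[OF *(1) this] show ?thesis by (simp add: mult.commute)
  qed
  moreover have "smooth_upto k (\<lambda>x. c * f' (c * x + d))"
    by (intro smooth_upto_cmult Suc.IH *)
  ultimately show ?case
    unfolding smooth_upto.simps(2) by (intro exI[of _ "\<lambda>x. c * f' (c * x + d)"] conjI allI)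
qed

text \<open>The classical flat function exp (-1/x) is the case m = 0. The powers of 1/x are included
  so that the linear span of the family is closed under differentiation.\<close>

definition flat :: "nat \<Rightarrow> real \<Rightarrow> real" where
  "flat m x = (if x > 0 then exp (- inverse x) * inverse x ^ m else 0)"

lemma flat_tendsto_0: "(flat m \<longlongrightarrow> 0) (at 0)"
proof -
  have "((\<lambda>x::real. inverse x ^ m / exp (inverse x)) \<longlongrightarrow> 0) (at_right 0)"
    by (rule filterlim_compose[OF tendsto_power_div_exp_0 filterlim_inverse_at_top_right])
  then have "(flat m \<longlongrightarrow> 0) (at_right 0)"
    by (rule Lim_transform_eventually)
       (auto simp: flat_def exp_minus divide_inverse mult_ac eventually_at_right_less intro!: eventually_at_rightI[of 0 1])
  moreover have "(flat m \<longlongrightarrow> 0) (at_left 0)"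
    by (rule tendsto_eventually) (auto simp: flat_def intro!: eventually_at_leftI[of "-1"])
  ultimately show ?thesis by (simp add: filterlim_at_split)
qed

text \<open>At the origin the difference quotient of \<open>flat m\<close> is
  \<open>flat (m + 1)\<close>, which tends to 0; elsewhere the product rule applies on a
  half-line.\<close>

lemma flat_has_derivative:
  "(flat m has_real_derivative (flat (m + 2) x - real m * flat (m + 1) x)) (at x)"
proof -
  consider "x > 0" | "x < 0" | "x = 0" by linarith
  then show ?thesis
  proof cases
    case 1
    have "((\<lambda>x. exp (- inverse x) * inverse x ^ m) has_real_derivative
        (exp (- inverse x) * (inverse x)\<^sup>2 * inverse x ^ m +
         exp (- inverse x) * (real m * inverse x ^ (m - 1) * - (inverse x)\<^sup>2))) (at x)"
      using 1 by (auto intro!: derivative_eq_intros simp: power2_eq_square)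
    also have "exp (- inverse x) * (inverse x)\<^sup>2 * inverse x ^ m +
         exp (- inverse x) * (real m * inverse x ^ (m - 1) * - (inverse x)\<^sup>2)
         = flat (m + 2) x - real m * flat (m + 1) x"
      using 1 by (cases m) (simp_all add: flat_def power2_eq_square algebra_simps)
    finally have "((\<lambda>x. exp (- inverse x) * inverse x ^ m) has_real_derivative (flat (m + 2) x - real m * flat (m + 1) x)) (at x)" .
    then show ?thesis
      by (rule has_field_derivative_transform_within_open[where S = "{0<..}"]) (use 1 in \<open>auto simp: flat_def\<close>)
  next
    case 2
    have "((\<lambda>x. 0) has_real_derivative 0) (at x)" by simp
    then have "(flat m has_real_derivative 0) (at x)"
      by (rule has_field_derivative_transform_within_open[where S = "{..<0}"]) (use 2 in \<open>auto simp: flat_def\<close>)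
    then show ?thesis using 2 by (simp add: flat_def)
  next
    case 3
    have "((\<lambda>h. flat (Suc m) h) \<longlongrightarrow> 0) (at 0)" by (rule flat_tendsto_0)
    then have "((\<lambda>h. (flat m (0 + h) - flat m 0) / h) \<longlongrightarrow> 0) (at 0)"
      by (rule Lim_transform_eventually) (auto simp: flat_def eventually_at divide_inverse mult_ac intro!: exI[of _ 1])
    then have "(flat m has_real_derivative 0) (at 0)" by (simp add: DERIV_def)
    then show ?thesis using 3 by (simp add: flat_def)
  qed
qed

lemma flat_smooth: "smooth_upto k (flat m)"
proof (induction k arbitrary: m)
  case 0
  show ?case by (auto intro!: continuous_at_imp_continuous_on DERIV_isCont flat_has_derivative)
next
  case (Suc k)
  have "smooth_upto k (\<lambda>x. flat (m + 2) x + (- real m) * flat (m + 1) x)"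
    by (intro smooth_upto_add smooth_upto_cmult Suc)
  then show ?case using flat_has_derivative[of m] by (auto intro!: exI[of _ "\<lambda>x. flat (m + 2) x - real m * flat (m + 1) x"])
qed

definition bump :: "real \<Rightarrow> real \<Rightarrow> real \<Rightarrow> real" where
  "bump p q x = flat 0 (x - p) * flat 0 (q - x)"

lemma bump_smooth: "smooth_upto k (bump p q)"
proof -
  have "smooth_upto k (\<lambda>x. flat 0 (1 * x + (- p)) * flat 0 ((-1) * x + q))"
    by (intro smooth_upto_mult smooth_upto_affine flat_smooth)
  then show ?thesis by (simp add: bump_def[abs_def])
qed

lemma bump_nonneg: "0 \<le> bump p q x"
  by (simp add: bump_def flat_def)

lemma bump_pos: "p < x \<Longrightarrow> x < q \<Longrightarrow> 0 < bump p q x"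
  by (simp add: bump_def flat_def)

lemma bump_eq_0: "x \<notin> {p<..<q} \<Longrightarrow> bump p q x = 0"
  by (auto simp: bump_def flat_def)

lemma continuous_bump: "continuous_on A (bump p q)"
  using bump_smooth[of 0 p q] by (auto intro: continuous_on_subset)

text \<open>If j were positive at x, it would be positive on a small interval around x. There bump
  times j is continuous and nonnegative with integral 0, hence zero, although it is positive at
  x.\<close>

lemma bump_integral_real_eq_0:
  fixes j :: "real \<Rightarrow> real"
  assumes S: "open S" and j: "continuous_on S j"
    and z: "\<And>p q. p < q \<Longrightarrow> {p..q} \<subseteq> S \<Longrightarrow> integral {p..q} (\<lambda>y. bump p q y * j y) = 0"
    and x: "x \<in> S"
  shows "\<not> j x > 0"
proof
  assume pos: "j x > 0"
  have "isCont j x" using S j x by (simp add: continuous_on_eq_continuous_at)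
  then have "\<forall>\<^sub>F y in at x. j y > 0"
    using pos by (auto simp: isCont_def intro: order_tendstoD(1))
  then obtain d where d: "d > 0" "\<And>y. \<bar>y - x\<bar> < d \<Longrightarrow> j y > 0"
    using pos by (auto simp: eventually_at dist_real_def) (metis pos)
  obtain d' where d': "d' > 0" "\<And>y. \<bar>y - x\<bar> < d' \<Longrightarrow> y \<in> S"
    using S x by (auto simp: open_dist dist_real_def)
  define h where "h = min d d' / 2"
  have h: "h > 0" "h < d" "h < d'" using d d' by (auto simp: h_def)
  have sub: "{x-h..x+h} \<subseteq> S" using d'(2) h by auto
  have c: "continuous_on {x-h..x+h} (\<lambda>y. bump (x-h) (x+h) y * j y)"
    by (intro continuous_on_mult continuous_bump continuous_on_subset[OF j sub])
  have "((\<lambda>y. bump (x-h) (x+h) y * j y) has_integral 0) {x-h..x+h}"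
    using integrable_integral[OF integrable_continuous_interval[OF c]] z[OF _ sub] h by simp
  moreover have "0 \<le> bump (x-h) (x+h) y * j y" if "\<bar>y - x\<bar> < d" for y
    using d(2)[OF that] bump_nonneg by (intro mult_nonneg_nonneg) auto
  ultimately have "bump (x-h) (x+h) x * j x = 0"
    using c h by (intro has_integral_0_cbox_imp_0[of "x-h" "x+h" "\<lambda>y. bump (x-h) (x+h) y * j y" x])
      (auto simp del: mult_eq_0_iff)
  then show False using bump_pos[of "x-h" x "x+h"] pos h by auto
qed

text \<open>The real case is applied to the real and imaginary parts and to their negatives;
  \<open>T\<close> stands for either part.\<close>

lemma fundamental_lemma_bump:
  fixes J :: "real \<Rightarrow> complex"
  assumes S: "open S" and j: "continuous_on S J"
    and z: "\<And>p q. p < q \<Longrightarrow> {p..q} \<subseteq> S \<Longrightarrow> integral {p..q} (\<lambda>y. bump p q y *\<^sub>R J y) = 0"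
    and x: "x \<in> S"
  shows "J x = 0"
proof -
  have I: "(\<lambda>y. bump p q y *\<^sub>R J y) integrable_on {p..q}" if "{p..q} \<subseteq> S" for p q
    using that by (intro integrable_continuous_interval continuous_intros continuous_bump continuous_on_subset[OF j])
  have L: "T (J x) = 0" if T: "bounded_linear T" for T :: "complex \<Rightarrow> real"
  proof -
    have cT: "continuous_on S (\<lambda>y. T (J y))"
      by (intro continuous_on_compose2[OF linear_continuous_on[OF T, of UNIV]] j) auto
    have T0: "integral {p..q} (\<lambda>y. bump p q y * T (J y)) = 0" if "p < q" "{p..q} \<subseteq> S" for p q
    proof -
      have "integral {p..q} (T \<circ> (\<lambda>y. bump p q y *\<^sub>R J y)) = T (integral {p..q} (\<lambda>y. bump p q y *\<^sub>R J y))"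
        by (rule integral_linear[OF I[OF that(2)] T])
      then show ?thesis using z[OF that] T
        by (simp add: comp_def linear_simps bounded_linear.linear linear_scale)
    qed
    have "\<not> T (J x) > 0"
      by (rule bump_integral_real_eq_0[OF S cT T0 x])
    moreover have "\<not> - T (J x) > 0"
      by (rule bump_integral_real_eq_0[OF S continuous_on_minus[OF cT] _ x]) (simp add: T0)
    ultimately show ?thesis by simp
  qed
  show ?thesis using L[OF bounded_linear_Re] L[OF bounded_linear_Im] by (simp add: complex_eq_iff)
qed

text \<open>Mean zero is what brings F back to 0 beyond s. For negative t the interval
  \<open>{0..t}\<close> is empty and its integral 0, which is the correct value because f vanishes
  before r > 0.\<close>

lemma antiderivative_compact_support:
  fixes f :: "real \<Rightarrow> real"
  assumes cont: "continuous_on UNIV f" and r: "0 < r" "r \<le> s"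
    and supp: "\<And>t. t \<notin> {r..s} \<Longrightarrow> f t = 0" and int: "integral {r..s} f = 0"
  defines "F \<equiv> \<lambda>t. integral {0..t} f"
  shows "(F has_real_derivative f t) (at t)" and "t \<notin> {r..s} \<Longrightarrow> F t = 0"
proof -
  have I: "f integrable_on {a..b}" for a b
    by (intro integrable_continuous_interval continuous_on_subset[OF cont]) auto
  have low: "F t = 0" if "t < r" for t
  proof -
    have "integral {0..t} f = integral {0..t} (\<lambda>_. 0)"
      using that supp by (intro integral_cong) auto
    then show ?thesis by (simp add: F_def)
  qed
  show "F t = 0" if "t \<notin> {r..s}"
  proof (cases "t < r")
    case False
    then have "s < t" using that by auto
    have "integral {0..t} f = integral {0..r} f + integral {r..s} f + integral {s..t} f"
      using r \<open>s < t\<close> Henstock_Kurzweil_Integration.integral_combine[OF _ _ I, of 0 r t]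
       Henstock_Kurzweil_Integration.integral_combine[OF _ _ I, of r s t] by simp
    moreover have "integral {0..r} f = 0"
    proof -
      have "integral {0..r} f = integral {0..r} (\<lambda>_. 0)"
        by (rule integral_spike[of "{r}"]) (use supp in auto)
      then show ?thesis by simp
    qed
    moreover have "integral {s..t} f = 0"
    proof -
      have "integral {s..t} f = integral {s..t} (\<lambda>_. 0)"
        by (rule integral_spike[of "{s}"]) (use supp in auto)
      then show ?thesis by simp
    qed
    ultimately show ?thesis using int by (simp add: F_def)
  qed (rule low)
  show "(F has_real_derivative f t) (at t)"
  proof (cases "t < r")
    case True
    have "((\<lambda>_. 0) has_real_derivative 0) (at t)" by simp
    then have "(F has_real_derivative 0) (at t)"
      by (rule has_field_derivative_transform_within_open[where S = "{..<r}"]) (use True low in auto)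
    then show ?thesis using True supp by simp
  next
    case False
    have "(F has_real_derivative f t) (at t within {0..t+1})"
      unfolding F_def using False r
      by (intro integral_has_real_derivative continuous_on_subset[OF cont]) auto
    moreover have "at t within {0..t+1} = at t"
      using False r by (intro at_within_interior) simp
    ultimately show ?thesis by (simp only:)
  qed
qed

text \<open>The hypothesis says that the weak derivative of Z on the positive half-line is zero.
  Every bump, corrected by a multiple of one fixed bump, is the derivative of a test function, so Z
  minus its weighted mean over the fixed bump is orthogonal to all bumps.\<close>

lemma du_Bois_Reymond:
  fixes Z :: "real \<Rightarrow> complex"
  assumes Z: "continuous_on {0<..} Z"
    and test: "\<And>b b' r s. 0 < r \<Longrightarrow> r \<le> s \<Longrightarrow> (\<And>k. smooth_upto k b) \<Longrightarrow> (\<And>k. smooth_upto k b') \<Longrightarrow>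
       (\<And>t. (b has_real_derivative b' t) (at t)) \<Longrightarrow>
       (\<And>t. t \<notin> {r..s} \<Longrightarrow> b t = 0) \<Longrightarrow> (\<And>t. t \<notin> {r..s} \<Longrightarrow> b' t = 0) \<Longrightarrow>
       integral {r..s} (\<lambda>t. b' t *\<^sub>R Z t) = 0"
  obtains C where "\<And>t. t > 0 \<Longrightarrow> Z t = C"
proof -
  define n where "n = integral {1..2} (bump 1 2)"
  have Ib: "bump p q integrable_on {a..b}" for p q a b
    by (intro integrable_continuous_interval continuous_bump)
  have IZ: "(\<lambda>t. bump p q t *\<^sub>R Z t) integrable_on {a..b}" if "0 < a" for p q a b
    using that by (intro integrable_continuous_interval continuous_intros continuous_bump continuous_on_subset[OF Z]) auto
  have n: "n \<noteq> 0"
  proof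
    assume "n = 0"
    then have "(bump 1 2 has_integral 0) (cbox 1 2)"
      using integrable_integral[OF Ib, of 1 2 1 2] by (simp add: n_def)
    then have "bump 1 2 (3/2) = 0"
      by (intro has_integral_0_cbox_imp_0[of 1 2 "bump 1 2"]) (auto simp: continuous_bump bump_nonneg)
    then show False using bump_pos[of 1 "3/2" 2] by simp
  qed
  \<comment> \<open>The constant is forced: it must be the mean of Z with respect to the normalised
    bump on the interval from 1 to 2.\<close>
  define C where "C = integral {1..2} (\<lambda>t. bump 1 2 t *\<^sub>R Z t) /\<^sub>R n"
  \<comment> \<open>This transfers integrals between the support of a bump and the common interval
    \<open>{r..s}\<close> that contains both supports.\<close>
  have ext: "integral {r..s} g = integral {p..q} g" if "r \<le> p" "q \<le> s" "\<And>t. t \<notin> {p<..<q} \<Longrightarrow> g t = 0"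
    for r s p q :: real and g :: "real \<Rightarrow> 'x::euclidean_space"
  proof -
    have "{x \<in> {r..s} - {p..q}. g x \<noteq> 0} = {}" using that(3) by (auto simp: not_le)
    moreover have "{x \<in> {p..q} - {r..s}. g x \<noteq> 0} = {}" using that(1,2) by auto
    ultimately show ?thesis by (intro integral_spike_set) (simp_all only: negligible_empty)
  qed
  have "Z t - C = 0" if t: "t > 0" for t
  proof (rule fundamental_lemma_bump[of "{0<..}"])
    show "continuous_on {0<..} (\<lambda>t. Z t - C)" by (intro continuous_intros Z)
    fix p q :: real assume pq: "p < q" "{p..q} \<subseteq> {0<..}"
    have p: "p > 0" using subsetD[OF pq(2), of p] pq(1) by simp
    define m where "m = integral {p..q} (bump p q)"
    define r where "r = min p 1"
    define s where "s = max q 2"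
    have rs: "0 < r" "r \<le> s" "r \<le> p" "r \<le> 1" "q \<le> s" "2 \<le> s" using p pq by (auto simp: r_def s_def)
    \<comment> \<open>Subtracting a multiple of a fixed bump gives mean zero, so the antiderivative is a test function.\<close>
    define b' where "b' = (\<lambda>t. n * bump p q t + (- m) * bump 1 2 t)"
    have sm: "smooth_upto k b'" for k
      unfolding b'_def by (intro smooth_upto_add smooth_upto_cmult bump_smooth)
    have supp: "b' t = 0" if "t \<notin> {r..s}" for t
    proof -
      have "t \<notin> {p<..<q}" "t \<notin> {1<..<2}" using that rs by auto
      then show ?thesis unfolding b'_def by (simp del: greaterThanLessThan_iff add: bump_eq_0)
    qed
    have ib1: "integral {r..s} (bump p q) = m" unfolding m_def using rs by (intro ext) (auto intro: bump_eq_0)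
    have ib2: "integral {r..s} (bump 1 2) = n" unfolding n_def using rs by (intro ext) (auto intro: bump_eq_0)
    have "integral {r..s} b' = n * m + (- m) * n"
      unfolding b'_def by (subst integral_add) (auto intro!: integrable_continuous_interval continuous_intros continuous_bump simp: ib1 ib2)
    then have int: "integral {r..s} b' = 0" by simp
    have cont: "continuous_on UNIV b'" using sm[of 0] by simp
    note anti = antiderivative_compact_support[OF cont rs(1,2) supp int]
    have "smooth_upto k (\<lambda>t. integral {0..t} b')" for k
    proof -
      have "smooth_upto (Suc k) (\<lambda>t. integral {0..t} b')"
        using anti(1) sm[of k] by auto
      then show ?thesis by (rule smooth_upto_Suc_imp)
    qed
    from test[OF rs(1,2) this sm anti(1) anti(2) supp]
    have "0 = integral {r..s} (\<lambda>t. b' t *\<^sub>R Z t)" by simp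
    also have "\<dots> = integral {r..s} (\<lambda>t. n *\<^sub>R (bump p q t *\<^sub>R Z t) + (- m) *\<^sub>R (bump 1 2 t *\<^sub>R Z t))"
      by (simp add: b'_def scaleR_left_distrib scaleR_left_diff_distrib)
    also have "\<dots> = n *\<^sub>R integral {r..s} (\<lambda>t. bump p q t *\<^sub>R Z t) + (- m) *\<^sub>R integral {r..s} (\<lambda>t. bump 1 2 t *\<^sub>R Z t)"
    proof -
      have J: "(\<lambda>t. k *\<^sub>R (bump p q t *\<^sub>R Z t)) integrable_on {r..s}" for k p q
        by (intro integrable_cmul IZ rs)
      show ?thesis by (simp only: Henstock_Kurzweil_Integration.integral_add[OF J J] integral_cmul)
    qed
    also have "integral {r..s} (\<lambda>t. bump p q t *\<^sub>R Z t) = integral {p..q} (\<lambda>t. bump p q t *\<^sub>R Z t)"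
      using rs by (intro ext) (auto simp: bump_eq_0)
    also have "integral {r..s} (\<lambda>t. bump 1 2 t *\<^sub>R Z t) = n *\<^sub>R C"
      unfolding C_def using rs n by (simp, intro ext) (auto simp: bump_eq_0)
    finally have "n *\<^sub>R (integral {p..q} (\<lambda>t. bump p q t *\<^sub>R Z t) - m *\<^sub>R C) = 0"
      by (simp add: algebra_simps)
    then have "integral {p..q} (\<lambda>t. bump p q t *\<^sub>R Z t) - m *\<^sub>R C = 0" using n by simp
    moreover have "integral {p..q} (\<lambda>t. bump p q t *\<^sub>R C) = m *\<^sub>R C"
      unfolding m_def by (rule integral_unique[OF has_integral_scaleR_left[OF integrable_integral[OF Ib]]])
    moreover have "(\<lambda>t. bump p q t *\<^sub>R C) integrable_on {p..q}"
      by (intro integrable_continuous_interval continuous_intros continuous_bump)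
    ultimately show "integral {p..q} (\<lambda>t. bump p q t *\<^sub>R (Z t - C)) = 0"
      by (simp add: scaleR_diff_right integral_diff IZ p)
  qed (use t in auto)
  then show ?thesis by (intro that[of C]) simp
qed

subsection \<open>Integration of the transport equation along characteristics\<close>

lemma continuous_on_compose_pair:
  assumes "continuous_on S (\<lambda>p. f (fst p) (snd p))" "continuous_on A g" "continuous_on A h"
    and "\<And>x. x \<in> A \<Longrightarrow> (g x, h x) \<in> S"
  shows "continuous_on A (\<lambda>x. f (g x) (h x))"
  using continuous_on_compose2[OF assms(1) continuous_on_Pair[OF assms(2,3)]] assms(4) by auto

lemma differentiable_partial:
  assumes "\<phi> differentiable (at (x, t))"
  shows "(\<lambda>x. \<phi> (x, t)) differentiable (at x)" "(\<lambda>t. \<phi> (x, t)) differentiable (at t)"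
proof -
  have "(\<lambda>x. (x, t)) differentiable (at x)" "(\<lambda>t. (x, t)) differentiable (at t)"
    by (auto simp: differentiable_def intro!: exI derivative_eq_intros)
  then show "(\<lambda>x. \<phi> (x, t)) differentiable (at x)" "(\<lambda>t. \<phi> (x, t)) differentiable (at t)"
    using assms differentiable_chain_at[of "\<lambda>x. (x, t)" x \<phi>] differentiable_chain_at[of "\<lambda>t. (x, t)" t \<phi>]
    by (auto simp: comp_def)
qed

lemma Ck_add: "Ck k \<phi> \<Longrightarrow> Ck k \<psi> \<Longrightarrow> Ck k (\<lambda>p. \<phi> p + \<psi> p)"
proof (induction k arbitrary: \<phi> \<psi>)
  case 0
  then show ?case by (auto intro: continuous_on_add)
next
  case (Suc k)
  then have d: "\<phi> differentiable (at p)" "\<psi> differentiable (at p)" for p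
    unfolding Ck.simps by blast+
  have "dx (\<lambda>p. \<phi> p + \<psi> p) = (\<lambda>p. dx \<phi> p + dx \<psi> p)" "dt (\<lambda>p. \<phi> p + \<psi> p) = (\<lambda>p. dt \<phi> p + dt \<psi> p)"
    unfolding dx_def dt_def
    by (auto intro!: ext vector_derivative_add_at differentiable_partial d)
  then show ?case using Suc d by (auto intro: differentiable_add)
qed

text \<open>For these products a(x - c t) b(t) the terms with a' cancel in the transport operator,
  which leaves a(x - c t) b'(t): the first factor only localises in the choice of
  characteristic.\<close>

lemma
  assumes a: "\<And>x. (a has_real_derivative a' x) (at x)" and b: "\<And>x. (b has_real_derivative b' x) (at x)"
  shows dx_travelling: "dx (\<lambda>p. complex_of_real (a (fst p - c * snd p) * b (snd p)))
      = (\<lambda>p. complex_of_real (a' (fst p - c * snd p) * b (snd p)))" (is "dx ?\<phi> = ?dx")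
    and dt_travelling: "dt (\<lambda>p. complex_of_real (a (fst p - c * snd p) * b (snd p)))
      = (\<lambda>p. complex_of_real ((- c * a' (fst p - c * snd p)) * b (snd p)) + complex_of_real (a (fst p - c * snd p) * b' (snd p)))"
       (is "dt ?\<phi> = ?dt")
    and differentiable_travelling: "(\<lambda>p. complex_of_real (a (fst p - c * snd p) * b (snd p))) differentiable (at p)"
proof -
  show "dx ?\<phi> = ?dx"
  proof
    fix p :: "real \<times> real"
    have "((\<lambda>x. a (x - c * snd p)) has_real_derivative a' (fst p - c * snd p)) (at (fst p))"
    proof -
      have "((\<lambda>x. x - c * snd p) has_real_derivative 1) (at (fst p))" by (auto intro!: derivative_eq_intros)
      from DERIV_chain2[OF a this] show ?thesis by simp
    qed
    from has_vector_derivative_of_real[OF DERIV_cmult_right[OF this, of "b (snd p)"]]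
    show "dx ?\<phi> p = ?dx p"
      unfolding dx_def by (auto intro: vector_derivative_at)
  qed
  show "dt ?\<phi> = ?dt"
  proof
    fix p :: "real \<times> real"
    have "((\<lambda>t. fst p - c * t) has_real_derivative (- c)) (at (snd p))"
      by (auto intro!: derivative_eq_intros)
    from DERIV_mult[OF DERIV_chain2[OF a this] b]
    have "((\<lambda>t. a (fst p - c * t) * b t) has_real_derivative
      (- c * a' (fst p - c * snd p)) * b (snd p) + a (fst p - c * snd p) * b' (snd p)) (at (snd p))"
      by (simp add: mult_ac)
    from has_vector_derivative_of_real[OF this]
    show "dt ?\<phi> p = ?dt p"
      unfolding dt_def by (auto intro: vector_derivative_at)
  qed
  have "((\<lambda>p. fst p - c * snd p) has_derivative (\<lambda>p. fst p - c * snd p)) (at p)"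
    by (auto intro!: derivative_eq_intros)
  from DERIV_compose_FDERIV[OF a this]
  have 1: "(\<lambda>p. a (fst p - c * snd p)) differentiable (at p)" by (auto simp: differentiable_def)
  have "(snd has_derivative snd) (at p)"
    by (auto intro!: derivative_eq_intros)
  from DERIV_compose_FDERIV[OF b this]
  have 2: "(\<lambda>p. b (snd p)) differentiable (at p)" by (auto simp: differentiable_def)
  from differentiable_mult[OF 1 2]
  obtain D where "((\<lambda>p. a (fst p - c * snd p) * b (snd p)) has_derivative D) (at p)" by (auto simp: differentiable_def)
  from has_derivative_of_real[OF this] show "?\<phi> differentiable (at p)" by (auto simp: differentiable_def)
qed

text \<open>Both partial derivatives are sums of functions of the same form with derived profiles,
  so the induction is run with both profiles arbitrary.\<close>

lemma Ck_travelling: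
  "smooth_upto k a \<Longrightarrow> smooth_upto k b \<Longrightarrow> Ck k (\<lambda>p. complex_of_real (a (fst p - c * snd p) * b (snd p)))"
proof (induction k arbitrary: a b)
  case 0
  then show ?case
    by (auto intro!: continuous_intros continuous_on_compose2[of UNIV a] continuous_on_compose2[of UNIV b])
next
  case (Suc k)
  then obtain a' b' where *: "\<And>x. (a has_real_derivative a' x) (at x)" "smooth_upto k a'"
    "\<And>x. (b has_real_derivative b' x) (at x)" "smooth_upto k b'" by auto
  have ab: "smooth_upto k a" "smooth_upto k b" using smooth_upto_Suc_imp[OF Suc.prems(1)] smooth_upto_Suc_imp[OF Suc.prems(2)] by this+
  show ?case
    unfolding Ck.simps dx_travelling[OF *(1,3)] dt_travelling[OF *(1,3)]
    using differentiable_travelling[OF *(1,3)]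
    by (intro conjI allI Ck_add Suc.IH smooth_upto_cmult * ab)
qed

lemma compact_sheared_rectangle:
  "compact {p :: real \<times> real. fst p - c * snd p \<in> {P..Q} \<and> snd p \<in> {r..s}}"
proof -
  have "{p :: real \<times> real. fst p - c * snd p \<in> {P..Q} \<and> snd p \<in> {r..s}} = (\<lambda>p. (fst p + c * snd p, snd p)) ` ({P..Q} \<times> {r..s})"
  proof (intro equalityI subsetI)
    fix p :: "real \<times> real" assume "p \<in> {p. fst p - c * snd p \<in> {P..Q} \<and> snd p \<in> {r..s}}"
    then show "p \<in> (\<lambda>p. (fst p + c * snd p, snd p)) ` ({P..Q} \<times> {r..s})"
      by (intro image_eqI[of _ _ "(fst p - c * snd p, snd p)"]) (cases p, auto)
  qed auto
  then show ?thesis by (auto intro!: compact_continuous_image continuous_intros compact_Times)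
qed

lemma test_function_travelling:
  assumes "\<And>k. smooth_upto k a" "\<And>k. smooth_upto k b" "0 < r"
    and "\<And>y. y \<notin> {P..Q} \<Longrightarrow> a y = 0" "\<And>t. t \<notin> {r..s} \<Longrightarrow> b t = 0"
  shows "test_function (\<lambda>p. complex_of_real (a (fst p - c * snd p) * b (snd p)))" (is "test_function ?\<phi>")
proof -
  let ?K = "{p :: real \<times> real. fst p - c * snd p \<in> {P..Q} \<and> snd p \<in> {r..s}}"
  have K: "compact ?K" by (rule compact_sheared_rectangle)
  have "{p. ?\<phi> p \<noteq> 0} \<subseteq> ?K" using assms(4,5) by auto
  then have sub: "closure {p. ?\<phi> p \<noteq> 0} \<subseteq> ?K"
    using compact_imp_closed[OF K] by (rule closure_minimal)
  moreover have "compact (closure {p. ?\<phi> p \<noteq> 0})"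
    using compact_Int_closed[OF K closed_closure[of "{p. ?\<phi> p \<noteq> 0}"]] unfolding Int_absorb1[OF sub] .
  moreover have "?K \<subseteq> UNIV \<times> {0<..}" using assms(3) by auto
  ultimately show ?thesis
    unfolding test_function_def using Ck_travelling[OF assms(1,2)] by blast
qed

lemma integrable_of_compact_support:
  fixes f :: "'a::euclidean_space \<Rightarrow> complex"
  assumes "continuous_on UNIV f" "compact K" "\<And>x. x \<notin> K \<Longrightarrow> f x = 0"
  shows "integrable lborel f"
proof -
  have "integrable lborel (\<lambda>x. indicator K x *\<^sub>R f x)"
    by (intro borel_integrable_compact assms continuous_on_subset[OF assms(1)]) auto
  moreover have "indicator K x *\<^sub>R f x = f x" for x using assms(3)[of x] by (auto simp: indicator_def)
  ultimately show ?thesis by simp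
qed

lemma lborel_eq_integral_interval:
  fixes f :: "real \<Rightarrow> complex"
  assumes "continuous_on UNIV f" "\<And>x. x \<notin> {a..b} \<Longrightarrow> f x = 0"
  shows "(LINT x|lborel. f x) = integral {a..b} f"
proof -
  have "integrable lborel (\<lambda>x. indicator {a..b} x *\<^sub>R f x)"
    by (intro borel_integrable_compact continuous_on_subset[OF assms(1)]) auto
  then have "(LINT x:{a..b}|lborel. f x) = integral {a..b} f"
    by (intro set_borel_integral_eq_integral) (simp add: set_integrable_def)
  moreover have "indicator {a..b} x *\<^sub>R f x = f x" for x using assms(2)[of x] by (auto simp: indicator_def)
  ultimately show ?thesis by (simp add: set_lebesgue_integral_def)
qed

text \<open>At fixed t the shear is a translation in x, so Lebesgue measure is preserved; Fubini
  then puts the integration along the characteristic inside.\<close>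

lemma integral_shear:
  fixes f :: "real \<Rightarrow> real \<Rightarrow> complex"
  assumes cont: "continuous_on UNIV (\<lambda>p. f (fst p) (snd p))"
    and supp: "\<And>y t. y \<notin> {P..Q} \<or> t \<notin> {r..s} \<Longrightarrow> f y t = 0"
  shows "integrable lborel (\<lambda>p. f (fst p - c * snd p) (snd p))"
    and "(LINT p|lborel. f (fst p - c * snd p) (snd p)) = integral {P..Q} (\<lambda>y. integral {r..s} (f y))"
proof -
  have c1: "continuous_on UNIV (\<lambda>p. f (fst p - c * snd p) (snd p))"
    by (intro continuous_on_compose_pair[OF cont] continuous_intros) auto
  show 1: "integrable lborel (\<lambda>p. f (fst p - c * snd p) (snd p))"
    by (rule integrable_of_compact_support[OF c1 compact_sheared_rectangle[of c P Q r s]]) (intro supp, auto simp: mem_Times_iff)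
  have 2: "integrable lborel (\<lambda>p. f (fst p) (snd p))"
    by (rule integrable_of_compact_support[OF cont compact_Times[OF compact_Icc compact_Icc], of P Q r s]) (intro supp, auto simp: mem_Times_iff)
  have c2: "continuous_on UNIV (f y)" for y
    using continuous_on_compose_pair[OF cont, of UNIV "\<lambda>_. y" "\<lambda>t. t"] by simp
  have c3: "continuous_on UNIV (\<lambda>y. integral {r..s} (f y))"
    using integral_continuous_on_param[of UNIV r s f] cont
    by (simp add: case_prod_unfold continuous_on_subset)
  have "(LINT p|lborel. f (fst p - c * snd p) (snd p)) = (LINT t|lborel. LINT x|lborel. f (x - c * t) t)"
    using lborel_pair.integral_snd[of "\<lambda>x t. f (x - c * t) t"] 1 by (simp add: lborel_prod case_prod_unfold)
  also have "\<dots> = (LINT t|lborel. LINT y|lborel. f y t)"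
    using lborel_integral_real_affine[of 1 "\<lambda>x. f (x - c * t) t" "c * t" for t] by simp
  also have "\<dots> = (LINT y|lborel. LINT t|lborel. f y t)"
    using 2 by (intro lborel_pair.Fubini_integral) (simp add: lborel_prod case_prod_unfold)
  also have "\<dots> = (LINT y|lborel. integral {r..s} (f y))"
    using supp by (intro Bochner_Integration.integral_cong lborel_eq_integral_interval c2) auto
  also have "\<dots> = integral {P..Q} (\<lambda>y. integral {r..s} (f y))"
  proof (rule lborel_eq_integral_interval[OF c3])
    fix y assume "y \<notin> {P..Q}"
    then have "f y = (\<lambda>t. 0)" using supp by auto
    then show "integral {r..s} (f y) = 0" by simp
  qed
  finally show "(LINT p|lborel. f (fst p - c * snd p) (snd p)) = integral {P..Q} (\<lambda>y. integral {r..s} (f y))" .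
qed

text \<open>Testing with a(x - c t) b(t) shows that the integral along the characteristic through y,
  as a function of y, is orthogonal to every bump a. It is continuous in y, so it vanishes on every
  characteristic and not just on almost every one. \<open>W\<close> and \<open>\<Phi>\<close> extend
  the functions to negative times, where w and F carry no information.\<close>

lemma transport_eq_weak_characteristic:
  fixes w F :: "real \<Rightarrow> real \<Rightarrow> complex"
  assumes eq: "transport_eq c w F"
    and W: "continuous_on UNIV (\<lambda>p. W (fst p) (snd p))" "\<And>y t. t \<ge> 0 \<Longrightarrow> W y t = w (y + c * t) t"
    and \<Phi>: "continuous_on UNIV (\<lambda>p. \<Phi> (fst p) (snd p))" "\<And>y t. t \<ge> 0 \<Longrightarrow> \<Phi> y t = F (y + c * t) t"
    and r: "0 < r" and b: "\<And>k. smooth_upto k b" "\<And>k. smooth_upto k b'"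
    and b': "\<And>t. (b has_real_derivative b' t) (at t)"
    and supp: "\<And>t. t \<notin> {r..s} \<Longrightarrow> b t = 0" "\<And>t. t \<notin> {r..s} \<Longrightarrow> b' t = 0"
  shows "integral {r..s} (\<lambda>t. - \<i> * W y t * b' t - \<Phi> y t * b t) = 0"
proof -
  have cb: "continuous_on A b" "continuous_on A b'" for A
    using b(1)[of 0] b(2)[of 0] by (auto intro: continuous_on_subset)
  define J where "J = (\<lambda>y. integral {r..s} (\<lambda>t. - \<i> * W y t * b' t - \<Phi> y t * b t))"
  have cint: "continuous_on UNIV (\<lambda>p. - \<i> * W (fst p) (snd p) * b' (snd p) - \<Phi> (fst p) (snd p) * b (snd p))"
    by (intro continuous_intros W \<Phi> continuous_on_compose2[OF cb(1)] continuous_on_compose2[OF cb(2)]) auto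
  have cJ: "continuous_on UNIV J"
    unfolding J_def
    using integral_continuous_on_param[of UNIV r s "\<lambda>y t. - \<i> * W y t * b' t - \<Phi> y t * b t"] cint
    by (simp add: case_prod_unfold continuous_on_subset)
  have "J y = 0"
  proof (rule fundamental_lemma_bump[OF open_UNIV cJ _ UNIV_I])
    fix P Q :: real assume "P < Q"
    define a where "a = bump P Q"
    have sa: "smooth_upto k a" for k unfolding a_def by (rule bump_smooth)
    obtain a' where a': "\<And>x. (a has_real_derivative a' x) (at x)" using sa[of "Suc 0"] by auto
    have a0: "a y = 0" if "y \<notin> {P..Q}" for y unfolding a_def using that by (intro bump_eq_0) auto
    have ca: "continuous_on A a" for A unfolding a_def by (rule continuous_bump)
    let ?\<phi> = "\<lambda>p. complex_of_real (a (fst p - c * snd p) * b (snd p))"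
    have test: "test_function ?\<phi>"
      by (rule test_function_travelling[where P=P and Q=Q and r=r and s=s]) (use sa b r a0 supp in auto)
    have d: "dt ?\<phi> p + complex_of_real c * dx ?\<phi> p = complex_of_real (a (fst p - c * snd p) * b' (snd p))" for p
      unfolding dx_travelling[OF a' b'] dt_travelling[OF a' b'] by simp
    define f where "f = (\<lambda>y t. - \<i> * W y t * (complex_of_real (a y) * b' t))"
    define g where "g = (\<lambda>y t. \<Phi> y t * (complex_of_real (a y) * b t))"
    have ab: "continuous_on UNIV (\<lambda>p::real\<times>real. complex_of_real (a (fst p)))"
      "continuous_on UNIV (\<lambda>p::real\<times>real. complex_of_real (b (snd p)))"
      "continuous_on UNIV (\<lambda>p::real\<times>real. complex_of_real (b' (snd p)))"
      by (intro continuous_intros continuous_on_compose2[OF cb(1)] continuous_on_compose2[OF cb(2)] continuous_on_compose2[OF ca]; auto)+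
    have cf: "continuous_on UNIV (\<lambda>p. f (fst p) (snd p))" and cg: "continuous_on UNIV (\<lambda>p. g (fst p) (snd p))"
      unfolding f_def g_def by (intro continuous_intros W \<Phi> ab)+
    have sf: "f y t = 0" "g y t = 0" if "y \<notin> {P..Q} \<or> t \<notin> {r..s}" for y t
      using that a0 supp by (auto simp: f_def g_def)
    \<comment> \<open>On the support in time t >= r > 0, so \<open>W\<close> agrees with w there;
      elsewhere b' makes both sides vanish.\<close>
    have wf: "- \<i> * w (fst p) (snd p) * (dt ?\<phi> p + complex_of_real c * dx ?\<phi> p) = f (fst p - c * snd p) (snd p)" for p
    proof (cases "snd p \<in> {r..s}")
      case True
      then show ?thesis unfolding d f_def using r by (simp add: W(2))
    next
      case False
      then have "b' (snd p) = 0" by (rule supp)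
      then show ?thesis unfolding d f_def by simp
    qed
    have Fg: "F (fst p) (snd p) * ?\<phi> p = g (fst p - c * snd p) (snd p)" for p
    proof (cases "snd p \<in> {r..s}")
      case True
      then show ?thesis unfolding g_def using r by (simp add: \<Phi>(2))
    next
      case False
      then have "b (snd p) = 0" by (rule supp)
      then show ?thesis unfolding g_def by simp
    qed
    have "(LINT p|lborel. f (fst p - c * snd p) (snd p)) = (LINT p|lborel. g (fst p - c * snd p) (snd p))"
      using eq[unfolded transport_eq_def, rule_format, OF test] unfolding wf Fg .
    then have *: "integral {P..Q} (\<lambda>y. integral {r..s} (f y)) = integral {P..Q} (\<lambda>y. integral {r..s} (g y))"
      using integral_shear(2)[of f, OF cf sf(1), where c=c] integral_shear(2)[of g, OF cg sf(2), where c=c]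
      by (simp only:)
    have fy: "continuous_on UNIV (f y)" "continuous_on UNIV (g y)" for y
      using continuous_on_compose_pair[OF cf, of UNIV "\<lambda>_. y" "\<lambda>t. t"]
        continuous_on_compose_pair[OF cg, of UNIV "\<lambda>_. y" "\<lambda>t. t"] by simp_all
    have cif: "continuous_on UNIV (\<lambda>y. integral {r..s} (f y))" "continuous_on UNIV (\<lambda>y. integral {r..s} (g y))"
      using integral_continuous_on_param[of UNIV r s f] integral_continuous_on_param[of UNIV r s g] cf cg
      by (simp_all add: case_prod_unfold continuous_on_subset)
    have "integral {P..Q} (\<lambda>y. a y *\<^sub>R J y) = integral {P..Q} (\<lambda>y. integral {r..s} (f y) - integral {r..s} (g y))"
    proof (rule integral_cong)
      fix y
      have "integral {r..s} (f y) - integral {r..s} (g y) = integral {r..s} (\<lambda>t. f y t - g y t)"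
        by (intro Henstock_Kurzweil_Integration.integral_diff[symmetric] integrable_continuous_interval continuous_on_subset[OF fy(1)] continuous_on_subset[OF fy(2)]) auto
      also have "\<dots> = integral {r..s} (\<lambda>t. a y *\<^sub>R (- \<i> * W y t * b' t - \<Phi> y t * b t))"
        unfolding f_def g_def by (intro integral_cong) (simp add: scaleR_conv_of_real algebra_simps)
      finally show "a y *\<^sub>R J y = integral {r..s} (f y) - integral {r..s} (g y)"
        unfolding J_def by simp
    qed
    also have "\<dots> = integral {P..Q} (\<lambda>y. integral {r..s} (f y)) - integral {P..Q} (\<lambda>y. integral {r..s} (g y))"
      by (intro Henstock_Kurzweil_Integration.integral_diff integrable_continuous_interval continuous_on_subset[OF cif(1)] continuous_on_subset[OF cif(2)]) auto
    also have "\<dots> = 0" using * by simp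
    finally show "integral {P..Q} (\<lambda>y. bump P Q y *\<^sub>R J y) = 0" by (simp add: a_def)
  qed
  then show ?thesis by (simp add: J_def)
qed

text \<open>Integration by parts with the antiderivative of the right-hand side along the
  characteristic turns the weak equation into a vanishing weak derivative, and
  \<open>du_Bois_Reymond\<close> integrates it.\<close>

lemma transport_eq_imp_mild:
  fixes w F :: "real \<Rightarrow> real \<Rightarrow> complex"
  assumes eq: "transport_eq c w F"
    and w: "continuous_on (UNIV \<times> {0..}) (\<lambda>p. w (fst p) (snd p))"
    and F: "continuous_on (UNIV \<times> {0..}) (\<lambda>p. F (fst p) (snd p))"
    and t: "t \<ge> 0"
  shows "w (y + c * t) t = w y 0 - \<i> * integral {0..t} (\<lambda>\<tau>. F (y + c * \<tau>) \<tau>)"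
proof -
  \<comment> \<open>Values at negative times are frozen at t = 0, which gives a continuous function
    on the whole plane.\<close>
  define W where "W = (\<lambda>y t. w (y + c * max 0 t) (max 0 t))"
  define \<Phi> where "\<Phi> = (\<lambda>y t. F (y + c * max 0 t) (max 0 t))"
  have cW: "continuous_on UNIV (\<lambda>p. W (fst p) (snd p))" and c\<Phi>: "continuous_on UNIV (\<lambda>p. \<Phi> (fst p) (snd p))"
    unfolding W_def \<Phi>_def
    by (intro continuous_on_compose_pair[OF w] continuous_on_compose_pair[OF F] continuous_intros; simp)+
  have cy: "continuous_on A (W y)" "continuous_on A (\<Phi> y)" for A
    using continuous_on_compose_pair[OF cW, of A "\<lambda>_. y" "\<lambda>t. t"]
      continuous_on_compose_pair[OF c\<Phi>, of A "\<lambda>_. y" "\<lambda>t. t"] by simp_all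
  define \<Psi> where "\<Psi> = (\<lambda>t. integral {0..t} (\<Phi> y))"
  have \<Psi>d: "(\<Psi> has_vector_derivative \<Phi> y t) (at t within {0..s})" if "t \<in> {0..s}" for t s
    unfolding \<Psi>_def using that by (intro integral_has_vector_derivative cy)
  have c\<Psi>': "continuous_on {0..s} \<Psi>" for s
    using \<Psi>d by (intro continuous_on_vector_derivative) blast
  have c\<Psi>: "isCont \<Psi> t" if "t > 0" for t
    using c\<Psi>'[of "t + 1"] that by (intro continuous_on_interior[of "{0..t+1}"]) auto
  \<comment> \<open>The integral of Phi b equals minus that of Psi b', so the weak equation says
    that b' integrates to 0 against exactly this combination.\<close>
  define Z where "Z = (\<lambda>t. - \<i> * W y t + \<Psi> t)"
  have cZ: "continuous_on {0..s} Z" for s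
    unfolding Z_def by (intro continuous_intros cy c\<Psi>')
  obtain C where C: "\<And>t. t > 0 \<Longrightarrow> Z t = C"
  proof (rule du_Bois_Reymond)
    show "continuous_on {0<..} Z"
      unfolding Z_def using c\<Psi> by (intro continuous_intros cy continuous_at_imp_continuous_on) auto
    fix b b' :: "real \<Rightarrow> real" and r s :: real
    assume r: "0 < r" "r \<le> s" and b: "\<And>k. smooth_upto k b" "\<And>k. smooth_upto k b'"
      and b': "\<And>t. (b has_real_derivative b' t) (at t)"
      and supp: "\<And>t. t \<notin> {r..s} \<Longrightarrow> b t = 0" "\<And>t. t \<notin> {r..s} \<Longrightarrow> b' t = 0"
    have cb: "continuous_on A b" "continuous_on A b'" for A
      using b(1)[of 0] b(2)[of 0] by (auto intro: continuous_on_subset)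
    have "integral {r..s} (\<lambda>t. - \<i> * W y t * b' t - \<Phi> y t * b t) = 0"
      by (rule transport_eq_weak_characteristic[OF eq cW _ c\<Phi> _ r(1) b b' supp]) (auto simp: W_def \<Phi>_def)
    moreover have "integral {r..s} (\<lambda>t. \<Phi> y t * b t + \<Psi> t * b' t) = 0"
    proof -
      \<comment> \<open>The support condition is silent about the endpoints; there b vanishes as a
        one-sided limit from outside.\<close>
      have bz: "b r = 0" "b s = 0"
      proof -
        have "b \<midarrow>r\<rightarrow> b r" "b \<midarrow>s\<rightarrow> b s" using DERIV_isCont[OF b'] by (auto simp: isCont_def)
        then have "(b \<longlongrightarrow> b r) (at_left r)" "(b \<longlongrightarrow> b s) (at_right s)"
          by (auto simp: filterlim_at_split)
        moreover have "(b \<longlongrightarrow> 0) (at_left r)" "(b \<longlongrightarrow> 0) (at_right s)"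
          by (auto intro!: tendsto_eventually eventually_at_leftI[of "r - 1"] eventually_at_rightI[of _ "s + 1"] supp)
        ultimately show "b r = 0" "b s = 0"
          by (auto dest: tendsto_unique[rotated])
      qed
      have "((\<lambda>t. \<Phi> y t * b t + \<Psi> t * b' t) has_integral \<Psi> s * b s - \<Psi> r * b r) {r..s}"
      proof (rule fundamental_theorem_of_calculus[OF r(2)])
        fix t assume t: "t \<in> {r..s}"
        have 1: "(\<Psi> has_vector_derivative \<Phi> y t) (at t within {r..s})"
          using t r by (intro has_vector_derivative_within_subset[OF \<Psi>d[of t s]]) auto
        have 2: "((\<lambda>t. complex_of_real (b t)) has_vector_derivative complex_of_real (b' t)) (at t within {r..s})"
          by (rule has_vector_derivative_at_within[OF has_vector_derivative_of_real[OF b']])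
        from has_vector_derivative_mult[OF 1 2]
        show "((\<lambda>t. \<Psi> t * b t) has_vector_derivative \<Phi> y t * b t + \<Psi> t * b' t) (at t within {r..s})"
          by (simp add: add.commute)
      qed
      then show ?thesis using bz by (simp add: integral_unique)
    qed
    moreover have "integral {r..s} (\<lambda>t. (- \<i> * W y t * b' t - \<Phi> y t * b t) + (\<Phi> y t * b t + \<Psi> t * b' t)) =
       integral {r..s} (\<lambda>t. - \<i> * W y t * b' t - \<Phi> y t * b t) + integral {r..s} (\<lambda>t. \<Phi> y t * b t + \<Psi> t * b' t)"
      using r by (intro Henstock_Kurzweil_Integration.integral_add integrable_continuous_interval continuous_intros cy cb continuous_on_subset[OF c\<Psi>'[of s]]) auto
    moreover have "(\<lambda>t. b' t *\<^sub>R Z t) = (\<lambda>t. (- \<i> * W y t * b' t - \<Phi> y t * b t) + (\<Phi> y t * b t + \<Psi> t * b' t))"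
      by (auto simp: Z_def scaleR_conv_of_real algebra_simps)
    ultimately show "integral {r..s} (\<lambda>t. b' t *\<^sub>R Z t) = 0" by simp
  qed blast
  \<comment> \<open>Test functions see positive times only; continuity of Z at 0 is what brings in
    the initial value.\<close>
  have "Z 0 = C"
  proof -
    have "(Z \<longlongrightarrow> Z 0) (at 0 within {0..1})" using cZ[of 1] by (auto simp: continuous_on_def)
    then have "(Z \<longlongrightarrow> Z 0) (at_right 0)" by (simp add: at_within_Icc_at_right)
    moreover have "(Z \<longlongrightarrow> C) (at_right 0)"
      by (intro tendsto_eventually eventually_at_rightI[of 0 1]) (auto simp: C)
    ultimately show ?thesis by (auto dest: tendsto_unique[rotated])
  qed
  then have "Z t = Z 0" using C[of t] t by (cases "t = 0") auto
  then have "- \<i> * W y t + \<Psi> t = - \<i> * W y 0" by (simp add: Z_def \<Psi>_def)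
  then have "\<i> * (- \<i> * W y t + \<Psi> t) = \<i> * (- \<i> * W y 0)" by simp
  then have "W y t = W y 0 - \<i> * \<Psi> t" by (simp add: algebra_simps)
  moreover have "\<Psi> t = integral {0..t} (\<lambda>\<tau>. F (y + c * \<tau>) \<tau>)"
    unfolding \<Psi>_def by (intro integral_cong) (auto simp: \<Phi>_def)
  ultimately show ?thesis using t by (simp add: W_def)
qed

subsection \<open>Charge conservation and pointwise bounds\<close>

text \<open>Fubini for f extended by 0 off the triangle through the indicator, since continuity is
  available on the triangle only.\<close>

lemma triangle_swap:
  fixes f :: "real \<Rightarrow> real \<Rightarrow> real"
  assumes cont: "continuous_on {p. a \<le> fst p \<and> fst p \<le> snd p \<and> snd p \<le> b} (\<lambda>p. f (fst p) (snd p))"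
  shows "integral {a..b} (\<lambda>x. integral {x..b} (\<lambda>y. f x y)) = integral {a..b} (\<lambda>y. integral {a..y} (\<lambda>x. f x y))"
proof -
  define T where "T = {p::real\<times>real. a \<le> fst p \<and> fst p \<le> snd p \<and> snd p \<le> b}"
  have T: "compact T"
  proof -
    have "T = ({a..b} \<times> {a..b}) \<inter> {p. fst p \<le> snd p}" by (auto simp: T_def)
    moreover have "closed {p::real\<times>real. fst p \<le> snd p}" by (intro closed_Collect_le continuous_intros)
    ultimately show ?thesis by (auto intro: compact_Int_closed compact_Times)
  qed
  define g where "g = (\<lambda>x y. indicator T (x, y) *\<^sub>R f x y)"
  have "integrable lborel (\<lambda>p. indicator T p *\<^sub>R f (fst p) (snd p))"
    using T cont by (intro borel_integrable_compact) (simp_all add: T_def)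
  then have I: "integrable (lborel \<Otimes>\<^sub>M lborel) (case_prod g)"
    by (simp add: g_def case_prod_unfold lborel_prod)
  have slice: "(LINT z|lborel. indicator {c..d} z *\<^sub>R h z) = integral {c..d} h"
    if "continuous_on {c..d} h" for c d and h :: "real \<Rightarrow> real"
  proof -
    have "integrable lborel (\<lambda>z. indicator {c..d} z *\<^sub>R h z)"
      using that by (intro borel_integrable_compact) auto
    then show ?thesis
      using set_borel_integral_eq_integral(2)[of "{c..d}" h]
      by (simp add: set_integrable_def set_lebesgue_integral_def)
  qed
  have c1: "continuous_on {x..b} (\<lambda>y. f x y)" if "a \<le> x" for x
    using that by (intro continuous_on_compose_pair[OF cont] continuous_intros) auto
  have c2: "continuous_on {a..y} (\<lambda>x. f x y)" if "y \<le> b" for y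
    using that by (intro continuous_on_compose_pair[OF cont] continuous_intros) auto
  have gx: "(LINT y|lborel. g x y) = indicator {a..b} x *\<^sub>R integral {x..b} (f x)" for x
  proof (cases "x \<in> {a..b}")
    case True
    have "g x = (\<lambda>y. indicator {x..b} y *\<^sub>R f x y)" using True by (auto simp: g_def T_def indicator_def)
    then show ?thesis using True slice[OF c1, of x] by simp
  next
    case False
    then have "g x = (\<lambda>y. 0)" by (auto simp: g_def T_def indicator_def)
    then show ?thesis using False by simp
  qed
  have gy: "(LINT x|lborel. g x y) = indicator {a..b} y *\<^sub>R integral {a..y} (\<lambda>x. f x y)" for y
  proof (cases "y \<in> {a..b}")
    case True
    have "(\<lambda>x. g x y) = (\<lambda>x. indicator {a..y} x *\<^sub>R f x y)" using True by (auto simp: g_def T_def indicator_def)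
    then show ?thesis using True slice[OF c2, of y] by simp
  next
    case False
    then have "(\<lambda>x. g x y) = (\<lambda>x. 0)" by (auto simp: g_def T_def indicator_def)
    then show ?thesis using False by simp
  qed
  have ix: "set_integrable lborel {a..b} (\<lambda>x. integral {x..b} (f x))"
    using lborel_pair.integrable_fst[OF I] unfolding set_integrable_def by (simp add: gx)
  have iy: "set_integrable lborel {a..b} (\<lambda>y. integral {a..y} (\<lambda>x. f x y))"
    using lborel_pair.integrable_snd[OF I] unfolding set_integrable_def by (simp add: gy)
  have "integral {a..b} (\<lambda>x. integral {x..b} (f x)) = (LINT x|lborel. LINT y|lborel. g x y)"
    using set_borel_integral_eq_integral(2)[OF ix] by (simp add: gx set_lebesgue_integral_def)
  also have "\<dots> = (LINT y|lborel. LINT x|lborel. g x y)"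
    using lborel_pair.Fubini_integral[OF I] by simp
  also have "\<dots> = integral {a..b} (\<lambda>y. integral {a..y} (\<lambda>x. f x y))"
    using set_borel_integral_eq_integral(2)[OF iy] by (simp add: gy set_lebesgue_integral_def)
  finally show ?thesis .
qed

text \<open>Only one power falls on the first argument; this makes the later growth inequality for
  |u|^2 linear. The 4 |beta| is 2 |beta| from the coefficient times 2 |a| |b| for the
  bracket.\<close>

lemma norm_N1_le: "cmod (N1 \<alpha> \<beta> a b) \<le> (\<bar>\<alpha>\<bar> + 4 * \<bar>\<beta>\<bar>) * (cmod a * (cmod b)\<^sup>2)"
proof -
  have "cmod (N1 \<alpha> \<beta> a b) \<le> cmod (complex_of_real \<alpha> * a * complex_of_real ((cmod b)\<^sup>2))
     + cmod (2 * complex_of_real \<beta> * b * (cnj a * b + a * cnj b))"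
    unfolding N1_def by (rule norm_triangle_ineq)
  also have "cmod (2 * complex_of_real \<beta> * b * (cnj a * b + a * cnj b)) \<le> 2 * \<bar>\<beta>\<bar> * cmod b * (2 * (cmod a * cmod b))"
  proof -
    have "cmod (cnj a * b + a * cnj b) \<le> 2 * (cmod a * cmod b)"
      using norm_triangle_ineq[of "cnj a * b" "a * cnj b"] by (simp add: norm_mult)
    moreover have "cmod (2 * complex_of_real \<beta> * b * S) = 2 * \<bar>\<beta>\<bar> * cmod b * cmod S" for S
      by (simp add: norm_mult)
    ultimately show ?thesis
      by (simp only:) (intro mult_left_mono, simp_all)
  qed
  also have "cmod (complex_of_real \<alpha> * a * complex_of_real ((cmod b)\<^sup>2)) = \<bar>\<alpha>\<bar> * cmod a * (cmod b)\<^sup>2"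
    by (simp add: norm_mult norm_power)
  finally show ?thesis by (simp add: algebra_simps power2_eq_square)
qed

text \<open>This reflects the symmetry of the potential W in its two arguments, on which the
  reflection argument rests.\<close>

lemma N2_eq_N1: "N2 \<alpha> \<beta> a b = N1 \<alpha> \<beta> b a"
  by (simp add: N1_def N2_def algebra_simps)

text \<open>The infinitesimal form of the invariance of W under a common phase rotation of u and v:
  what one component gains in charge the other loses.\<close>

lemma charge_exchange: "Im (cnj b * N2 \<alpha> \<beta> a b) = - Im (cnj a * N1 \<alpha> \<beta> a b)"
  by (simp add: N1_def N2_def cmod_power2 algebra_simps power2_eq_square)

lemma continuous_on_N1:
  assumes "continuous_on S f" "continuous_on S g"
  shows "continuous_on S (\<lambda>x. N1 \<alpha> \<beta> (f x) (g x))"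
  unfolding N1_def by (intro continuous_intros assms)

lemma cmod_sq_has_derivative:
  assumes "(w has_vector_derivative w') (at t within S)"
  shows "((\<lambda>t. (cmod (w t))\<^sup>2) has_real_derivative 2 * Re (cnj (w t) * w')) (at t within S)"
proof -
  have "((\<lambda>t. Re (w t)) has_real_derivative Re w') (at t within S)"
    "((\<lambda>t. Im (w t)) has_real_derivative Im w') (at t within S)"
    unfolding has_real_derivative_iff_has_vector_derivative
    by (intro bounded_linear.has_vector_derivative[OF bounded_linear_Re]
        bounded_linear.has_vector_derivative[OF bounded_linear_Im] assms)+
  from DERIV_add[OF DERIV_power[OF this(1), of 2] DERIV_power[OF this(2), of 2]]
  show ?thesis unfolding cmod_power2 by (simp add: mult.commute algebra_simps)
qed

lemma L2_integral_interval_le: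
  assumes "L2 f" "continuous_on {a..b} f"
  shows "integral {a..b} (\<lambda>x. (cmod (f x))\<^sup>2) \<le> (LINT x|lborel. (cmod (f x))\<^sup>2)"
proof -
  have I: "set_integrable lborel {a..b} (\<lambda>x. (cmod (f x))\<^sup>2)"
    unfolding set_integrable_def using assms by (intro borel_integrable_compact continuous_intros) auto
  have "integral {a..b} (\<lambda>x. (cmod (f x))\<^sup>2) = (LINT x:{a..b}|lborel. (cmod (f x))\<^sup>2)"
    using set_borel_integral_eq_integral(2)[OF I] by simp
  also have "\<dots> \<le> (LINT x|lborel. (cmod (f x))\<^sup>2)"
    unfolding set_lebesgue_integral_def using assms I
    by (intro integral_mono) (auto simp: L2_def set_integrable_def indicator_def)
  finally show ?thesis .
qed

text \<open>This is what the remaining argument retains of the Sobolev setting. The assumptions are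
  stable under reflection combined with exchange of the components, so facts proved for u can be
  interpreted for v.\<close>

locale mild_solution =
  fixes \<alpha> \<beta> :: real and u0 v0 :: "real \<Rightarrow> complex" and u v :: "real \<Rightarrow> real \<Rightarrow> complex"
  assumes cont_u: "continuous_on (UNIV \<times> {0..}) (\<lambda>p. u (fst p) (snd p))"
    and cont_v: "continuous_on (UNIV \<times> {0..}) (\<lambda>p. v (fst p) (snd p))"
    and mild_u: "\<And>y t. t \<ge> 0 \<Longrightarrow>
      u (y + t) t = u0 y - \<i> * integral {0..t} (\<lambda>\<tau>. N1 \<alpha> \<beta> (u (y + \<tau>) \<tau>) (v (y + \<tau>) \<tau>))"
    and mild_v: "\<And>y t. t \<ge> 0 \<Longrightarrow>
      v (y - t) t = v0 y - \<i> * integral {0..t} (\<lambda>\<tau>. N2 \<alpha> \<beta> (u (y - \<tau>) \<tau>) (v (y - \<tau>) \<tau>))"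
    and L2_u0: "L2 u0" and L2_v0: "L2 v0"
    and u0_lim: "(u0 \<longlongrightarrow> 0) at_infinity" and v0_lim: "(v0 \<longlongrightarrow> 0) at_infinity"
begin

lemma reflected: "mild_solution \<alpha> \<beta> (\<lambda>x. v0 (- x)) (\<lambda>x. u0 (- x)) (\<lambda>x t. v (- x) t) (\<lambda>x t. u (- x) t)"
proof
  show "continuous_on (UNIV \<times> {0..}) (\<lambda>p. v (- fst p) (snd p))"
    by (intro continuous_on_compose_pair[OF cont_v] continuous_intros) auto
  show "continuous_on (UNIV \<times> {0..}) (\<lambda>p. u (- fst p) (snd p))"
    by (intro continuous_on_compose_pair[OF cont_u] continuous_intros) auto
  have L2r: "L2 (\<lambda>x. f (- x))" if "L2 f" for f
  proof -
    have [measurable]: "f \<in> borel_measurable borel" using that by (simp add: L2_def)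
    show ?thesis
      using that lborel_integrable_real_affine[of "\<lambda>x. (cmod (f x))\<^sup>2" "-1" 0] by (auto simp: L2_def)
  qed
  show "L2 (\<lambda>x. v0 (- x))" "L2 (\<lambda>x. u0 (- x))" using L2_u0 L2_v0 by (auto intro: L2r)
  have "((\<lambda>x. f (- x)) \<longlongrightarrow> 0) at_infinity" if "(f \<longlongrightarrow> 0) at_infinity" for f :: "real \<Rightarrow> complex"
    using that unfolding tendsto_iff eventually_at_infinity by (metis norm_minus_cancel)
  then show "((\<lambda>x. v0 (- x)) \<longlongrightarrow> 0) at_infinity" "((\<lambda>x. u0 (- x)) \<longlongrightarrow> 0) at_infinity"
    using u0_lim v0_lim by auto
next
  fix y t :: real assume "t \<ge> 0"
  from mild_v[OF this, of "- y"]
  show "v (- (y + t)) t = v0 (- y) - \<i> * integral {0..t} (\<lambda>\<tau>. N1 \<alpha> \<beta> (v (- (y + \<tau>)) \<tau>) (u (- (y + \<tau>)) \<tau>))"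
    by (simp add: N2_eq_N1)
next
  fix y t :: real assume "t \<ge> 0"
  from mild_u[OF this, of "- y"]
  show "u (- (y - t)) t = u0 (- y) - \<i> * integral {0..t} (\<lambda>\<tau>. N2 \<alpha> \<beta> (v (- (y - \<tau>)) \<tau>) (u (- (y - \<tau>)) \<tau>))"
    by (simp add: N2_eq_N1)
qed

lemma u_0: "u y 0 = u0 y" and v_0: "v y 0 = v0 y"
  using mild_u[of 0 y] mild_v[of 0 y] by simp_all

lemma continuous_on_u:
  "continuous_on S f \<Longrightarrow> continuous_on S g \<Longrightarrow> (\<And>x. x \<in> S \<Longrightarrow> 0 \<le> g x) \<Longrightarrow> continuous_on S (\<lambda>x. u (f x) (g x))"
  by (rule continuous_on_compose_pair[OF cont_u]) auto

lemma continuous_on_v: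
  "continuous_on S f \<Longrightarrow> continuous_on S g \<Longrightarrow> (\<And>x. x \<in> S \<Longrightarrow> 0 \<le> g x) \<Longrightarrow> continuous_on S (\<lambda>x. v (f x) (g x))"
  by (rule continuous_on_compose_pair[OF cont_v]) auto

lemma continuous_on_u0: "continuous_on S u0"
  using continuous_on_u[of S "\<lambda>x. x" "\<lambda>x. 0"] by (simp add: u_0)

lemma continuous_on_v0: "continuous_on S v0"
  using continuous_on_v[of S "\<lambda>x. x" "\<lambda>x. 0"] by (simp add: v_0)

text \<open>\<open>q\<close> is the rate at which charge passes from $v$ to $u$:
  $(\partial_t + \partial_x)|u|^2 = q = -(\partial_t - \partial_x)|v|^2$.\<close>

definition q :: "real \<Rightarrow> real \<Rightarrow> real" where
  "q x t = 2 * Im (cnj (u x t) * N1 \<alpha> \<beta> (u x t) (v x t))"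

lemma continuous_on_q:
  "continuous_on S f \<Longrightarrow> continuous_on S g \<Longrightarrow> (\<And>x. x \<in> S \<Longrightarrow> 0 \<le> g x) \<Longrightarrow> continuous_on S (\<lambda>x. q (f x) (g x))"
  unfolding q_def by (intro continuous_intros continuous_on_N1 continuous_on_u continuous_on_v)

text \<open>The integrated equation makes u differentiable along its characteristic with derivative
  -i N_1, and 2 Re (cnj u (-i N_1)) = 2 Im (cnj u N_1).\<close>

lemma u_charge_derivative:
  assumes "t \<in> {0..T}"
  shows "((\<lambda>t. (cmod (u (y + t) t))\<^sup>2) has_real_derivative q (y + t) t) (at t within {0..T})"
proof -
  have c: "continuous_on {0..T} (\<lambda>\<tau>. N1 \<alpha> \<beta> (u (y + \<tau>) \<tau>) (v (y + \<tau>) \<tau>))"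
    by (intro continuous_on_N1 continuous_on_u continuous_on_v continuous_intros) auto
  have "((\<lambda>t. u0 y - \<i> * integral {0..t} (\<lambda>\<tau>. N1 \<alpha> \<beta> (u (y + \<tau>) \<tau>) (v (y + \<tau>) \<tau>))) has_vector_derivative
     (0 - \<i> * N1 \<alpha> \<beta> (u (y + t) t) (v (y + t) t))) (at t within {0..T})"
    by (intro has_vector_derivative_diff has_vector_derivative_const has_vector_derivative_mult_right
        integral_has_vector_derivative[OF c] assms)
  then have "((\<lambda>t. u (y + t) t) has_vector_derivative (0 - \<i> * N1 \<alpha> \<beta> (u (y + t) t) (v (y + t) t))) (at t within {0..T})"
    by (rule has_vector_derivative_transform[OF assms, rotated]) (simp add: mild_u)
  from cmod_sq_has_derivative[OF this] show ?thesis by (simp add: q_def algebra_simps)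
qed

lemma v_charge_derivative:
  assumes "t \<in> {0..T}"
  shows "((\<lambda>t. (cmod (v (y - t) t))\<^sup>2) has_real_derivative - q (y - t) t) (at t within {0..T})"
proof -
  have c: "continuous_on {0..T} (\<lambda>\<tau>. N2 \<alpha> \<beta> (u (y - \<tau>) \<tau>) (v (y - \<tau>) \<tau>))"
    unfolding N2_eq_N1 by (intro continuous_on_N1 continuous_on_u continuous_on_v continuous_intros) auto
  have "((\<lambda>t. v0 y - \<i> * integral {0..t} (\<lambda>\<tau>. N2 \<alpha> \<beta> (u (y - \<tau>) \<tau>) (v (y - \<tau>) \<tau>))) has_vector_derivative
     (0 - \<i> * N2 \<alpha> \<beta> (u (y - t) t) (v (y - t) t))) (at t within {0..T})"
    by (intro has_vector_derivative_diff has_vector_derivative_const has_vector_derivative_mult_right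
        integral_has_vector_derivative[OF c] assms)
  then have "((\<lambda>t. v (y - t) t) has_vector_derivative (0 - \<i> * N2 \<alpha> \<beta> (u (y - t) t) (v (y - t) t))) (at t within {0..T})"
    by (rule has_vector_derivative_transform[OF assms, rotated]) (simp add: mild_v)
  from cmod_sq_has_derivative[OF this]
  have "((\<lambda>t. (cmod (v (y - t) t))\<^sup>2) has_real_derivative
     2 * Im (cnj (v (y - t) t) * N2 \<alpha> \<beta> (u (y - t) t) (v (y - t) t))) (at t within {0..T})"
    by (simp add: algebra_simps)
  then show ?thesis unfolding charge_exchange q_def by simp
qed

text \<open>Integrate \<open>q\<close> over the triangle $a \le \xi \le \eta \le b$ in the characteristic coordinates
  $\xi = x - t$, $\eta = x + t$, once along each family of characteristics.\<close>

lemma charge_balance: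
  assumes ab: "a \<le> b"
  shows "integral {a..b} (\<lambda>\<xi>. (cmod (u ((\<xi> + b) / 2) ((b - \<xi>) / 2)))\<^sup>2)
       + integral {a..b} (\<lambda>\<eta>. (cmod (v ((a + \<eta>) / 2) ((\<eta> - a) / 2)))\<^sup>2)
       = integral {a..b} (\<lambda>x. (cmod (u0 x))\<^sup>2) + integral {a..b} (\<lambda>x. (cmod (v0 x))\<^sup>2)"
proof -
  define f where "f = (\<lambda>\<xi> \<eta>. q ((\<xi> + \<eta>) / 2) ((\<eta> - \<xi>) / 2))"
  have cont: "continuous_on {p. a \<le> fst p \<and> fst p \<le> snd p \<and> snd p \<le> b} (\<lambda>p. f (fst p) (snd p))"
    unfolding f_def by (intro continuous_on_q continuous_intros) auto
  \<comment> \<open>Since t = (eta - xi) / 2, unit speed in eta is half speed along the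
    characteristic. The factors 2 here and in the next step come from that.\<close>
  have inner_u: "integral {\<xi>..b} (\<lambda>\<eta>. f \<xi> \<eta>) = 2 * (cmod (u ((\<xi> + b) / 2) ((b - \<xi>) / 2)))\<^sup>2 - 2 * (cmod (u0 \<xi>))\<^sup>2"
    if \<xi>: "\<xi> \<in> {a..b}" for \<xi>
  proof -
    let ?F = "\<lambda>\<eta>. 2 * (cmod (u (\<xi> + (\<eta> - \<xi>) / 2) ((\<eta> - \<xi>) / 2)))\<^sup>2"
    have "((\<lambda>\<eta>. f \<xi> \<eta>) has_integral ?F b - ?F \<xi>) {\<xi>..b}"
    proof (rule fundamental_theorem_of_calculus)
      fix \<eta> assume \<eta>: "\<eta> \<in> {\<xi>..b}"
      have 1: "((\<lambda>\<eta>. (\<eta> - \<xi>) / 2) has_real_derivative 1 / 2) (at \<eta> within {\<xi>..b})"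
        by (auto intro!: derivative_eq_intros)
      have "(\<eta> - \<xi>) / 2 \<in> {0..(b - \<xi>) / 2}" using \<eta> by auto
      from u_charge_derivative[OF this, of \<xi>]
      have 2: "((\<lambda>t. (cmod (u (\<xi> + t) t))\<^sup>2) has_real_derivative q (\<xi> + (\<eta> - \<xi>) / 2) ((\<eta> - \<xi>) / 2))
         (at ((\<eta> - \<xi>) / 2) within (\<lambda>\<eta>. (\<eta> - \<xi>) / 2) ` {\<xi>..b})"
        by (rule DERIV_subset) auto
      from DERIV_cmult[OF DERIV_image_chain[OF 2 1], of 2]
      have "(?F has_real_derivative q (\<xi> + (\<eta> - \<xi>) / 2) ((\<eta> - \<xi>) / 2)) (at \<eta> within {\<xi>..b})"
        by (simp add: comp_def)
      moreover have "\<xi> + (\<eta> - \<xi>) / 2 = (\<xi> + \<eta>) / 2" by (simp add: field_simps)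
      ultimately show "(?F has_vector_derivative f \<xi> \<eta>) (at \<eta> within {\<xi>..b})"
        by (simp add: f_def has_real_derivative_iff_has_vector_derivative)
    qed (use \<xi> in auto)
    moreover have "\<xi> + (b - \<xi>) / 2 = (\<xi> + b) / 2" by (simp add: field_simps)
    ultimately show ?thesis by (simp add: integral_unique u_0)
  qed
  have inner_v: "integral {a..\<eta>} (\<lambda>\<xi>. f \<xi> \<eta>) = 2 * (cmod (v0 \<eta>))\<^sup>2 - 2 * (cmod (v ((a + \<eta>) / 2) ((\<eta> - a) / 2)))\<^sup>2"
    if \<eta>: "\<eta> \<in> {a..b}" for \<eta>
  proof -
    let ?F = "\<lambda>\<xi>. 2 * (cmod (v (\<eta> - (\<eta> - \<xi>) / 2) ((\<eta> - \<xi>) / 2)))\<^sup>2"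
    have "((\<lambda>\<xi>. f \<xi> \<eta>) has_integral ?F \<eta> - ?F a) {a..\<eta>}"
    proof (rule fundamental_theorem_of_calculus)
      fix \<xi> assume \<xi>: "\<xi> \<in> {a..\<eta>}"
      have 1: "((\<lambda>\<xi>. (\<eta> - \<xi>) / 2) has_real_derivative - (1 / 2)) (at \<xi> within {a..\<eta>})"
        by (auto intro!: derivative_eq_intros)
      have "(\<eta> - \<xi>) / 2 \<in> {0..(\<eta> - a) / 2}" using \<xi> by auto
      from v_charge_derivative[OF this, of \<eta>]
      have 2: "((\<lambda>t. (cmod (v (\<eta> - t) t))\<^sup>2) has_real_derivative - q (\<eta> - (\<eta> - \<xi>) / 2) ((\<eta> - \<xi>) / 2))
         (at ((\<eta> - \<xi>) / 2) within (\<lambda>\<xi>. (\<eta> - \<xi>) / 2) ` {a..\<eta>})"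
        by (rule DERIV_subset) auto
      from DERIV_cmult[OF DERIV_image_chain[OF 2 1], of 2]
      have "(?F has_real_derivative q (\<eta> - (\<eta> - \<xi>) / 2) ((\<eta> - \<xi>) / 2)) (at \<xi> within {a..\<eta>})"
        by (simp add: comp_def)
      moreover have "\<eta> - (\<eta> - \<xi>) / 2 = (\<xi> + \<eta>) / 2" by (simp add: field_simps)
      ultimately show "(?F has_vector_derivative f \<xi> \<eta>) (at \<xi> within {a..\<eta>})"
        by (simp add: f_def has_real_derivative_iff_has_vector_derivative)
    qed (use \<eta> in auto)
    moreover have "\<eta> - (\<eta> - a) / 2 = (a + \<eta>) / 2" by (simp add: field_simps)
    ultimately show ?thesis by (simp add: integral_unique v_0)
  qed
  have I: "(\<lambda>\<xi>. (cmod (u ((\<xi> + b) / 2) ((b - \<xi>) / 2)))\<^sup>2) integrable_on {a..b}"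
    "(\<lambda>\<eta>. (cmod (v ((a + \<eta>) / 2) ((\<eta> - a) / 2)))\<^sup>2) integrable_on {a..b}"
    "(\<lambda>x. (cmod (u0 x))\<^sup>2) integrable_on {a..b}" "(\<lambda>x. (cmod (v0 x))\<^sup>2) integrable_on {a..b}"
    by (intro integrable_continuous_interval continuous_intros continuous_on_u continuous_on_v continuous_on_u0 continuous_on_v0; simp)+
  have "2 * integral {a..b} (\<lambda>\<xi>. (cmod (u ((\<xi> + b) / 2) ((b - \<xi>) / 2)))\<^sup>2) - 2 * integral {a..b} (\<lambda>x. (cmod (u0 x))\<^sup>2)
     = integral {a..b} (\<lambda>\<xi>. 2 * (cmod (u ((\<xi> + b) / 2) ((b - \<xi>) / 2)))\<^sup>2 - 2 * (cmod (u0 \<xi>))\<^sup>2)"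
    by (subst Henstock_Kurzweil_Integration.integral_diff) (auto intro!: integrable_on_mult_right I)
  also have "\<dots> = integral {a..b} (\<lambda>\<xi>. integral {\<xi>..b} (\<lambda>\<eta>. f \<xi> \<eta>))"
    by (intro integral_cong) (simp only: inner_u)
  also have "\<dots> = integral {a..b} (\<lambda>\<eta>. integral {a..\<eta>} (\<lambda>\<xi>. f \<xi> \<eta>))"
    by (rule triangle_swap[OF cont])
  also have "\<dots> = integral {a..b} (\<lambda>\<eta>. 2 * (cmod (v0 \<eta>))\<^sup>2 - 2 * (cmod (v ((a + \<eta>) / 2) ((\<eta> - a) / 2)))\<^sup>2)"
    by (intro integral_cong) (simp only: inner_v)
  also have "\<dots> = 2 * integral {a..b} (\<lambda>x. (cmod (v0 x))\<^sup>2) - 2 * integral {a..b} (\<lambda>\<eta>. (cmod (v ((a + \<eta>) / 2) ((\<eta> - a) / 2)))\<^sup>2)"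
    by (subst Henstock_Kurzweil_Integration.integral_diff) (auto intro!: integrable_on_mult_right I)
  finally show ?thesis by simp
qed

section \<open>Bounds along a single characteristic\<close>

definition Q :: real where
  "Q = (LINT x|lborel. (cmod (u0 x))\<^sup>2) + (LINT x|lborel. (cmod (v0 x))\<^sup>2)"

text \<open>The u-characteristic from y up to time T is one side of the triangle over the interval
  from y to y + 2T, whose apex is at time T. In the charge balance the nonnegative integral over the
  other side is dropped; eta = y + 2 tau gives the factor 2.\<close>

lemma v_charge_along_u_characteristic:
  assumes "T \<ge> 0"
  shows "2 * integral {0..T} (\<lambda>\<tau>. (cmod (v (y + \<tau>) \<tau>))\<^sup>2) \<le> Q"
proof -
  define b where "b = y + 2 * T"
  have yb: "y \<le> b" using assms by (simp add: b_def)
  let ?m = "\<lambda>\<tau>. (cmod (v (y + \<tau>) \<tau>))\<^sup>2"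
  have cm: "continuous_on {0..T} ?m"
    by (intro continuous_intros continuous_on_v) auto
  let ?F = "\<lambda>\<eta>. 2 * integral {0..(\<eta> - y) / 2} ?m"
  have "((\<lambda>\<eta>. (cmod (v ((y + \<eta>) / 2) ((\<eta> - y) / 2)))\<^sup>2) has_integral ?F b - ?F y) {y..b}"
  proof (rule fundamental_theorem_of_calculus[OF yb])
    fix \<eta> assume \<eta>: "\<eta> \<in> {y..b}"
    have 1: "((\<lambda>\<eta>. (\<eta> - y) / 2) has_real_derivative 1 / 2) (at \<eta> within {y..b})"
      by (auto intro!: derivative_eq_intros)
    have "(\<eta> - y) / 2 \<in> {0..T}" using \<eta> by (auto simp: b_def)
    from integral_has_real_derivative[OF cm this]
    have 2: "((\<lambda>t. integral {0..t} ?m) has_real_derivative ?m ((\<eta> - y) / 2)) (at ((\<eta> - y) / 2) within (\<lambda>\<eta>. (\<eta> - y) / 2) ` {y..b})"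
      by (rule DERIV_subset) (auto simp: b_def)
    from DERIV_cmult[OF DERIV_image_chain[OF 2 1], of 2]
    have "(?F has_real_derivative ?m ((\<eta> - y) / 2)) (at \<eta> within {y..b})"
      by (simp add: comp_def)
    moreover have "y + (\<eta> - y) / 2 = (y + \<eta>) / 2" by (simp add: field_simps)
    ultimately show "(?F has_vector_derivative (cmod (v ((y + \<eta>) / 2) ((\<eta> - y) / 2)))\<^sup>2) (at \<eta> within {y..b})"
      by (simp add: has_real_derivative_iff_has_vector_derivative)
  qed
  then have "2 * integral {0..T} ?m = integral {y..b} (\<lambda>\<eta>. (cmod (v ((y + \<eta>) / 2) ((\<eta> - y) / 2)))\<^sup>2)"
    by (simp add: integral_unique b_def)
  also have "\<dots> \<le> integral {y..b} (\<lambda>\<xi>. (cmod (u ((\<xi> + b) / 2) ((b - \<xi>) / 2)))\<^sup>2)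
       + integral {y..b} (\<lambda>\<eta>. (cmod (v ((y + \<eta>) / 2) ((\<eta> - y) / 2)))\<^sup>2)"
  proof -
    have "0 \<le> integral {y..b} (\<lambda>\<xi>. (cmod (u ((\<xi> + b) / 2) ((b - \<xi>) / 2)))\<^sup>2)"
      by (intro Henstock_Kurzweil_Integration.integral_nonneg integrable_continuous_interval continuous_intros continuous_on_u) auto
    then show ?thesis by simp
  qed
  also have "\<dots> \<le> Q"
    unfolding charge_balance[OF yb] Q_def
    by (intro add_mono L2_integral_interval_le L2_u0 L2_v0 continuous_on_u0 continuous_on_v0)
  finally show ?thesis .
qed

text \<open>Working with |u|^2 keeps the quantity differentiable at zeros of u, and the bound stays
  proportional to the initial value even where that is 0.\<close>

lemma u_pointwise_bound:
  assumes t: "t \<ge> 0"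
  shows "(cmod (u (y + t) t))\<^sup>2 \<le> exp ((\<bar>\<alpha>\<bar> + 4 * \<bar>\<beta>\<bar>) * Q) * (cmod (u0 y))\<^sup>2"
proof -
  define K where "K = \<bar>\<alpha>\<bar> + 4 * \<bar>\<beta>\<bar>"
  have K: "K \<ge> 0" by (simp add: K_def)
  let ?m = "\<lambda>\<tau>. (cmod (v (y + \<tau>) \<tau>))\<^sup>2"
  have cm: "continuous_on {0..t} ?m"
    by (intro continuous_intros continuous_on_v) auto
  define M where "M = (\<lambda>t. integral {0..t} ?m)"
  \<comment> \<open>The integrating factor for the inequality d/ds |u|^2 <= 2 K |v|^2 |u|^2; M
    collects the charge of v met so far.\<close>
  define h where "h = (\<lambda>s. (cmod (u (y + s) s))\<^sup>2 * exp (- (2 * K * M s)))"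
  have q_le: "q (y + s) s \<le> 2 * K * ?m s * (cmod (u (y + s) s))\<^sup>2" for s
  proof -
    let ?a = "u (y + s) s" and ?b = "v (y + s) s"
    have "Im (cnj ?a * N1 \<alpha> \<beta> ?a ?b) \<le> cmod (cnj ?a * N1 \<alpha> \<beta> ?a ?b)"
      using abs_Im_le_cmod by (rule order_trans[OF abs_ge_self])
    also have "\<dots> \<le> cmod ?a * (K * (cmod ?a * (cmod ?b)\<^sup>2))"
      unfolding K_def by (simp only: norm_mult complex_mod_cnj) (intro mult_left_mono norm_N1_le norm_ge_zero)
    finally show ?thesis by (simp add: q_def power2_eq_square mult_ac)
  qed
  have dh: "(h has_real_derivative (q (y + s) s - 2 * K * ?m s * (cmod (u (y + s) s))\<^sup>2) * exp (- (2 * K * M s))) (at s within {0..t})"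
    if s: "s \<in> {0..t}" for s
  proof -
    have "(M has_real_derivative ?m s) (at s within {0..t})"
      unfolding M_def by (rule integral_has_real_derivative[OF cm s])
    then have "((\<lambda>s. exp (- (2 * K * M s))) has_real_derivative exp (- (2 * K * M s)) * (- (2 * K * ?m s))) (at s within {0..t})"
      by (auto intro!: derivative_eq_intros)
    from DERIV_mult[OF u_charge_derivative[OF s, of y] this] show ?thesis
      unfolding h_def by (simp add: algebra_simps)
  qed
  have "h t \<le> h 0"
  proof (rule DERIV_nonpos_imp_decreasing_open[OF t])
    show "continuous_on {0..t} h"
      using dh by (intro continuous_on_eq_continuous_within[THEN iffD2] ballI DERIV_continuous) blast
    fix s assume s: "0 < s" "s < t"
    then have "at s within {0..t} = at s" by (intro at_within_interior) simp
    with dh[of s] s have "(h has_real_derivative (q (y + s) s - 2 * K * ?m s * (cmod (u (y + s) s))\<^sup>2) * exp (- (2 * K * M s))) (at s)"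
      by simp
    moreover have "(q (y + s) s - 2 * K * ?m s * (cmod (u (y + s) s))\<^sup>2) * exp (- (2 * K * M s)) \<le> 0"
      using q_le[of s] by (intro mult_nonpos_nonneg) auto
    ultimately show "\<exists>y. (h has_real_derivative y) (at s) \<and> y \<le> 0" by blast
  qed
  then have "(cmod (u (y + t) t))\<^sup>2 * exp (- (2 * K * M t)) \<le> (cmod (u0 y))\<^sup>2"
    by (simp add: h_def M_def u_0)
  then have "(cmod (u (y + t) t))\<^sup>2 \<le> exp (2 * K * M t) * (cmod (u0 y))\<^sup>2"
    by (simp add: exp_minus field_simps)
  also have "\<dots> \<le> exp (K * Q) * (cmod (u0 y))\<^sup>2"
  proof (intro mult_right_mono)
    have "K * (2 * M t) \<le> K * Q"
      unfolding M_def by (intro mult_left_mono v_charge_along_u_characteristic t K)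
    then show "exp (2 * K * M t) \<le> exp (K * Q)" by (simp add: mult_ac)
  qed simp
  finally show ?thesis by (simp add: K_def)
qed

lemma v_pointwise_bound:
  assumes t: "t \<ge> 0"
  shows "(cmod (v (y - t) t))\<^sup>2 \<le> exp ((\<bar>\<alpha>\<bar> + 4 * \<bar>\<beta>\<bar>) * Q) * (cmod (v0 y))\<^sup>2"
proof -
  interpret r: mild_solution \<alpha> \<beta> "\<lambda>x. v0 (- x)" "\<lambda>x. u0 (- x)" "\<lambda>x t. v (- x) t" "\<lambda>x t. u (- x) t"
    by (rule reflected)
  have "(LINT x|lborel. (cmod (f (- x)))\<^sup>2) = (LINT x|lborel. (cmod (f x))\<^sup>2)" for f :: "real \<Rightarrow> complex"
    using lborel_integral_real_affine[of "-1" "\<lambda>x. (cmod (f x))\<^sup>2" 0] by simp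
  then have "r.Q = Q" by (simp add: r.Q_def Q_def)
  with r.u_pointwise_bound[OF t, of "- y"] show ?thesis by simp
qed

subsection \<open>Scattering\<close>

text \<open>The profile error in the moving frame x = y + t, where all estimates are pointwise in y;
  the translation is undone in \<open>u_scattering\<close>.\<close>

definition remainder :: "real \<Rightarrow> real \<Rightarrow> complex" where
  "remainder y t = u (y + t) t - u0 y - G1 \<alpha> \<beta> u v y"

definition tail :: "real \<Rightarrow> real" where
  "tail R = (LINT z|lborel. indicator {z. R \<le> z} z *\<^sub>R (cmod (v0 z))\<^sup>2)"

text \<open>The first factor comes from \<open>norm_N1_le\<close>. Of the two exponentials one
  bounds |u| and the other |v|^2.\<close>

definition D :: real where
  "D = (\<bar>\<alpha>\<bar> + 4 * \<bar>\<beta>\<bar>) * (exp ((\<bar>\<alpha>\<bar> + 4 * \<bar>\<beta>\<bar>) * Q))\<^sup>2"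

lemma D_nonneg: "D \<ge> 0" by (simp add: D_def)

lemma Q_nonneg: "Q \<ge> 0"
  unfolding Q_def by (intro add_nonneg_nonneg integral_nonneg_AE) auto

lemma norm_N1_characteristic_le:
  assumes "\<tau> \<ge> 0"
  shows "cmod (N1 \<alpha> \<beta> (u (y + \<tau>) \<tau>) (v (y + \<tau>) \<tau>)) \<le> D * cmod (u0 y) * (cmod (v0 (y + 2 * \<tau>)))\<^sup>2"
proof -
  define E where "E = exp ((\<bar>\<alpha>\<bar> + 4 * \<bar>\<beta>\<bar>) * Q)"
  have E: "E \<ge> 1" unfolding E_def using Q_nonneg by simp
  have "(cmod (u (y + \<tau>) \<tau>))\<^sup>2 \<le> E * (cmod (u0 y))\<^sup>2"
    unfolding E_def by (rule u_pointwise_bound[OF assms])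
  \<comment> \<open>Since E >= 1, replacing E by its square is harmless and avoids the square root
    of E.\<close>
  also have "\<dots> \<le> E\<^sup>2 * (cmod (u0 y))\<^sup>2"
    using E by (intro mult_right_mono) (auto simp: power2_eq_square)
  finally have "(cmod (u (y + \<tau>) \<tau>))\<^sup>2 \<le> (E * cmod (u0 y))\<^sup>2"
    by (simp add: power_mult_distrib)
  then have U: "cmod (u (y + \<tau>) \<tau>) \<le> E * cmod (u0 y)"
    by (rule power2_le_imp_le) (use E in simp)
  \<comment> \<open>The point (y + tau, tau) lies on the v-characteristic that starts from y + 2
    tau.\<close>
  have V: "(cmod (v (y + \<tau>) \<tau>))\<^sup>2 \<le> E * (cmod (v0 (y + 2 * \<tau>)))\<^sup>2"
    using v_pointwise_bound[OF assms, of "y + 2 * \<tau>"] by (simp add: E_def add.commute)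
  have "cmod (N1 \<alpha> \<beta> (u (y + \<tau>) \<tau>) (v (y + \<tau>) \<tau>)) \<le>
      (\<bar>\<alpha>\<bar> + 4 * \<bar>\<beta>\<bar>) * (cmod (u (y + \<tau>) \<tau>) * (cmod (v (y + \<tau>) \<tau>))\<^sup>2)"
    by (rule norm_N1_le)
  also have "\<dots> \<le> (\<bar>\<alpha>\<bar> + 4 * \<bar>\<beta>\<bar>) * ((E * cmod (u0 y)) * (E * (cmod (v0 (y + 2 * \<tau>)))\<^sup>2))"
    using E by (intro mult_left_mono mult_mono U V) auto
  finally show ?thesis by (simp add: D_def E_def power2_eq_square mult_ac)
qed

lemma integrable_v0_shifted:
  "integrable lborel (\<lambda>\<tau>. (cmod (v0 (y + 2 * \<tau>)))\<^sup>2)"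
  using L2_v0 lborel_integrable_real_affine[of "\<lambda>z. (cmod (v0 z))\<^sup>2" 2 y] by (simp add: L2_def)

lemma N1_characteristic_integrable:
  "set_integrable lborel {0..} (\<lambda>\<tau>. N1 \<alpha> \<beta> (u (y + \<tau>) \<tau>) (v (y + \<tau>) \<tau>))"
  unfolding set_integrable_def
proof (rule Bochner_Integration.integrable_bound)
  show "integrable lborel (\<lambda>\<tau>. D * cmod (u0 y) * (cmod (v0 (y + 2 * \<tau>)))\<^sup>2)"
    by (intro integrable_mult_right integrable_v0_shifted)
  have "continuous_on {0..} (\<lambda>\<tau>. N1 \<alpha> \<beta> (u (y + \<tau>) \<tau>) (v (y + \<tau>) \<tau>))"
    by (intro continuous_on_N1 continuous_on_u continuous_on_v continuous_intros) auto
  then show "(\<lambda>\<tau>. indicator {0..} \<tau> *\<^sub>R N1 \<alpha> \<beta> (u (y + \<tau>) \<tau>) (v (y + \<tau>) \<tau>)) \<in> borel_measurable lborel"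
    by (simp add: borel_measurable_continuous_on_indicator)
  show "AE \<tau> in lborel. norm (indicator {0..} \<tau> *\<^sub>R N1 \<alpha> \<beta> (u (y + \<tau>) \<tau>) (v (y + \<tau>) \<tau>))
      \<le> norm (D * cmod (u0 y) * (cmod (v0 (y + 2 * \<tau>)))\<^sup>2)"
    using norm_N1_characteristic_le[of _ y] D_nonneg by (intro AE_I2) (auto simp: indicator_def abs_mult)
qed

lemma tail_integrable: "integrable lborel (\<lambda>z. indicator {z. R \<le> z} z *\<^sub>R (cmod (v0 z))\<^sup>2)"
proof (rule Bochner_Integration.integrable_bound)
  have [measurable]: "v0 \<in> borel_measurable borel" using L2_v0 by (rule L2_measurable)
  show "integrable lborel (\<lambda>z. (cmod (v0 z))\<^sup>2)" using L2_v0 by (simp add: L2_def)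
  show "(\<lambda>z. indicator {z. R \<le> z} z *\<^sub>R (cmod (v0 z))\<^sup>2) \<in> borel_measurable lborel" by measurable
qed (auto simp: indicator_def)

lemma tail_nonneg: "tail R \<ge> 0"
  unfolding tail_def by (intro integral_nonneg_AE) auto

lemma tail_antimono: "R \<le> R' \<Longrightarrow> tail R' \<le> tail R"
  unfolding tail_def by (intro integral_mono tail_integrable) (auto simp: indicator_def)

lemma tail_le_Q: "tail R \<le> Q"
proof -
  have "tail R \<le> (LINT z|lborel. (cmod (v0 z))\<^sup>2)"
    unfolding tail_def using L2_v0
    by (intro integral_mono tail_integrable) (auto simp: indicator_def L2_def)
  also have "\<dots> \<le> Q" unfolding Q_def by (simp add: integral_nonneg_AE)
  finally show ?thesis .
qed

lemma tail_tendsto_0: "(tail \<longlongrightarrow> 0) at_top"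
proof -
  have [measurable]: "v0 \<in> borel_measurable borel" using L2_v0 by (rule L2_measurable)
  have "(tail \<longlongrightarrow> (LINT z|(lborel::real measure). 0)) at_top"
    unfolding tail_def
  proof (rule integral_dominated_convergence_at_top)
    show "integrable lborel (\<lambda>z. (cmod (v0 z))\<^sup>2)" using L2_v0 by (simp add: L2_def)
    show "AE z in lborel. ((\<lambda>R. indicator {z. R \<le> z} z *\<^sub>R (cmod (v0 z))\<^sup>2) \<longlongrightarrow> 0) at_top"
    proof (intro AE_I2 tendsto_eventually)
      fix z :: real
      show "\<forall>\<^sub>F R in at_top. indicator {z. R \<le> z} z *\<^sub>R (cmod (v0 z))\<^sup>2 = 0"
        using eventually_gt_at_top[of z] by eventually_elim auto
    qed
  qed (auto simp: indicator_def)
  then show ?thesis by simp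
qed

text \<open>By the integrated equation the remainder is i times the part of the integral in
  \<open>G1\<close> after time t, and tau > t means that v_0 is evaluated beyond y + 2t.\<close>

lemma remainder_bound:
  assumes t: "t \<ge> 0"
  shows "cmod (remainder y t) \<le> D * cmod (u0 y) * tail (y + 2 * t)"
proof -
  have [measurable]: "v0 \<in> borel_measurable borel" using L2_v0 by (rule L2_measurable)
  let ?n = "\<lambda>\<tau>. N1 \<alpha> \<beta> (u (y + \<tau>) \<tau>) (v (y + \<tau>) \<tau>)"
  note I = N1_characteristic_integrable[of y]
  have I0: "set_integrable lborel {0..t} ?n" by (rule set_integrable_subset[OF I]) auto
  have I1: "set_integrable lborel {t<..} ?n" by (rule set_integrable_subset[OF I]) (use t in auto)
  have "{0..t} \<inter> {t<..} = {}" by auto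
  note split = set_integral_Un[OF this I0 I1]
  have "{0..} = {0..t} \<union> {t<..}" using t by auto
  then have "(LINT \<tau>:{0..}|lborel. ?n \<tau>) = (LINT \<tau>:{0..t}|lborel. ?n \<tau>) + (LINT \<tau>:{t<..}|lborel. ?n \<tau>)"
    by (simp only: split)
  moreover have "(LINT \<tau>:{0..t}|lborel. ?n \<tau>) = integral {0..t} ?n"
    by (rule set_borel_integral_eq_integral(2)[OF I0])
  ultimately have "remainder y t = \<i> * (LINT \<tau>:{t<..}|lborel. ?n \<tau>)"
    unfolding remainder_def G1_def mild_u[OF t] by (simp add: distrib_left)
  then have "cmod (remainder y t) = cmod (LINT \<tau>|lborel. indicator {t<..} \<tau> *\<^sub>R ?n \<tau>)"
    by (simp add: norm_mult set_lebesgue_integral_def)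
  also have "\<dots> \<le> (LINT \<tau>|lborel. D * cmod (u0 y) * (indicator {z. y + 2 * t \<le> z} (y + 2 * \<tau>) *\<^sub>R (cmod (v0 (y + 2 * \<tau>)))\<^sup>2))"
  proof (rule Bochner_Integration.integral_norm_bound_integral)
    show "integrable lborel (\<lambda>\<tau>. indicator {t<..} \<tau> *\<^sub>R ?n \<tau>)" using I1 by (simp add: set_integrable_def)
    show "integrable lborel (\<lambda>\<tau>. D * cmod (u0 y) * (indicator {z. y + 2 * t \<le> z} (y + 2 * \<tau>) *\<^sub>R (cmod (v0 (y + 2 * \<tau>)))\<^sup>2))"
      using lborel_integrable_real_affine[OF tail_integrable, of 2 "y + 2 * t" y] by (intro integrable_mult_right) simp
    fix \<tau> :: real
    show "cmod (indicator {t<..} \<tau> *\<^sub>R ?n \<tau>) \<le> D * cmod (u0 y) * (indicator {z. y + 2 * t \<le> z} (y + 2 * \<tau>) *\<^sub>R (cmod (v0 (y + 2 * \<tau>)))\<^sup>2)"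
      using norm_N1_characteristic_le[of \<tau> y] t D_nonneg by (auto simp: indicator_def)
  qed
  also have "\<dots> = D * cmod (u0 y) * (LINT \<tau>|lborel. indicator {z. y + 2 * t \<le> z} (y + 2 * \<tau>) *\<^sub>R (cmod (v0 (y + 2 * \<tau>)))\<^sup>2)"
    by (rule integral_mult_right_zero)
  also have "(LINT \<tau>|lborel. indicator {z. y + 2 * t \<le> z} (y + 2 * \<tau>) *\<^sub>R (cmod (v0 (y + 2 * \<tau>)))\<^sup>2) = tail (y + 2 * t) / 2"
    unfolding tail_def
    by (subst lborel_integral_real_affine[of 2 _ y]) auto
  \<comment> \<open>The gain 1/2 from the substitution z = y + 2 tau is given away.\<close>
  also have "D * cmod (u0 y) * (tail (y + 2 * t) / 2) \<le> D * cmod (u0 y) * tail (y + 2 * t)"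
    using D_nonneg tail_nonneg by (intro mult_left_mono) auto
  finally show ?thesis .
qed

lemma tail_measurable [measurable]: "tail \<in> borel_measurable borel"
proof -
  have [measurable]: "v0 \<in> borel_measurable borel" using L2_v0 by (rule L2_measurable)
  show ?thesis unfolding tail_def by measurable
qed

text \<open>Measurability of \<open>G1\<close> comes from its being the pointwise limit of the
  continuous functions u(y + n, n) - u_0(y), which the remainder bound provides.\<close>

lemma remainder_measurable:
  assumes t: "t \<ge> 0"
  shows "(\<lambda>y. remainder y t) \<in> borel_measurable borel"
proof -
  have [measurable]: "u0 \<in> borel_measurable borel" using L2_u0 by (rule L2_measurable)
  have m: "(\<lambda>y. u (y + t) t) \<in> borel_measurable borel" if "t \<ge> 0" for t
    using that by (intro borel_measurable_continuous_onI continuous_on_u continuous_intros) auto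
  have lim: "(\<lambda>n. u (y + real n) (real n) - u0 y) \<longlonglongrightarrow> G1 \<alpha> \<beta> u v y" for y
  proof -
    have "filterlim (\<lambda>n. y + 2 * real n) at_top sequentially"
      by (intro filterlim_tendsto_add_at_top[OF tendsto_const] filterlim_tendsto_pos_mult_at_top[OF tendsto_const] filterlim_real_sequentially) auto
    from filterlim_compose[OF tail_tendsto_0 this]
    have "(\<lambda>n. D * cmod (u0 y) * tail (y + 2 * real n)) \<longlonglongrightarrow> 0"
      by (rule tendsto_mult_right_zero)
    then have "(\<lambda>n. remainder y (real n)) \<longlonglongrightarrow> 0"
      by (rule Lim_null_comparison[OF always_eventually, rotated]) (simp add: remainder_bound)
    then show ?thesis unfolding remainder_def by (simp add: LIM_zero_iff)
  qed
  have "G1 \<alpha> \<beta> u v \<in> borel_measurable borel"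
    by (rule borel_measurable_LIMSEQ_metric[OF _ lim]) (intro borel_measurable_diff m; simp)
  then show ?thesis unfolding remainder_def using m[OF t] by measurable
qed

lemma remainder_sq_le:
  assumes "t \<ge> 0"
  shows "(cmod (remainder y t))\<^sup>2 \<le> (D * tail (y + 2 * t))\<^sup>2 * (cmod (u0 y))\<^sup>2"
  using power_mono[OF remainder_bound[OF assms, of y] norm_ge_zero, of 2] by (simp add: power_mult_distrib mult_ac)

lemma majorant_le: "(D * tail R)\<^sup>2 * (cmod (u0 y))\<^sup>2 \<le> (D * Q)\<^sup>2 * (cmod (u0 y))\<^sup>2"
  using D_nonneg tail_nonneg tail_le_Q by (intro mult_right_mono power_mono mult_left_mono) auto

lemma majorant_integrable: "integrable lborel (\<lambda>y. (D * tail (y + 2 * t))\<^sup>2 * (cmod (u0 y))\<^sup>2)"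
proof (rule Bochner_Integration.integrable_bound)
  have [measurable]: "u0 \<in> borel_measurable borel" using L2_u0 by (rule L2_measurable)
  show "integrable lborel (\<lambda>y. (D * Q)\<^sup>2 * (cmod (u0 y))\<^sup>2)"
    using L2_u0 by (intro integrable_mult_right) (simp add: L2_def)
  show "(\<lambda>y. (D * tail (y + 2 * t))\<^sup>2 * (cmod (u0 y))\<^sup>2) \<in> borel_measurable lborel" by measurable
qed (use majorant_le in auto)

lemma remainder_integrable:
  assumes t: "t \<ge> 0"
  shows "integrable lborel (\<lambda>y. (cmod (remainder y t))\<^sup>2)"
proof (rule Bochner_Integration.integrable_bound[OF majorant_integrable[of t]])
  have [measurable]: "(\<lambda>y. remainder y t) \<in> borel_measurable borel" using t by (rule remainder_measurable)
  show "(\<lambda>y. (cmod (remainder y t))\<^sup>2) \<in> borel_measurable lborel" by measurable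
qed (use remainder_sq_le[OF t] in auto)

lemma remainder_L2_tendsto: "((\<lambda>t. LINT y|lborel. (cmod (remainder y t))\<^sup>2) \<longlongrightarrow> 0) at_top"
proof -
  have [measurable]: "u0 \<in> borel_measurable borel" using L2_u0 by (rule L2_measurable)
  have "((\<lambda>t. LINT y|lborel. (D * tail (y + 2 * t))\<^sup>2 * (cmod (u0 y))\<^sup>2) \<longlongrightarrow> (LINT y|(lborel::real measure). 0)) at_top"
  proof (rule integral_dominated_convergence_at_top)
    show "integrable lborel (\<lambda>y. (D * Q)\<^sup>2 * (cmod (u0 y))\<^sup>2)"
      using L2_u0 by (intro integrable_mult_right) (simp add: L2_def)
    show "AE y in lborel. ((\<lambda>t. (D * tail (y + 2 * t))\<^sup>2 * (cmod (u0 y))\<^sup>2) \<longlongrightarrow> 0) at_top"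
    proof (rule AE_I2)
      fix y :: real
      have "filterlim (\<lambda>t. y + 2 * t) at_top at_top"
        by (intro filterlim_tendsto_add_at_top[OF tendsto_const] filterlim_tendsto_pos_mult_at_top[OF tendsto_const] filterlim_ident) auto
      from filterlim_compose[OF tail_tendsto_0 this]
      have "((\<lambda>t. (D * tail (y + 2 * t))\<^sup>2 * (cmod (u0 y))\<^sup>2) \<longlongrightarrow> (D * 0)\<^sup>2 * (cmod (u0 y))\<^sup>2) at_top"
        by (intro tendsto_intros)
      then show "((\<lambda>t. (D * tail (y + 2 * t))\<^sup>2 * (cmod (u0 y))\<^sup>2) \<longlongrightarrow> 0) at_top" by simp
    qed
    show "\<forall>\<^sub>F t in at_top. AE y in lborel. norm ((D * tail (y + 2 * t))\<^sup>2 * (cmod (u0 y))\<^sup>2) \<le> (D * Q)\<^sup>2 * (cmod (u0 y))\<^sup>2"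
      using majorant_le by (intro always_eventually allI AE_I2) auto
  qed measurable
  then have lim: "((\<lambda>t. LINT y|lborel. (D * tail (y + 2 * t))\<^sup>2 * (cmod (u0 y))\<^sup>2) \<longlongrightarrow> 0) at_top" by simp
  show ?thesis
  proof (rule Lim_null_comparison[OF _ lim])
    show "\<forall>\<^sub>F t in at_top. norm (LINT y|lborel. (cmod (remainder y t))\<^sup>2) \<le> (LINT y|lborel. (D * tail (y + 2 * t))\<^sup>2 * (cmod (u0 y))\<^sup>2)"
      using eventually_ge_at_top[of 0]
    proof eventually_elim
      case (elim t)
      have "(LINT y|lborel. (cmod (remainder y t))\<^sup>2) \<le> (LINT y|lborel. (D * tail (y + 2 * t))\<^sup>2 * (cmod (u0 y))\<^sup>2)"
        using elim by (intro integral_mono remainder_integrable majorant_integrable remainder_sq_le)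
      then show ?case by (simp add: integral_nonneg_AE)
    qed
  qed
qed

text \<open>On a bounded range of y the tails are all at most the one at the left end, which tends
  to 0 with time; outside it |u_0| is small and the tail is bounded by Q at all times.\<close>

lemma remainder_uniform:
  assumes e: "e > 0"
  shows "\<forall>\<^sub>F t in at_top. \<forall>y. cmod (remainder y t) \<le> e"
proof -
  define d where "d = e / (D * Q + 1)"
  have DQ: "D * Q \<ge> 0" using D_nonneg Q_nonneg by simp
  have d: "d > 0" using e DQ by (simp add: d_def)
  obtain R where R: "\<And>y. R \<le> \<bar>y\<bar> \<Longrightarrow> cmod (u0 y) < d"
    using tendstoD[OF u0_lim d] by (auto simp: eventually_at_infinity)
  have "compact (u0 ` {-R..R})" by (intro compact_continuous_image continuous_on_u0) auto
  from compact_imp_bounded[OF this]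
  obtain M where M: "M > 0" "\<And>y. y \<in> {-R..R} \<Longrightarrow> cmod (u0 y) \<le> M"
    by (auto simp: bounded_pos)
  have "filterlim (\<lambda>t. - R + 2 * t) at_top at_top"
    by (intro filterlim_tendsto_add_at_top[OF tendsto_const] filterlim_tendsto_pos_mult_at_top[OF tendsto_const] filterlim_ident) auto
  from filterlim_compose[OF tail_tendsto_0 this]
  have "((\<lambda>t. D * M * tail (- R + 2 * t)) \<longlongrightarrow> 0) at_top" by (rule tendsto_mult_right_zero)
  from order_tendstoD(2)[OF this e] eventually_ge_at_top[of 0]
  show ?thesis
  proof eventually_elim
    case (elim t)
    show ?case
    proof
      fix y
      show "cmod (remainder y t) \<le> e"
      proof (cases "y \<in> {-R..R}")
        case True
        have "cmod (remainder y t) \<le> D * cmod (u0 y) * tail (y + 2 * t)" by (rule remainder_bound) (use elim in simp)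
        also have "\<dots> \<le> D * M * tail (- R + 2 * t)"
          using True M D_nonneg tail_nonneg by (intro mult_mono mult_left_mono tail_antimono) auto
        finally show ?thesis using elim by simp
      next
        case False
        then have "cmod (u0 y) < d" by (intro R) auto
        have "cmod (remainder y t) \<le> D * cmod (u0 y) * tail (y + 2 * t)" by (rule remainder_bound) (use elim in simp)
        also have "\<dots> \<le> D * d * Q"
          using \<open>cmod (u0 y) < d\<close> D_nonneg tail_nonneg tail_le_Q d by (intro mult_mono mult_left_mono) auto
        also have "\<dots> \<le> e" using DQ e by (simp add: d_def field_simps)
        finally show ?thesis .
      qed
    qed
  qed
qed

text \<open>Taking the supremum in \<open>ennreal\<close> makes it meaningful without a boundedness
  assumption, so its convergence to 0 also asserts that it is finite for large t.\<close>

lemma u_scattering: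
  shows "t \<ge> 0 \<Longrightarrow> integrable lborel (\<lambda>x. (cmod (u x t - u0 (x - t) - G1 \<alpha> \<beta> u v (x - t)))\<^sup>2)"
    and "((\<lambda>t. LINT x|lborel. (cmod (u x t - u0 (x - t) - G1 \<alpha> \<beta> u v (x - t)))\<^sup>2) \<longlongrightarrow> 0) at_top"
    and "((\<lambda>t. SUP x. ennreal (cmod (u x t - u0 (x - t) - G1 \<alpha> \<beta> u v (x - t)))) \<longlongrightarrow> 0) at_top"
proof -
  \<comment> \<open>The argument is written as \<open>- t + 1 * x\<close> to match the affine
    substitution rule for \<open>lborel\<close>.\<close>
  have eq: "u x t - u0 (x - t) - G1 \<alpha> \<beta> u v (x - t) = remainder (- t + 1 * x) t" for x t
    by (simp add: remainder_def)
  show "integrable lborel (\<lambda>x. (cmod (u x t - u0 (x - t) - G1 \<alpha> \<beta> u v (x - t)))\<^sup>2)" if "t \<ge> 0"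
    unfolding eq using lborel_integrable_real_affine[OF remainder_integrable[OF that], of 1 "- t"] by simp
  have "(LINT x|lborel. (cmod (remainder (- t + 1 * x) t))\<^sup>2) = (LINT y|lborel. (cmod (remainder y t))\<^sup>2)" for t
    using lborel_integral_real_affine[of 1 "\<lambda>y. (cmod (remainder y t))\<^sup>2" "- t"] by simp
  then show "((\<lambda>t. LINT x|lborel. (cmod (u x t - u0 (x - t) - G1 \<alpha> \<beta> u v (x - t)))\<^sup>2) \<longlongrightarrow> 0) at_top"
    unfolding eq using remainder_L2_tendsto by simp
  show "((\<lambda>t. SUP x. ennreal (cmod (u x t - u0 (x - t) - G1 \<alpha> \<beta> u v (x - t)))) \<longlongrightarrow> 0) at_top"
    unfolding eq
  proof (rule order_tendstoI)
    fix a :: ennreal assume "0 < a"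
    then obtain b where b: "0 < b" "b < a" using dense by blast
    then obtain e where e: "b = ennreal e" "e > 0"
      by (cases b) (auto simp: ennreal_zero_less_top)
    from remainder_uniform[OF e(2)]
    show "\<forall>\<^sub>F t in at_top. (SUP x. ennreal (cmod (remainder (- t + 1 * x) t))) < a"
    proof eventually_elim
      case (elim t)
      then have "(SUP x. ennreal (cmod (remainder (- t + 1 * x) t))) \<le> b"
        unfolding e(1) by (intro SUP_least ennreal_leI) auto
      then show ?case using b(2) by (rule le_less_trans)
    qed
  qed simp
qed

end

lemma is_solution_imp_mild_solution:
  assumes s: "s > 1 / 2" and sol: "is_solution \<alpha> \<beta> s u0 v0 u v"
  shows "mild_solution \<alpha> \<beta> u0 v0 u v"
proof
  have u: "C_Hs s u" "transport_eq 1 u (\<lambda>x t. N1 \<alpha> \<beta> (u x t) (v x t))" "\<And>x. u x 0 = u0 x"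
    and v: "C_Hs s v" "transport_eq (-1) v (\<lambda>x t. N2 \<alpha> \<beta> (u x t) (v x t))" "\<And>x. v x 0 = v0 x"
    and i: "in_Hs s u0" "in_Hs s v0"
    using sol by (auto simp: is_solution_def)
  show cu: "continuous_on (UNIV \<times> {0..}) (\<lambda>p. u (fst p) (snd p))"
    by (rule C_Hs_continuous[OF s u(1)])
  show cv: "continuous_on (UNIV \<times> {0..}) (\<lambda>p. v (fst p) (snd p))"
    by (rule C_Hs_continuous[OF s v(1)])
  \<comment> \<open>Membership in H^s leaves a function free on null sets; continuity of the initial
    data comes from the slices of u and v at t = 0.\<close>
  have c0: "continuous_on UNIV u0" "continuous_on UNIV v0"
    using u(1,3) v(1,3) unfolding C_Hs_def by (metis (no_types, lifting) continuous_on_cong order_refl)+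
  show L: "L2 u0" "L2 v0"
    using i by (auto simp: in_Hs_def has_fourier_L2_def)
  show "(u0 \<longlongrightarrow> 0) at_infinity" "(v0 \<longlongrightarrow> 0) at_infinity"
    using L c0 i by (auto intro!: L2_uniformly_continuous_tendsto_0 in_Hs_uniformly_continuous[OF s])
  have cN: "continuous_on (UNIV \<times> {0..}) (\<lambda>p. N1 \<alpha> \<beta> (u (fst p) (snd p)) (v (fst p) (snd p)))"
    "continuous_on (UNIV \<times> {0..}) (\<lambda>p. N2 \<alpha> \<beta> (u (fst p) (snd p)) (v (fst p) (snd p)))"
    unfolding N2_eq_N1 by (intro continuous_on_N1 cu cv)+
  fix y t :: real assume t: "t \<ge> 0"
  show "u (y + t) t = u0 y - \<i> * integral {0..t} (\<lambda>\<tau>. N1 \<alpha> \<beta> (u (y + \<tau>) \<tau>) (v (y + \<tau>) \<tau>))"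
    using transport_eq_imp_mild[OF u(2) cu cN(1) t, of y] by (simp add: u(3))
  show "v (y - t) t = v0 y - \<i> * integral {0..t} (\<lambda>\<tau>. N2 \<alpha> \<beta> (u (y - \<tau>) \<tau>) (v (y - \<tau>) \<tau>))"
    using transport_eq_imp_mild[OF v(2) cv cN(2) t, of y] by (simp add: v(3))
qed

theorem theorem1p1:
  fixes \<alpha> \<beta> s :: real
    and u0 v0 :: "real \<Rightarrow> complex"
    and u v :: "real \<Rightarrow> real \<Rightarrow> complex"
  assumes "s > 1 / 2"
    and "is_solution \<alpha> \<beta> s u0 v0 u v"
  shows
    "(\<forall>y. set_integrable lborel {0..} (\<lambda>\<tau>. N1 \<alpha> \<beta> (u (y + \<tau>) \<tau>) (v (y + \<tau>) \<tau>)))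
     \<and> (\<forall>y. set_integrable lborel {0..} (\<lambda>\<tau>. N2 \<alpha> \<beta> (u (y - \<tau>) \<tau>) (v (y - \<tau>) \<tau>)))
     \<and> (\<forall>t\<ge>0. integrable lborel (\<lambda>x. (cmod (u x t - u0 (x - t) - G1 \<alpha> \<beta> u v (x - t)))\<^sup>2))
     \<and> (\<forall>t\<ge>0. integrable lborel (\<lambda>x. (cmod (v x t - v0 (x + t) - G2 \<alpha> \<beta> u v (x + t)))\<^sup>2))
     \<and> ((\<lambda>t. LINT x|lborel. (cmod (u x t - u0 (x - t) - G1 \<alpha> \<beta> u v (x - t)))\<^sup>2) \<longlongrightarrow> 0) at_top
     \<and> ((\<lambda>t. LINT x|lborel. (cmod (v x t - v0 (x + t) - G2 \<alpha> \<beta> u v (x + t)))\<^sup>2) \<longlongrightarrow> 0) at_top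
     \<and> ((\<lambda>t. SUP x. ennreal (cmod (u x t - u0 (x - t) - G1 \<alpha> \<beta> u v (x - t)))) \<longlongrightarrow> 0) at_top
     \<and> ((\<lambda>t. SUP x. ennreal (cmod (v x t - v0 (x + t) - G2 \<alpha> \<beta> u v (x + t)))) \<longlongrightarrow> 0) at_top"
proof -
  interpret mild_solution \<alpha> \<beta> u0 v0 u v
    by (rule is_solution_imp_mild_solution[OF assms])
  interpret r: mild_solution \<alpha> \<beta> "\<lambda>x. v0 (- x)" "\<lambda>x. u0 (- x)" "\<lambda>x t. v (- x) t" "\<lambda>x t. u (- x) t"
    by (rule reflected)
  \<comment> \<open>Under reflection the second profile becomes the first profile of the exchanged
    pair, evaluated at the opposite point.\<close>
  have G: "G1 \<alpha> \<beta> (\<lambda>x t. v (- x) t) (\<lambda>x t. u (- x) t) y = G2 \<alpha> \<beta> u v (- y)" for y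
    by (simp add: G1_def G2_def N2_eq_N1)
  define f where "f = (\<lambda>t x. cmod (v x t - v0 (x + t) - G2 \<alpha> \<beta> u v (x + t)))"
  have f: "cmod (v (- x) t - v0 (- (x - t)) - G1 \<alpha> \<beta> (\<lambda>x t. v (- x) t) (\<lambda>x t. u (- x) t) (x - t)) = f t (- x)" for x t
    by (simp add: f_def G)
  have N2: "set_integrable lborel {0..} (\<lambda>\<tau>. N2 \<alpha> \<beta> (u (y - \<tau>) \<tau>) (v (y - \<tau>) \<tau>))" for y
    using r.N1_characteristic_integrable[of "- y"] by (simp add: N2_eq_N1)
  have int: "integrable lborel (\<lambda>x. (f t x)\<^sup>2)" if "t \<ge> 0" for t
    using lborel_integrable_real_affine[OF r.u_scattering(1)[OF that, unfolded f], of "-1" 0] by simp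
  have "(LINT x|lborel. (f t (- x))\<^sup>2) = (LINT x|lborel. (f t x)\<^sup>2)" for t
    using lborel_integral_real_affine[of "-1" "\<lambda>x. (f t x)\<^sup>2" 0] by simp
  then have l2: "((\<lambda>t. LINT x|lborel. (f t x)\<^sup>2) \<longlongrightarrow> 0) at_top"
    using r.u_scattering(2) unfolding f by simp
  have "(SUP x. ennreal (f t (- x))) = (SUP x. ennreal (f t x))" for t
    by (rule SUP_eq) (metis UNIV_I minus_minus order_refl)+
  then have sup: "((\<lambda>t. SUP x. ennreal (f t x)) \<longlongrightarrow> 0) at_top"
    using r.u_scattering(3) unfolding f by simp
  show ?thesis
    using N1_characteristic_integrable N2 u_scattering int l2 sup unfolding f_def by blast
qed

end
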